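(* Let $0<\alpha_2<\alpha_1<1$, $c_1>0$, $c_2\ge0$, $c_1+c_2=1$. Let $\mathcal B^{\alpha_1,\alpha_2}$ be the busy period of the mixed time-changed Erlang queue and $F_{\mathcal B^{\alpha_1,\alpha_2}}(t)=\Pr(\mathcal B^{\alpha_1,\alpha_2}\le t)$ its distribution function. Then, for $t>0$, $$F_{\mathcal B^{\alpha_1,\alpha_2}}(t)=\sum_{h=0}^\infty\frac{k\mu\,A^0_{k,h}}{c_1^{a^0_{k,h}}}\,h_{a^0_{k,h}}^{*(a^0_{k,h})}(t),$$ where, for integers $m\ge1$, $r\ge0$, $a^0_{m,r}=m+r(k+1)$ and $A^0_{m,r}=\dfrac{m\lambda^r(k\mu)^{m+rk-1}}{r!\,(m+rk)!}(m+r(k+1)-1)!$, and for $N\in\mathbb N$ $$h_N(t)=t^{\alpha_1-\frac{N-1}{N}}\sum_{j=0}^\infty\Big(-\frac{c_2}{c_1}\Big)^jt^{(\alpha_1-\alpha_2)j}E^{j+1}_{\alpha_1,\,\alpha_1+(\alpha_1-\alpha_2)j+\frac1N}\Big(-\frac{\lambda+k\mu}{c_1}t^{\alpha_1}\Big),$$ with $h_N^{*(N)}$ the $N$-fold convolution of $h_N$.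
   Context: Parameters: $\lambda>0$, $\mu>0$, $k\in\mathbb N=\{1,2,\dots\}$. Erlang queue: single-server queue with Poisson arrivals of rate $\lambda$, each service consisting of $k$ successive phases, each exponential with parameter $k\mu$, all independent. $\mathcal Q(t)=(\mathcal N(t),\mathcal S(t))$, where $\mathcal N(t)$ is the number of customers in the system and $\mathcal S(t)$ is the phase of the customer being served if $\mathcal N(t)>0$ (phases are counted down: service starts at phase $k$ and ends upon completion of phase $1$), with $\mathcal S(t)=0$ if $\mathcal N(t)=0$. Thus $\mathcal Q$ is the continuous-time Markov chain on $\mathcal H_0=\mathcal H\cup\{(0,0)\}$, $\mathcal H=\{(n,s)\in\mathbb N\times\mathbb N: s\le k\}$, with $\mathcal Q(0)=(0,0)$ and transition rates: $(0,0)\to(1,k)$ at rate $\lambda$; $(n,s)\to(n+1,s)$ at rate $\lambda$; $(n,s)\to(n,s-1)$ at rate $k\mu$ if $s\ge2$; $(n,1)\to(n-1,k)$ at rate $k\mu$ if $n\ge2$; $(1,1)\to(0,0)$ at rate $k\mu$. Inverse mixed stable subordinator: $\{D_{\alpha_1,\alpha_2}(t)\}_{t\ge0}$ is the nondecreasing Lévy process (started at $0$) with $\mathbb E(e^{-zD_{\alpha_1,\alpha_2}(t)})=e^{-t(c_1z^{\alpha_1}+c_2z^{\alpha_2})}$, $z>0$; $Y_{\alpha_1,\alpha_2}(t)=\inf\{s\ge0:D_{\alpha_1,\alpha_2}(s)>t\}$, $t>0$, $Y_{\alpha_1,\alpha_2}(0)=0$. Mixed time-changed Erlang queue: $\mathcal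 Q^{\alpha_1,\alpha_2}(t)=\mathcal Q(Y_{\alpha_1,\alpha_2}(t))$, with $\mathcal Q$ and $Y_{\alpha_1,\alpha_2}$ independent. Its busy period is the duration of time from when the first customer enters the empty system until the system becomes empty again (possibly infinite). Three-parameter Mittag-Leffler function: $E^\gamma_{\alpha,\beta}(t)=\sum_{r=0}^\infty\frac{\Gamma(\gamma+r)t^r}{r!\,\Gamma(\gamma)\Gamma(\alpha r+\beta)}$, $t\in\mathbb R$, $\alpha,\beta,\gamma>0$. Convolution of functions on $(0,\infty)$: $(f*g)(t)=\int_0^tf(t-u)g(u)\,\mathrm du$, $f^{*(1)}=f$, $f^{*(N+1)}=f*f^{*(N)}$. Convention $0^0=1$. *)

theory Defs
  imports "HOL-Probability.Probability"
begin

section \<open>Continuous-time Markov chains on a discrete state space\<close>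

definition exit_rate :: "('s \<Rightarrow> 's \<Rightarrow> real) \<Rightarrow> 's \<Rightarrow> real" where
  "exit_rate q x = (\<Sum>\<^sub>\<infinity>y\<in>-{x}. q x y)"

definition jump_prob :: "('s \<Rightarrow> 's \<Rightarrow> real) \<Rightarrow> 's \<Rightarrow> 's \<Rightarrow> real" where
  "jump_prob q x y = (if y = x then 0 else q x y / exit_rate q x)"

text \<open>The Markov chain with transition rates \<open>q x y\<close> (\<open>x \<noteq> y\<close>) and initial state \<open>x0\<close>, described
  by its jump chain \<open>Z\<close> and holding times \<open>S\<close>: \<open>Z\<close> is a discrete-time Markov chain with transition
  matrix \<open>jump_prob q\<close> and, given \<open>Z\<close>, the \<open>S i\<close> are independent exponential variables with
  parameters \<open>exit_rate q (Z i)\<close>. Both properties are contained in the product formula for the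
  joint law. Holding times are finite, so this is meant for chains without reachable absorbing
  states; the path is not constrained after a possible explosion (there is none if the exit rates
  are bounded).\<close>

definition markov_chain_with_rates ::
    "'w measure \<Rightarrow> ('s \<Rightarrow> 's \<Rightarrow> real) \<Rightarrow> 's \<Rightarrow> (real \<Rightarrow> 'w \<Rightarrow> 's) \<Rightarrow> bool" where
  "markov_chain_with_rates M q x0 X \<longleftrightarrow>
    (\<forall>t\<ge>0. X t \<in> measurable M (count_space UNIV)) \<and>
    (\<exists>(Z :: nat \<Rightarrow> 'w \<Rightarrow> 's) (S :: nat \<Rightarrow> 'w \<Rightarrow> real).
      (\<forall>i. Z i \<in> measurable M (count_space UNIV)) \<and>
      (\<forall>i. S i \<in> borel_measurable M) \<and>
      (\<forall>n (z :: nat \<Rightarrow> 's) (s :: nat \<Rightarrow> real). (\<forall>i<n. 0 \<le> s i) \<longrightarrow>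
        measure M {\<omega> \<in> space M. (\<forall>i\<le>n. Z i \<omega> = z i) \<and> (\<forall>i<n. s i < S i \<omega>)} =
          of_bool (z 0 = x0) *
          (\<Prod>i<n. jump_prob q (z i) (z (Suc i)) * exp (- exit_rate q (z i) * s i))) \<and>
      (AE \<omega> in M. \<forall>n t. (\<Sum>i<n. S i \<omega>) \<le> t \<and> t < (\<Sum>i<Suc n. S i \<omega>) \<longrightarrow> X t \<omega> = Z n \<omega>))"

section \<open>The Erlang queue\<close>

text \<open>A state \<open>(n, s)\<close> records the number of customers and the phase of the customer in service.
  Pairs outside the state space \<open>{(n, s). 1 \<le> n \<and> 1 \<le> s \<and> s \<le> k} \<union> {(0, 0)}\<close> have no outgoing
  rates, and no rate leads to them from inside.\<close>

fun erlang_rate :: "real \<Rightarrow> real \<Rightarrow> nat \<Rightarrow> nat \<times> nat \<Rightarrow> nat \<times> nat \<Rightarrow> real" where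
  "erlang_rate lam mu k (n, s) y =
    (if (n, s) = (0, 0) then (if y = (1, k) then lam else 0)
     else if 1 \<le> n \<and> 1 \<le> s \<and> s \<le> k then
       (if y = (n + 1, s) then lam
        else if 2 \<le> s \<and> y = (n, s - 1) then real k * mu
        else if s = 1 \<and> 2 \<le> n \<and> y = (n - 1, k) then real k * mu
        else if s = 1 \<and> n = 1 \<and> y = (0, 0) then real k * mu
        else 0)
     else 0)"

definition erlang_queue ::
    "'w measure \<Rightarrow> real \<Rightarrow> real \<Rightarrow> nat \<Rightarrow> (real \<Rightarrow> 'w \<Rightarrow> nat \<times> nat) \<Rightarrow> bool" where
  "erlang_queue M lam mu k Q \<longleftrightarrow> markov_chain_with_rates M (erlang_rate lam mu k) (0, 0) Q"

text \<open>The busy period of a path: from the first time at which the system is non-empty until the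
  first subsequent time at which it is empty. It is \<open>\<infinity>\<close> if either of these never happens
  (note \<open>\<infinity> - \<infinity> = \<infinity>\<close> in \<^typ>\<open>ereal\<close>).\<close>

definition busy_start :: "(real \<Rightarrow> nat \<times> nat) \<Rightarrow> ereal" where
  "busy_start x = (INF t\<in>{t. 0 \<le> t \<and> fst (x t) \<noteq> 0}. ereal t)"

definition busy_end :: "(real \<Rightarrow> nat \<times> nat) \<Rightarrow> ereal" where
  "busy_end x = (INF t\<in>{t. busy_start x < ereal t \<and> fst (x t) = 0}. ereal t)"

definition busy_period :: "(real \<Rightarrow> nat \<times> nat) \<Rightarrow> ereal" where
  "busy_period x = busy_end x - busy_start x"

section \<open>Mixed stable subordinators and the time change\<close>

definition nondecreasing_levy_process :: "'w measure \<Rightarrow> (real \<Rightarrow> 'w \<Rightarrow> real) \<Rightarrow> bool" where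
  "nondecreasing_levy_process M D \<longleftrightarrow>
    (\<forall>t\<ge>0. D t \<in> borel_measurable M) \<and>
    (AE \<omega> in M. D 0 \<omega> = 0) \<and>
    (\<forall>n (\<tau> :: nat \<Rightarrow> real). 0 \<le> \<tau> 0 \<and> mono \<tau> \<longrightarrow>
      prob_space.indep_vars M (\<lambda>_. borel) (\<lambda>i \<omega>. D (\<tau> (Suc i)) \<omega> - D (\<tau> i) \<omega>) {..<n}) \<and>
    (\<forall>s\<ge>0. \<forall>t\<ge>0. distr M borel (\<lambda>\<omega>. D (s + t) \<omega> - D s \<omega>) = distr M borel (D t)) \<and>
    (AE \<omega> in M. mono_on {0..} (\<lambda>t. D t \<omega>) \<and> (\<forall>t\<ge>0. continuous (at_right t) (\<lambda>s. D s \<omega>)))"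

definition mixed_stable_subordinator ::
    "'w measure \<Rightarrow> real \<Rightarrow> real \<Rightarrow> real \<Rightarrow> real \<Rightarrow> (real \<Rightarrow> 'w \<Rightarrow> real) \<Rightarrow> bool" where
  "mixed_stable_subordinator M \<alpha>1 \<alpha>2 c1 c2 D \<longleftrightarrow>
    nondecreasing_levy_process M D \<and>
    (\<forall>t\<ge>0. \<forall>z>0. (\<integral>\<omega>. exp (- z * D t \<omega>) \<partial>M) = exp (- t * (c1 * z powr \<alpha>1 + c2 * z powr \<alpha>2)))"

text \<open>The infimum is over a non-empty set for almost every \<open>\<omega>\<close>, because a mixed stable
  subordinator is almost surely unbounded.\<close>

definition inverse_process :: "(real \<Rightarrow> 'w \<Rightarrow> real) \<Rightarrow> real \<Rightarrow> 'w \<Rightarrow> real" where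
  "inverse_process D t \<omega> = (if t = 0 then 0 else Inf {s. 0 \<le> s \<and> t < D s \<omega>})"

text \<open>Independence of the sigma-algebras generated by the two processes. (\<open>indep_var\<close> is not used since
  it needs both random elements to have the same type; like it, \<open>indep_set\<close> includes
  measurability.)\<close>

definition process_algebra :: "'w measure \<Rightarrow> 'b measure \<Rightarrow> (real \<Rightarrow> 'w \<Rightarrow> 'b) \<Rightarrow> 'w measure" where
  "process_algebra M N X =
    vimage_algebra (space M) (\<lambda>\<omega>. \<lambda>t\<in>{0..}. X t \<omega>) (PiM {0..} (\<lambda>_. N))"

definition indep_processes ::
    "'w measure \<Rightarrow> (real \<Rightarrow> 'w \<Rightarrow> nat \<times> nat) \<Rightarrow> (real \<Rightarrow> 'w \<Rightarrow> real) \<Rightarrow> bool" where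
  "indep_processes M X Y \<longleftrightarrow>
    prob_space.indep_set M (sets (process_algebra M (count_space UNIV) X))
      (sets (process_algebra M borel Y))"

definition time_change :: "(real \<Rightarrow> 'w \<Rightarrow> 's) \<Rightarrow> (real \<Rightarrow> 'w \<Rightarrow> real) \<Rightarrow> real \<Rightarrow> 'w \<Rightarrow> 's" where
  "time_change X Y t \<omega> = X (Y t \<omega>) \<omega>"

text \<open>Path properties are only required almost surely, so the event that the busy period is at most
  \<open>t\<close> may differ from a member of the sigma-algebra by part of a null set; hence the completion.\<close>

definition busy_period_cdf :: "'w measure \<Rightarrow> (real \<Rightarrow> 'w \<Rightarrow> nat \<times> nat) \<Rightarrow> real \<Rightarrow> real" where
  "busy_period_cdf M X t =
    measure (completion M) {\<omega> \<in> space M. busy_period (\<lambda>s. X s \<omega>) \<le> ereal t}"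

section \<open>The functions in the series\<close>

definition mittag_leffler3 :: "real \<Rightarrow> real \<Rightarrow> real \<Rightarrow> real \<Rightarrow> real" where
  "mittag_leffler3 \<gamma> \<alpha> \<beta> x =
    (\<Sum>r. Gamma (\<gamma> + real r) * x ^ r / (fact r * Gamma \<gamma> * Gamma (\<alpha> * real r + \<beta>)))"

definition fun_conv :: "(real \<Rightarrow> real) \<Rightarrow> (real \<Rightarrow> real) \<Rightarrow> real \<Rightarrow> real" where
  "fun_conv f g t = (LINT u:{0<..<t}|lborel. f (t - u) * g u)"

text \<open>The \<open>N\<close>-fold convolution; only meaningful for \<open>N \<ge> 1\<close>.\<close>

definition conv_power :: "(real \<Rightarrow> real) \<Rightarrow> nat \<Rightarrow> real \<Rightarrow> real" where
  "conv_power f N = (fun_conv f ^^ (N - 1)) f"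

definition h_fun ::
    "real \<Rightarrow> real \<Rightarrow> nat \<Rightarrow> real \<Rightarrow> real \<Rightarrow> real \<Rightarrow> real \<Rightarrow> nat \<Rightarrow> real \<Rightarrow> real" where
  "h_fun lam mu k \<alpha>1 \<alpha>2 c1 c2 N t =
    t powr (\<alpha>1 - (real N - 1) / real N) *
    (\<Sum>j. (- (c2 / c1)) ^ j * t powr ((\<alpha>1 - \<alpha>2) * real j) *
      mittag_leffler3 (real j + 1) \<alpha>1 (\<alpha>1 + (\<alpha>1 - \<alpha>2) * real j + 1 / real N)
        (- ((lam + real k * mu) / c1) * t powr \<alpha>1))"

definition a0 :: "nat \<Rightarrow> nat \<Rightarrow> nat \<Rightarrow> nat" where
  "a0 k m r = m + r * (k + 1)"

definition A0 :: "real \<Rightarrow> real \<Rightarrow> nat \<Rightarrow> nat \<Rightarrow> nat \<Rightarrow> real" where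
  "A0 lam mu k m r =
    real m * lam ^ r * (real k * mu) ^ (m + r * k - 1) / (fact r * fact (m + r * k)) *
    fact (m + r * (k + 1) - 1)"

end

theory Submission
  imports Defs "HOL-Real_Asymp.Real_Asymp"
begin

text \<open>Let \<open>\<sigma>\<close> and \<open>\<rho>\<close> be the start and the end of the first busy period of the Erlang queue. Since a
  mixed stable subordinator \<open>D\<close> is strictly increasing, its inverse reaches the level \<open>s\<close> exactly at
  time \<open>D(s-)\<close>, so the busy period of the time-changed queue is \<open>D(\<rho>-) - D(\<sigma>-)\<close>. By independence
  its Laplace transform at \<open>z\<close> is that of \<open>\<rho> - \<sigma>\<close> at \<open>\<phi>(z) = c1 z^\<alpha>1 + c2 z^\<alpha>2\<close>. Counting service
  phases, the queue performs a walk with steps \<open>+k\<close> and \<open>-1\<close> from \<open>k\<close> to \<open>0\<close>; by the ballot theorem the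
  cycles with \<open>h\<close> arrivals, which consist of \<open>a = k + h(k+1)\<close> jumps, contribute
  \<open>k \<mu> A / (\<lambda> + k \<mu> + \<phi>(z))^a\<close>. On the other side the double series defining \<open>h_N\<close> can be transformed
  term by term, which gives \<open>c1 z^(-1/N) / (\<lambda> + k \<mu> + \<phi>(z))\<close>, so that its \<open>N\<close>-fold convolution has the
  transform \<open>c1^N / (z (\<lambda> + k \<mu> + \<phi>(z))^N)\<close>. Uniqueness of Laplace transforms of right-continuous
  functions identifies the summands one by one.\<close>

section \<open>Uniqueness of the Laplace transform\<close>

text \<open>The event that the busy period is at most t is split by the number of jumps in the first
  cycle. Countable additivity then supplies the outer series, so no sum over h has to be inverted:
  each piece is a restricted distribution function whose transform is a rational function of z and
  \<phi>(z). A busy period that never ends has value \<infinity> > t and contributes nothing, so a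
  total mass below 1 is harmless. The factor 1/z that distinguishes a distribution function from a
  density is the origin of the exponent 1/N in h_N. Transforms are compared only on a half-line z >
  c, where the double series for h_N converges absolutely; one c serves for all N. Left limits enter
  because D jumps: the inverse stays at level s throughout [D(s-), D(s)) and arrives there at the
  beginning of this interval. The random levels \<sigma> and \<rho> are therefore approached from
  below on a grid with countably many points, so that independence and the law of the increments are
  applied at fixed levels only.\<close>

definition laplace :: "(real \<Rightarrow> real) \<Rightarrow> real \<Rightarrow> real" where
  "laplace f z = (LINT t:{0<..}|lborel. exp (- z * t) * f t)"

text \<open>With \<open>x = exp (- t)\<close> the hypothesis says that \<open>F\<close> is orthogonal to all polynomials in \<open>x\<close>.\<close>

lemma exp_moments_zero_imp_continuous_zero:
  fixes F :: "real \<Rightarrow> real"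
  assumes int: "integrable lborel F" and supp: "\<And>t. t \<le> 0 \<Longrightarrow> F t = 0"
    and zero: "\<And>n::nat. (\<integral>t. exp (- t) ^ n * F t \<partial>lborel) = 0"
    and cont: "continuous_on {0..1} \<psi>" and meas: "\<psi> \<in> borel_measurable borel"
  shows "(\<integral>t. \<psi> (exp (- t)) * F t \<partial>lborel) = 0"
proof -
  have bdd_int: "integrable lborel (\<lambda>t. g (exp (- t)) * F t)"
    if "g \<in> borel_measurable borel" "\<And>x. x \<in> {0..1} \<Longrightarrow> \<bar>g x\<bar> \<le> C" for g :: "real \<Rightarrow> real" and C
  proof (rule Bochner_Integration.integrable_bound[of _ "\<lambda>t. C * F t"])
    show "integrable lborel (\<lambda>t. C * F t)" using int by simp
    show "(\<lambda>t. g (exp (- t)) * F t) \<in> borel_measurable lborel"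
      using that(1) int by measurable
    show "AE t in lborel. norm (g (exp (- t)) * F t) \<le> norm (C * F t)"
    proof (intro AE_I2)
      fix t :: real
      show "norm (g (exp (- t)) * F t) \<le> norm (C * F t)"
      proof (cases "t \<le> 0")
        case False
        then have "\<bar>g (exp (- t))\<bar> \<le> C" using that(2)[of "exp (-t)"] by simp
        then have "\<bar>g (exp (- t))\<bar> \<le> \<bar>C\<bar>" by linarith
        then show ?thesis by (simp add: abs_mult mult_right_mono)
      qed (simp add: supp)
    qed
  qed
  \<comment> \<open>Bernstein polynomials are combinations of x^i (1 - x)^m, so these mixed moments
    are the ones needed. Each factor 1 - x is peeled off as a difference of two moments with one
    such factor fewer.\<close>
  have mon: "(\<integral>t. exp (- t) ^ i * (1 - exp (- t)) ^ m * F t \<partial>lborel) = 0" for i m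
  proof (induction m arbitrary: i)
    case 0 show ?case using zero by simp
  next
    case (Suc m)
    have I: "integrable lborel (\<lambda>t. exp (- t) ^ i * (1 - exp (- t)) ^ m * F t)" for i
      by (rule bdd_int[of "\<lambda>x. x ^ i * (1 - x) ^ m" 1])
        (auto simp: abs_mult power_abs intro!: mult_le_one power_le_one)
    have "(\<integral>t. exp (- t) ^ i * (1 - exp (- t)) ^ Suc m * F t \<partial>lborel) =
      (\<integral>t. (exp (- t) ^ i * (1 - exp (- t)) ^ m * F t - exp (- t) ^ Suc i * (1 - exp (- t)) ^ m * F t) \<partial>lborel)"
      by (intro Bochner_Integration.integral_cong) (auto simp: algebra_simps)
    also have "\<dots> = 0"
      by (subst Bochner_Integration.integral_diff[OF I I]) (simp only: Suc.IH diff_0_right)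
    finally show ?case .
  qed
  define K where "K = (\<integral>t. \<bar>F t\<bar> \<partial>lborel)"
  have K0: "K \<ge> 0" unfolding K_def by simp
  have "\<bar>\<integral>t. \<psi> (exp (- t)) * F t \<partial>lborel\<bar> \<le> e * K" if e: "e > 0" for e
  proof -
    obtain n where n: "\<And>x. x \<in> {0..1} \<Longrightarrow> \<bar>\<psi> x - (\<Sum>k\<le>n. \<psi> (k / n) * Bernstein n k x)\<bar> < e"
      using Bernstein_Weierstrass[OF cont e] by blast
    define p where "p x = (\<Sum>k\<le>n. \<psi> (k / n) * Bernstein n k x)" for x
    have Bm [measurable]: "Bernstein n k \<in> borel_measurable borel" for k
      unfolding Bernstein_def by measurable
    have pm: "p \<in> borel_measurable borel" unfolding p_def by measurable
    have n': "\<bar>\<psi> x - p x\<bar> \<le> e" if "x \<in> {0..1}" for x using n[OF that] unfolding p_def by simp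
    obtain C where C: "\<And>x. x \<in> {0..1} \<Longrightarrow> \<bar>\<psi> x\<bar> \<le> C"
      using compact_imp_bounded[OF compact_continuous_image[OF cont]]
      unfolding bounded_iff by (metis compact_Icc image_eqI real_norm_def)
    have I1: "integrable lborel (\<lambda>t. \<psi> (exp (- t)) * F t)" using bdd_int[OF meas C] .
    have I2: "integrable lborel (\<lambda>t. (\<psi> (exp (- t)) - p (exp (- t))) * F t)"
      using pm meas n' by (intro bdd_int[of "\<lambda>x. \<psi> x - p x" e]) auto
    have Ik: "integrable lborel (\<lambda>t. Bernstein n k (exp (- t)) * F t)" if "k \<le> n" for k
      by (rule bdd_int[of "Bernstein n k" "n choose k", OF Bm])
        (auto simp: abs_mult power_abs Bernstein_def mult.assoc intro!: mult_left_le mult_le_one power_le_one)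
    have "(\<integral>t. p (exp (- t)) * F t \<partial>lborel) =
        (\<integral>t. (\<Sum>k\<le>n. \<psi> (k / n) * (Bernstein n k (exp (- t)) * F t)) \<partial>lborel)"
      unfolding p_def by (simp add: sum_distrib_right mult.assoc)
    also have "\<dots> = (\<Sum>k\<le>n. \<psi> (k / n) * (\<integral>t. Bernstein n k (exp (- t)) * F t \<partial>lborel))"
      using Ik by (subst Bochner_Integration.integral_sum) auto
    also have "\<dots> = 0"
    proof (rule sum.neutral, safe)
      fix k assume "k \<le> n"
      have "(\<integral>t. Bernstein n k (exp (- t)) * F t \<partial>lborel) = 
         (\<integral>t. (n choose k) * (exp (- t) ^ k * (1 - exp (- t)) ^ (n - k) * F t) \<partial>lborel)"
        by (simp add: Bernstein_def mult.assoc)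
      also have "\<dots> = 0" by (simp only: integral_mult_right_zero mon mult_zero_right)
      finally show "\<psi> (k / n) * (\<integral>t. Bernstein n k (exp (- t)) * F t \<partial>lborel) = 0" by simp
    qed
    finally have p0: "(\<integral>t. p (exp (- t)) * F t \<partial>lborel) = 0" .
    have Ip: "integrable lborel (\<lambda>t. p (exp (- t)) * F t)"
      using Bochner_Integration.integrable_diff[OF I1 I2] by (simp add: algebra_simps)
    have "(\<integral>t. \<psi> (exp (- t)) * F t \<partial>lborel) = (\<integral>t. (\<psi> (exp (- t)) - p (exp (- t))) * F t \<partial>lborel)"
      using Bochner_Integration.integral_diff[OF I1 Ip] p0 by (simp add: algebra_simps)
    also have "\<bar>\<dots>\<bar> \<le> (\<integral>t. \<bar>(\<psi> (exp (- t)) - p (exp (- t))) * F t\<bar> \<partial>lborel)"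
      by (rule integral_abs_bound)
    also have "\<dots> \<le> (\<integral>t. e * \<bar>F t\<bar> \<partial>lborel)"
    proof (rule integral_mono)
      fix t show "\<bar>(\<psi> (exp (- t)) - p (exp (- t))) * F t\<bar> \<le> e * \<bar>F t\<bar>"
        by (cases "t \<le> 0") (use n' in \<open>auto simp: supp abs_mult intro!: mult_right_mono\<close>)
    qed (use I2 int in auto)
    also have "\<dots> = e * K" by (simp add: K_def)
    finally show ?thesis .
  qed note B = this
  have "\<bar>\<integral>t. \<psi> (exp (- t)) * F t \<partial>lborel\<bar> \<le> 0"
  proof (rule field_le_epsilon)
    fix e :: real assume "e > 0"
    have "\<bar>\<integral>t. \<psi> (exp (- t)) * F t \<partial>lborel\<bar> \<le> e / (K + 1) * K"
      using B[of "e / (K+1)"] \<open>e > 0\<close> K0 by simp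
    also have "\<dots> \<le> e" using K0 \<open>e > 0\<close> by (simp add: field_simps)
    finally show "\<bar>\<integral>t. \<psi> (exp (- t)) * F t \<partial>lborel\<bar> \<le> 0 + e" by simp
  qed
  then show ?thesis by simp
qed

text \<open>In the variable x = exp (- t) the set {..a} becomes x \<ge> exp (- a). Its indicator is
  the limit of the continuous ramps \<open>\<psi> n\<close>, which equal 1 there and fall to 0
  within distance 1/n below exp (- a); dominated convergence carries the vanishing integrals
  over.\<close>

lemma exp_moments_zero_imp_integral_zero:
  fixes F :: "real \<Rightarrow> real"
  assumes int: "integrable lborel F" and supp: "\<And>t. t \<le> 0 \<Longrightarrow> F t = 0"
    and zero: "\<And>n::nat. (\<integral>t. exp (- t) ^ n * F t \<partial>lborel) = 0"
  shows "(\<integral>t. indicator {..a} t * F t \<partial>lborel) = 0"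
proof -
  define \<psi> where "\<psi> n x = min 1 (max 0 (1 + real n * (x - exp (- a))))" for n x
  have "(\<lambda>n. \<integral>t. \<psi> n (exp (- t)) * F t \<partial>lborel) \<longlonglongrightarrow> (\<integral>t. indicator {..a} t * F t \<partial>lborel)"
  proof (rule integral_dominated_convergence[where w = "\<lambda>t. \<bar>F t\<bar>"])
    show "AE t in lborel. (\<lambda>n. \<psi> n (exp (- t)) * F t) \<longlonglongrightarrow> indicator {..a} t * F t"
    proof (intro AE_I2 tendsto_mult tendsto_const)
      fix t
      show "(\<lambda>n. \<psi> n (exp (- t))) \<longlonglongrightarrow> indicator {..a} t"
      proof (cases "t \<le> a")
        case True
        then have "\<psi> n (exp (- t)) = 1" for n by (auto simp: \<psi>_def min_def max_def not_le)
        then show ?thesis using True by simp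
      next
        case False
        define d where "d = exp (- a) - exp (- t)"
        have d: "d > 0" using False by (simp add: d_def)
        have "eventually (\<lambda>n. \<psi> n (exp (- t)) = 0) sequentially"
          using eventually_ge_at_top[of "nat \<lceil>1 / d\<rceil>"]
        proof eventually_elim
          case (elim n)
          then have "1 / d \<le> real n" by linarith
          then have "1 \<le> real n * d" using d by (simp add: field_simps)
          then show ?case by (simp add: \<psi>_def d_def algebra_simps)
        qed
        then show ?thesis using False by (simp add: tendsto_eventually)
      qed
    qed
    show "AE t in lborel. norm (\<psi> n (exp (- t)) * F t) \<le> \<bar>F t\<bar>" for n
      by (intro AE_I2) (auto simp: abs_mult \<psi>_def intro!: mult_left_le_one_le)
    show "(\<lambda>t. \<psi> n (exp (- t)) * F t) \<in> borel_measurable lborel" for n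
      unfolding \<psi>_def using int by measurable
  qed (use int in auto)
  moreover have "(\<integral>t. \<psi> n (exp (- t)) * F t \<partial>lborel) = 0" for n
  proof (rule exp_moments_zero_imp_continuous_zero[OF int supp zero])
    show "continuous_on {0..1} (\<psi> n)" unfolding \<psi>_def by (intro continuous_intros)
    show "\<psi> n \<in> borel_measurable borel" unfolding \<psi>_def by measurable
  qed
  ultimately show ?thesis by (simp add: LIMSEQ_const_iff)
qed

text \<open>Right continuity keeps g above g t / 2 shortly after t. This turns vanishing integrals
  over intervals into a statement about points, using only the one-sided continuity that a
  distribution function has.\<close>

lemma right_continuous_pos_integral:
  fixes g :: "real \<Rightarrow> real"
  assumes int: "integrable lborel g" and c: "continuous (at_right t) g" and pos: "g t > 0"
  shows "\<exists>a>t. (\<integral>x. indicator {t<..a} x * g x \<partial>lborel) > 0"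
proof -
  have "eventually (\<lambda>x. g x > g t / 2) (at_right t)"
    using c pos by (intro order_tendstoD(1)[of g "g t"]) (auto simp: continuous_within)
  then obtain b where b: "b > t" "\<And>x. t < x \<Longrightarrow> x < b \<Longrightarrow> g x > g t / 2"
    by (auto simp: eventually_at_right_field)
  define a where "a = (t + b) / 2"
  have a: "t < a" "a < b" using b by (auto simp: a_def field_simps)
  have "0 < (a - t) * (g t / 2)" using a pos by simp
  also have "\<dots> = (\<integral>x. indicator {t<..a} x * (g t / 2) \<partial>lborel)" using a by simp
  also have "\<dots> \<le> (\<integral>x. indicator {t<..a} x * g x \<partial>lborel)"
  proof (rule integral_mono)
    show "integrable lborel (\<lambda>x. indicator {t<..a} x * (g t / 2))" using a by simp
    show "integrable lborel (\<lambda>x. indicator {t<..a} x * g x)" 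
      using integrable_mult_indicator[OF _ int, of "{t<..a}"] by simp
    show "indicator {t<..a} x * (g t / 2) \<le> indicator {t<..a} x * g x" for x
      using a b(2)[of x] by (auto simp: indicator_def)
  qed
  finally show ?thesis using a by blast
qed

text \<open>With the weight exp (- (c + 1) * t) absorbed into F, the transforms at the points c + 1
  + n become the moments of F in exp (- t). Agreement there forces the integrals of F over all {..a}
  to vanish, and right continuity passes from integrals to points.\<close>

theorem laplace_unique:
  fixes f g :: "real \<Rightarrow> real"
  assumes f: "\<And>z. z > c \<Longrightarrow> set_integrable lborel {0<..} (\<lambda>t. exp (- z * t) * f t)"
    and g: "\<And>z. z > c \<Longrightarrow> set_integrable lborel {0<..} (\<lambda>t. exp (- z * t) * g t)"
    and eq: "\<And>z. z > c \<Longrightarrow> laplace f z = laplace g z"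
    and cf: "\<And>t. t > 0 \<Longrightarrow> continuous (at_right t) f"
    and cg: "\<And>t. t > 0 \<Longrightarrow> continuous (at_right t) g"
    and t: "t > 0"
  shows "f t = g t"
proof -
  define z where "z = c + 1"
  \<comment> \<open>Stated for an arbitrary pair of functions, so that exchanging their roles
    excludes the opposite inequality.\<close>
  have nogt: "\<not> f t > g t"
    if f: "\<And>z. z > c \<Longrightarrow> set_integrable lborel {0<..} (\<lambda>t. exp (- z * t) * f t)"
    and g: "\<And>z. z > c \<Longrightarrow> set_integrable lborel {0<..} (\<lambda>t. exp (- z * t) * g t)"
    and eq: "\<And>z. z > c \<Longrightarrow> laplace f z = laplace g z"
    and cf: "continuous (at_right t) f"
    and cg: "continuous (at_right t) g" for f g :: "real \<Rightarrow> real"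
  proof
    assume less: "f t > g t"
    define F where "F t = indicator {0<..} t * (exp (- z * t) * (f t - g t))" for t
    have F_alt: "F t = indicator {0<..} t *\<^sub>R (exp (- z * t) * f t) - indicator {0<..} t *\<^sub>R (exp (- z * t) * g t)" for t
      by (simp add: F_def algebra_simps)
    have int: "integrable lborel F"
      unfolding F_alt using f[of z] g[of z] unfolding set_integrable_def z_def
      by (intro Bochner_Integration.integrable_diff) auto
    have zero: "(\<integral>t. exp (- t) ^ n * F t \<partial>lborel) = 0" for n
    proof -
      have zn: "z + n > c" by (simp add: z_def)
      have "(\<integral>t. exp (- t) ^ n * F t \<partial>lborel) = 
         (\<integral>t. (indicator {0<..} t *\<^sub>R (exp (- (z + n) * t) * f t) - indicator {0<..} t *\<^sub>R (exp (- (z + n) * t) * g t)) \<partial>lborel)"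
        by (intro Bochner_Integration.integral_cong)
          (auto simp: F_def algebra_simps exp_add exp_diff exp_of_nat_mult field_simps exp_minus simp flip: exp_of_nat_mult)
      also have "\<dots> = laplace f (z + n) - laplace g (z + n)"
        unfolding laplace_def set_lebesgue_integral_def using f[OF zn] g[OF zn]
        by (intro Bochner_Integration.integral_diff) (simp_all add: set_integrable_def)
      also have "\<dots> = 0" using eq[OF zn] by simp
      finally show ?thesis .
    qed
    have Z: "(\<integral>t. indicator {..a} t * F t \<partial>lborel) = 0" for a
      by (rule exp_moments_zero_imp_integral_zero[OF int _ zero]) (simp add: F_def)
    have "continuous (at_right t) F"
    proof -
      have "continuous (at_right t) (\<lambda>t. exp (- z * t) * (f t - g t))"
        by (intro continuous_intros cf cg)
      then have "((\<lambda>t. exp (- z * t) * (f t - g t)) \<longlongrightarrow> F t) (at_right t)"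
        using t by (simp add: continuous_within F_def)
      then show ?thesis
        unfolding continuous_within
        by (rule Lim_transform_eventually)
          (use t in \<open>auto simp: F_def eventually_at_right_field intro!: exI[of _ "t+1"]\<close>)
    qed
    moreover have "F t > 0" using less t by (simp add: F_def)
    ultimately obtain a where a: "a > t" "(\<integral>x. indicator {t<..a} x * F x \<partial>lborel) > 0"
      using right_continuous_pos_integral[OF int] by blast
    have I: "integrable lborel (\<lambda>x. indicator {..a} x * F x)" for a
      using integrable_mult_indicator[OF _ int, of "{..a}"] by simp
    have "(\<integral>x. indicator {t<..a} x * F x \<partial>lborel) =
        (\<integral>x. (indicator {..a} x * F x - indicator {..t} x * F x) \<partial>lborel)"
      using a by (intro Bochner_Integration.integral_cong) (auto simp: indicator_def)
    also have "\<dots> = 0" by (subst Bochner_Integration.integral_diff[OF I I]) (simp add: Z)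
    finally show False using a by simp
  qed
  show ?thesis
    using nogt[OF f g eq cf[OF t] cg[OF t]] nogt[OF g f eq[symmetric] cg[OF t] cf[OF t]] by force
qed

section \<open>Convolutions and series of functions with a power singularity at the origin\<close>

text \<open>The constants are part of the predicate because series of such functions need the sum of the
  constants to converge.\<close>

definition tame :: "real \<Rightarrow> real \<Rightarrow> real \<Rightarrow> (real \<Rightarrow> real) \<Rightarrow> bool" where
  "tame b c C f \<longleftrightarrow> continuous_on {0<..} f \<and> (\<forall>t>0. \<bar>f t\<bar> \<le> C * (t powr (b - 1) * exp (c * t)))"

lemma tame_const_nonneg:
  assumes "tame b c C f"
  shows "C \<ge> 0"
proof -
  have "0 \<le> \<bar>f 1\<bar>" by simp
  also have "\<dots> \<le> C * exp c" using assms by (auto simp: tame_def dest!: spec[of _ 1])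
  finally show ?thesis by (simp add: zero_le_mult_iff)
qed

lemma tame_measurable:
  assumes "tame b c C f"
  shows "(\<lambda>t. indicator {0<..} t * f t) \<in> borel_measurable borel"
  using borel_measurable_continuous_on_indicator[of "{0<..}" f] assms by (simp add: tame_def)

lemma has_bochner_integral_powr_exp:
  fixes b z :: real
  assumes b: "b > 0" and z: "z > 0"
  shows "has_bochner_integral lborel (\<lambda>t. indicator {0<..} t * (exp (- z * t) * t powr (b - 1))) (Gamma b / z powr b)"
proof -
  let ?g = "\<lambda>t. indicator {0..} t * t powr (b - 1) / exp t :: real"
  have "has_bochner_integral lborel ?g (Gamma b)"
    using Gamma_conv_nn_integral_real[OF b] Gamma_real_pos[OF b]
    by (intro has_bochner_integral_nn_integral) auto
  then have "has_bochner_integral lborel (\<lambda>t. ?g (0 + z * t)) (Gamma b /\<^sub>R \<bar>z\<bar>)"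
    using z by (subst (asm) lborel_has_bochner_integral_real_affine_iff[of z _ _ 0]) auto
  then have "has_bochner_integral lborel (\<lambda>t. z powr (1 - b) * ?g (0 + z * t)) (z powr (1 - b) * (Gamma b /\<^sub>R \<bar>z\<bar>))"
    by (rule has_bochner_integral_mult_right)
  also have "z powr (1 - b) * (Gamma b /\<^sub>R \<bar>z\<bar>) = Gamma b / z powr b"
    using z by (simp add: powr_diff field_simps)
  also have "(\<lambda>t. z powr (1 - b) * ?g (0 + z * t)) = (\<lambda>t. indicator {0<..} t * (exp (- z * t) * t powr (b - 1)))"
    using z by (auto simp: fun_eq_iff indicator_def zero_le_mult_iff powr_mult exp_minus field_simps powr_diff)
  finally show ?thesis .
qed

lemma tame_laplace_integrable:
  assumes f: "tame b c C f" and b: "b > 0" and z: "z > c"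
  shows "set_integrable lborel {0<..} (\<lambda>t. exp (- z * t) * f t)"
  unfolding set_integrable_def
proof (rule Bochner_Integration.integrable_bound)
  show "integrable lborel (\<lambda>t. C * (indicator {0<..} t * (exp (- (z - c) * t) * t powr (b - 1))))"
    using has_bochner_integral_powr_exp[OF b, of "z - c"] z
    by (intro integrable_mult_right) (auto simp: has_bochner_integral_iff)
  have "(\<lambda>t. exp (- z * t) * (indicator {0<..} t * f t)) \<in> borel_measurable lborel"
    using tame_measurable[OF f] by measurable
  then show "(\<lambda>t. indicat_real {0<..} t *\<^sub>R (exp (- z * t) * f t)) \<in> borel_measurable lborel"
    by (simp add: mult_ac)
  show "AE t in lborel. norm (indicat_real {0<..} t *\<^sub>R (exp (- z * t) * f t))
         \<le> norm (C * (indicat_real {0<..} t * (exp (- (z - c) * t) * t powr (b - 1))))"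
  proof (intro AE_I2)
    fix t
    show "norm (indicat_real {0<..} t *\<^sub>R (exp (- z * t) * f t))
         \<le> norm (C * (indicat_real {0<..} t * (exp (- (z - c) * t) * t powr (b - 1))))"
    proof (cases "t > 0")
      case True
      then have "exp (- z * t) * \<bar>f t\<bar> \<le> exp (- z * t) * (C * (t powr (b - 1) * exp (c * t)))"
        using f by (intro mult_left_mono) (auto simp: tame_def)
      also have "\<dots> = C * (exp (- (z - c) * t) * t powr (b - 1))"
        by (simp add: algebra_simps exp_add [symmetric] exp_diff exp_minus field_simps)
      finally show ?thesis using True tame_const_nonneg[OF f] by (simp add: abs_mult)
    qed simp
  qed
qed

text \<open>The substitution u = t * v moves the dependence on t from the domain into the integrand.
  Continuity in t then follows by dominated convergence, and power bounds on f and g lead to a Beta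
  integral.\<close>

lemma fun_conv_unit_interval:
  assumes "t > 0"
  shows "fun_conv f g t = t * (LINT v:{0<..<1}|lborel. f (t * (1 - v)) * g (t * v))"
proof -
  have "fun_conv f g t = (\<integral>u. indicator {0<..<t} u *\<^sub>R (f (t - u) * g u) \<partial>lborel)"
    by (simp add: fun_conv_def set_lebesgue_integral_def)
  also have "\<dots> = \<bar>t\<bar> *\<^sub>R (\<integral>v. indicator {0<..<t} (0 + t * v) *\<^sub>R (f (t - (0 + t * v)) * g (0 + t * v)) \<partial>lborel)"
    using assms by (intro lborel_integral_real_affine) simp
  also have "\<dots> = t * (LINT v:{0<..<1}|lborel. f (t * (1 - v)) * g (t * v))"
    unfolding set_lebesgue_integral_def using assms
    by (auto simp: indicator_def zero_less_mult_iff algebra_simps intro!: Bochner_Integration.integral_cong)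
  finally show ?thesis .
qed

lemma Beta_integral_open:
  assumes "a > 0" "b > (0::real)"
  shows "has_bochner_integral lborel (\<lambda>t. indicator {0<..<1} t * (t powr (a - 1) * (1 - t) powr (b - 1))) (Beta a b)"
proof -
  have I: "set_integrable lborel {0..1} (\<lambda>t. t powr (a - 1) * (1 - t) powr (b - 1))"
    by (rule integrable_Beta[OF assms])
  have e: "(\<lambda>t. indicator {0..1} t *\<^sub>R (t powr (a - 1) * (1 - t) powr (b - 1))) = 
      (\<lambda>t::real. indicator {0<..<1} t * (t powr (a - 1) * (1 - t) powr (b - 1)))"
    by (auto simp: fun_eq_iff indicator_def)
  have "(LINT t:{0..1}|lborel. t powr (a - 1) * (1 - t) powr (b - 1)) = Beta a b"
    using set_borel_integral_eq_integral(2)[OF I] has_integral_Beta_real[OF assms]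
    by (simp add: integral_unique)
  then show ?thesis using I 
    unfolding set_integrable_def set_lebesgue_integral_def e by (simp add: has_bochner_integral_iff)
qed

text \<open>Powers of t scale out of the Beta integral, so the exponents add, while exp (c * (t -
  u)) * exp (c * u) = exp (c * t) keeps the rate c. Hence all convolution powers have transforms on
  the same half-line.\<close>

lemma tame_conv:
  assumes f: "tame b c C f" and g: "tame b' c C' g" and b: "b > 0" "b' > 0"
  shows "tame (b + b') c (C * C' * Beta b' b) (fun_conv f g)"
proof -
  let ?k = "\<lambda>v. indicator {0<..<1} v * (v powr (b' - 1) * (1 - v) powr (b - 1)) :: real"
  define K where "K t = C * C' * (t powr (b + b' - 1) * exp (c * t))" for t
  let ?h = "\<lambda>t v. indicator {0<..<1} v *\<^sub>R (f (t * (1 - v)) * g (t * v))"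
  have conv: "fun_conv f g t = (\<integral>v. t * ?h t v \<partial>lborel)" if "t > 0" for t
    using fun_conv_unit_interval[OF that] by (simp add: set_lebesgue_integral_def)
  have C: "C \<ge> 0" "C' \<ge> 0" using f g tame_const_nonneg by auto
  have bound: "norm (t * ?h t v) \<le> K t * ?k v" if t: "t > 0" for t v
  proof (cases "v \<in> {0<..<1}")
    case True
    then have p: "t * (1 - v) > 0" "t * v > 0" using t by auto
    have "\<bar>f (t * (1 - v))\<bar> * \<bar>g (t * v)\<bar> \<le>
      (C * ((t * (1 - v)) powr (b - 1) * exp (c * (t * (1 - v))))) * (C' * ((t * v) powr (b' - 1) * exp (c * (t * v))))"
      using f g p C by (intro mult_mono) (auto simp: tame_def)
    also have "\<dots> = C * C' * (t powr (b - 1) * t powr (b' - 1)) * (exp (c * (t * (1 - v))) * exp (c * (t * v))) *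
        (v powr (b' - 1) * (1 - v) powr (b - 1))"
      using t True by (simp add: powr_mult mult_ac)
    also have "exp (c * (t * (1 - v))) * exp (c * (t * v)) = exp (c * t)"
      by (simp add: exp_add [symmetric] algebra_simps)
    also have "t powr (b - 1) * t powr (b' - 1) = t powr (b + b' - 1) / t"
      using t by (simp add: powr_add powr_diff)
    finally have "\<bar>t\<bar> * (\<bar>f (t * (1 - v))\<bar> * \<bar>g (t * v)\<bar>) \<le> 
        \<bar>t\<bar> * (C * C' * (t powr (b + b' - 1) / t) * exp (c * t) * (v powr (b' - 1) * (1 - v) powr (b - 1)))"
      by (intro mult_left_mono) auto
    also have "\<dots> = K t * ?k v" using t True by (simp add: K_def)
    finally show ?thesis using True by (simp add: abs_mult)
  qed simp
  have kint: "integrable lborel ?k" and kval: "integral\<^sup>L lborel ?k = Beta b' b"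
    using Beta_integral_open[OF b(2) b(1)] by (simp_all add: has_bochner_integral_iff)
  have meas: "(\<lambda>v. t * ?h t v) \<in> borel_measurable lborel" if "t > 0" for t
  proof -
    define fi where "fi x = indicator {0<..} x * f x" for x
    define gi where "gi x = indicator {0<..} x * g x" for x
    have [measurable]: "fi \<in> borel_measurable borel" "gi \<in> borel_measurable borel"
      using tame_measurable[OF f] tame_measurable[OF g] by (simp_all add: fi_def[abs_def] gi_def[abs_def])
    have "(\<lambda>v. t * (indicator {0<..<1} v * (fi (t * (1 - v)) * gi (t * v)))) \<in> borel_measurable borel"
      by measurable
    also have "(\<lambda>v. t * (indicator {0<..<1} v * (fi (t * (1 - v)) * gi (t * v)))) = (\<lambda>v. t * ?h t v)"
      using that by (auto simp: fun_eq_iff indicator_def fi_def gi_def)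
    finally show ?thesis by simp
  qed
  have int: "integrable lborel (\<lambda>v. t * ?h t v)" if "t > 0" for t
    by (rule Bochner_Integration.integrable_bound[OF integrable_mult_right[OF kint, of "K t"] meas[OF that]])
      (use bound[OF that] in \<open>auto intro!: AE_I2 order_trans[OF _ abs_ge_self]\<close>)
  have "continuous_on {0<..} (fun_conv f g)"
    unfolding continuous_on_sequentially
  proof safe
    fix X :: "nat \<Rightarrow> real" and a
    assume a: "a > 0" and X: "\<forall>n. X n \<in> {0<..}" and lim: "X \<longlonglongrightarrow> a"
    \<comment> \<open>The values K (X n) converge and so stay below some B; B times the Beta kernel
      then dominates the whole sequence.\<close>
    have "(\<lambda>n. K (X n)) \<longlonglongrightarrow> K a"
      unfolding K_def using a by (intro tendsto_intros lim) auto
    then have "Bseq (\<lambda>n. K (X n))" using convergentI convergent_imp_Bseq by blast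
    then obtain B where B: "\<And>n. \<bar>K (X n)\<bar> \<le> B" by (auto simp: Bseq_def)
    have "(\<lambda>n. \<integral>v. X n * ?h (X n) v \<partial>lborel) \<longlonglongrightarrow> (\<integral>v. a * ?h a v \<partial>lborel)"
    proof (rule integral_dominated_convergence[where w = "\<lambda>v. B * ?k v"])
      show "integrable lborel (\<lambda>v. B * ?k v)" by (intro integrable_mult_right kint)
      show "AE v in lborel. (\<lambda>n. X n * ?h (X n) v) \<longlonglongrightarrow> a * ?h a v"
      proof (intro AE_I2)
        fix v :: real
        show "(\<lambda>n. X n * ?h (X n) v) \<longlonglongrightarrow> a * ?h a v"
        proof (cases "v \<in> {0<..<1}")
          case True
          have fc: "isCont f (a * (1 - v))" and gc: "isCont g (a * v)" 
            using f g a True by (auto simp: tame_def continuous_on_eq_continuous_at)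
          show ?thesis
            by (intro tendsto_intros lim isCont_tendsto_compose[OF fc] isCont_tendsto_compose[OF gc])
        qed simp
      qed
      show "AE v in lborel. norm (X n * ?h (X n) v) \<le> B * ?k v" for n
      proof (intro AE_I2)
        fix v
        have "norm (X n * ?h (X n) v) \<le> K (X n) * ?k v" using X bound by auto
        also have "\<dots> \<le> B * ?k v" using B[of n] by (intro mult_right_mono) auto
        finally show "norm (X n * ?h (X n) v) \<le> B * ?k v" .
      qed
    qed (use X meas a in auto)
    then show "(fun_conv f g \<circ> X) \<longlonglongrightarrow> fun_conv f g a"
      using X conv a by (simp add: o_def)
  qed
  moreover have "\<bar>fun_conv f g t\<bar> \<le> C * C' * Beta b' b * (t powr (b + b' - 1) * exp (c * t))" if t: "t > 0" for t
  proof -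
    have "\<bar>fun_conv f g t\<bar> \<le> (\<integral>v. norm (t * ?h t v) \<partial>lborel)"
      using conv[OF t] integral_norm_bound[of lborel "\<lambda>v. t * ?h t v"] by simp
    also have "\<dots> \<le> (\<integral>v. K t * ?k v \<partial>lborel)"
      using int[OF t] bound[OF t] kint by (intro integral_mono) auto
    also have "\<dots> = K t * Beta b' b" by (simp only: integral_mult_right_zero kval)
    finally show ?thesis by (simp add: K_def mult_ac)
  qed
  ultimately show ?thesis unfolding tame_def by blast
qed

lemma laplace_fun_conv:
  assumes f: "tame b c C f" and g: "tame b' c C' g" and b: "b > 0" "b' > 0" and z: "z > c"
  shows "laplace (fun_conv f g) z = laplace f z * laplace g z"
proof -
  \<comment> \<open>After cutoff and weighting, the convolution is one over the whole line: the
    cutoffs confine u to {0<..<t} and the exponentials multiply to exp (- z * t). Fubini and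
    translation invariance then factor the integral.\<close>
  define F where "F t = indicator {0<..} t * (exp (- z * t) * f t)" for t
  define G where "G t = indicator {0<..} t * (exp (- z * t) * g t)" for t
  have Fi: "integrable lborel F" and Gi: "integrable lborel G"
    using tame_laplace_integrable[OF f b(1) z] tame_laplace_integrable[OF g b(2) z]
    unfolding F_def G_def set_integrable_def by simp_all
  have [measurable]: "F \<in> borel_measurable borel" "G \<in> borel_measurable borel" using Fi Gi by auto
  interpret lborel_pair: pair_sigma_finite lborel lborel ..
  have sh: "(\<integral>t. H (t - u) \<partial>lborel) = (\<integral>t. H t \<partial>lborel)" for H :: "real \<Rightarrow> real" and u
    using lborel_integral_real_affine[of 1 H "- u"] by simp
  have shi: "integrable lborel (\<lambda>t. F (t - u))" for u
    using lborel_integrable_real_affine[OF Fi, of 1 "- u"] by simp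
  have shn: "(\<integral>t. norm (F (t - u)) \<partial>lborel) = (\<integral>t. norm (F t) \<partial>lborel)" for u
    by (rule sh)
  have I: "integrable (lborel \<Otimes>\<^sub>M lborel) (\<lambda>(u, t). F (t - u) * G u)"
  proof (rule lborel_pair.Fubini_integrable)
    have "(\<lambda>u. \<integral>t. norm (case (u, t) of (u, t) \<Rightarrow> F (t - u) * G u) \<partial>lborel) = (\<lambda>u. (\<integral>t. norm (F t) \<partial>lborel) * norm (G u))"
      using shn by (simp add: abs_mult)
    then show "integrable lborel (\<lambda>u. \<integral>t. norm (case (u, t) of (u, t) \<Rightarrow> F (t - u) * G u) \<partial>lborel)"
      using Gi by simp
    show "AE u in lborel. integrable lborel (\<lambda>t. case (u, t) of (u, t) \<Rightarrow> F (t - u) * G u)"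
      using shi by simp
  qed measurable
  have "laplace (fun_conv f g) z = (\<integral>t. \<integral>u. F (t - u) * G u \<partial>lborel \<partial>lborel)"
    unfolding laplace_def set_lebesgue_integral_def
  proof (rule Bochner_Integration.integral_cong[OF refl])
    fix t :: real
    show "indicator {0<..} t *\<^sub>R (exp (- z * t) * fun_conv f g t) = (\<integral>u. F (t - u) * G u \<partial>lborel)"
    proof (cases "t > 0")
      case True
      have "(\<integral>u. F (t - u) * G u \<partial>lborel) = (\<integral>u. exp (- z * t) * (indicator {0<..<t} u *\<^sub>R (f (t - u) * g u)) \<partial>lborel)"
        by (intro Bochner_Integration.integral_cong)
          (auto simp: F_def G_def indicator_def algebra_simps exp_diff field_simps exp_minus simp flip: exp_add)
      then show ?thesis using True by (simp add: fun_conv_def set_lebesgue_integral_def)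
    next
      case False
      then have "(\<lambda>u. F (t - u) * G u) = (\<lambda>u. 0)" by (auto simp: F_def G_def indicator_def)
      then show ?thesis using False by (simp only:) simp
    qed
  qed
  also have "\<dots> = (\<integral>u. \<integral>t. F (t - u) * G u \<partial>lborel \<partial>lborel)"
    using lborel_pair.Fubini_integral[OF I] by simp
  also have "\<dots> = laplace f z * laplace g z"
  proof -
    have "(\<integral>t. F (t - u) * G u \<partial>lborel) = integral\<^sup>L lborel F * G u" for u
      using sh[of F u] by simp
    then have "(\<integral>u. \<integral>t. F (t - u) * G u \<partial>lborel \<partial>lborel) = integral\<^sup>L lborel F * integral\<^sup>L lborel G"
      by (simp only: integral_mult_right_zero)
    then show ?thesis by (simp add: laplace_def set_lebesgue_integral_def F_def[abs_def] G_def[abs_def])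
  qed
  finally show ?thesis .
qed

lemma conv_power_tame_laplace:
  assumes f: "tame b c C f" and b: "b > 0"
  shows "n \<ge> 1 \<Longrightarrow> (\<exists>C'. tame (real n * b) c C' (conv_power f n)) \<and> 
    (\<forall>z>c. laplace (conv_power f n) z = laplace f z ^ n)"
proof (induction n rule: nat_induct_at_least)
  case base
  then show ?case using f by (auto simp: conv_power_def)
next
  case (Suc n)
  have e: "conv_power f (Suc n) = fun_conv f (conv_power f n)"
    using Suc.hyps by (cases n) (auto simp: conv_power_def)
  obtain C' where C': "tame (real n * b) c C' (conv_power f n)" using Suc.IH by auto
  have nb: "real n * b > 0" using Suc.hyps b by simp
  have "tame (b + real n * b) c (C * C' * Beta (real n * b) b) (conv_power f (Suc n))"
    unfolding e by (rule tame_conv[OF f C' b nb])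
  moreover have "b + real n * b = real (Suc n) * b" by (simp add: algebra_simps)
  ultimately show ?case
    using laplace_fun_conv[OF f C' b nb] Suc.IH e by auto
qed

text \<open>All summands share the envelope t powr (b - 1) * exp (c * t), so summability of the
  constants dominates the series pointwise, locally uniformly and after integration against exp (- z
  * t). The sum is again tame, which permits a second application to the outer sum of a double
  series.\<close>

lemma tame_series:
  assumes f: "\<And>j::nat. tame b c (K j) (f j)" and K: "summable K" and b: "b > 0"
  shows "tame b c (suminf K) (\<lambda>t. \<Sum>j. f j t)"
    and "\<And>z. z > c \<Longrightarrow> (\<lambda>j. laplace (f j) z) sums laplace (\<lambda>t. \<Sum>j. f j t) z"
    and "\<And>t. t > 0 \<Longrightarrow> summable (\<lambda>j. \<bar>f j t\<bar>)"
proof -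
  have K0: "K j \<ge> 0" for j using f tame_const_nonneg by blast
  define E where "E t = t powr (b - 1) * exp (c * t)" for t
  have E0: "E t \<ge> 0" for t by (simp add: E_def)
  have bd: "\<bar>f j t\<bar> \<le> K j * E t" if "t > 0" for j t using f that by (auto simp: tame_def E_def)
  have sKE: "summable (\<lambda>j. K j * E t)" for t using K by (rule summable_mult2)
  show sum: "summable (\<lambda>j. \<bar>f j t\<bar>)" if "t > 0" for t
    by (rule summable_comparison_test[OF _ sKE[of t]]) (use bd[OF that] in auto)
  have sum': "summable (\<lambda>j. f j t)" if "t > 0" for t
    using sum[OF that] by (rule summable_rabs_cancel)
  have bound: "\<bar>\<Sum>j. f j t\<bar> \<le> suminf K * E t" if "t > 0" for t
  proof -
    have "\<bar>\<Sum>j. f j t\<bar> \<le> (\<Sum>j. \<bar>f j t\<bar>)" by (rule summable_rabs[OF sum[OF that]])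
    also have "\<dots> \<le> (\<Sum>j. K j * E t)" by (intro suminf_le bd sum sKE that)
    also have "\<dots> = suminf K * E t" by (rule suminf_mult2[OF K, symmetric])
    finally show ?thesis .
  qed
  have cont: "continuous_on {0<..} (\<lambda>t. \<Sum>j. f j t)"
  proof -
    have "isCont (\<lambda>t. \<Sum>j. f j t) a" if a: "a > 0" for a
    proof -
      \<comment> \<open>The envelope may blow up at 0, so the M-test is applied on a compact
        neighbourhood of a that keeps away from 0.\<close>
      define S where "S = {a / 2..2 * a}"
      have "continuous_on S E" unfolding E_def S_def using a by (intro continuous_intros) auto
      then have "compact (E ` S)" by (intro compact_continuous_image) (auto simp: S_def)
      then obtain B where B: "\<And>t. t \<in> S \<Longrightarrow> \<bar>E t\<bar> \<le> B"
        by (metis compact_imp_bounded bounded_iff image_eqI real_norm_def)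
      have B0: "t \<in> S \<Longrightarrow> E t \<le> B" for t using B[of t] by auto
      have "uniform_limit S (\<lambda>n t. \<Sum>j<n. f j t) (\<lambda>t. \<Sum>j. f j t) sequentially"
      proof (rule Weierstrass_m_test[of _ _ "\<lambda>j. K j * B"])
        fix j t assume t: "t \<in> S"
        then have "t > 0" using a by (auto simp: S_def)
        from bd[OF this, of j] show "norm (f j t) \<le> K j * B"
          using B0[OF t] K0[of j] by (auto intro: order_trans mult_left_mono)
      qed (use K in \<open>rule summable_mult2\<close>)
      then have "continuous_on S (\<lambda>t. \<Sum>j. f j t)"
      proof (rule uniform_limit_theorem[rotated])
        show "\<forall>\<^sub>F n in sequentially. continuous_on S (\<lambda>t. \<Sum>j<n. f j t)"
        proof (intro always_eventually allI continuous_on_sum)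
          fix n j
          have "S \<subseteq> {0<..}" using a by (auto simp: S_def)
          then show "continuous_on S (f j)" using f[of j] unfolding tame_def by (blast intro: continuous_on_subset)
        qed
      qed simp
      then show ?thesis
        by (rule continuous_on_interior) (use a in \<open>auto simp: S_def\<close>)
    qed
    then show ?thesis by (intro continuous_at_imp_continuous_on) auto
  qed
  show "tame b c (suminf K) (\<lambda>t. \<Sum>j. f j t)"
    using cont bound by (auto simp: tame_def E_def)
  fix z assume z: "z > c"
  define G where "G t = indicator {0<..} t * (exp (- (z - c) * t) * t powr (b - 1))" for t :: real
  have Gi: "integrable lborel G"
    using has_bochner_integral_powr_exp[OF b, of "z - c"] z unfolding G_def
    by (auto simp: has_bochner_integral_iff)
  define F where "F j t = indicator {0<..} t *\<^sub>R (exp (- z * t) * f j t)" for j t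
  have Fi: "integrable lborel (F j)" for j
    using tame_laplace_integrable[OF f b z] unfolding F_def set_integrable_def .
  have FG: "norm (F j t) \<le> K j * G t" for j t
  proof (cases "t > 0")
    case True
    have "exp (- z * t) * \<bar>f j t\<bar> \<le> exp (- z * t) * (K j * E t)" using bd[OF True] by (intro mult_left_mono) auto
    also have "\<dots> = K j * G t" using True
      by (simp add: G_def E_def algebra_simps exp_diff exp_minus field_simps flip: exp_add)
    finally show ?thesis using True by (simp add: F_def abs_mult)
  qed (simp add: F_def G_def)
  have G0: "G t \<ge> 0" for t by (simp add: G_def)
  have "(\<lambda>j. integral\<^sup>L lborel (F j)) sums (\<integral>t. (\<Sum>j. F j t) \<partial>lborel)"
  proof (rule sums_integral[OF Fi])
    show "AE t in lborel. summable (\<lambda>j. norm (F j t))"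
    proof (intro AE_I2)
      fix t
      have "\<exists>N. \<forall>j\<ge>N. norm (norm (F j t)) \<le> K j * G t" using FG by simp
      then show "summable (\<lambda>j. norm (F j t))"
        by (rule summable_comparison_test[OF _ summable_mult2[OF K]])
    qed
    show "summable (\<lambda>j. \<integral>t. norm (F j t) \<partial>lborel)"
    proof (rule summable_comparison_test)
      have "(\<integral>t. norm (F j t) \<partial>lborel) \<le> (\<integral>t. K j * G t \<partial>lborel)" for j
        using Fi Gi FG by (intro integral_mono) auto
      then have "(\<integral>t. norm (F j t) \<partial>lborel) \<le> K j * integral\<^sup>L lborel G" for j by simp
      then show "\<exists>N. \<forall>j\<ge>N. norm (\<integral>t. norm (F j t) \<partial>lborel) \<le> K j * integral\<^sup>L lborel G" by auto
      show "summable (\<lambda>j. K j * integral\<^sup>L lborel G)" using K by (rule summable_mult2)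
    qed
  qed
  also have "(\<integral>t. (\<Sum>j. F j t) \<partial>lborel) = laplace (\<lambda>t. \<Sum>j. f j t) z"
    unfolding laplace_def set_lebesgue_integral_def
  proof (rule Bochner_Integration.integral_cong[OF refl])
    fix t :: real
    show "(\<Sum>j. F j t) = indicator {0<..} t *\<^sub>R (exp (- z * t) * (\<Sum>j. f j t))"
      by (cases "t > 0") (use sum'[of t] in \<open>auto simp: F_def suminf_mult\<close>)
  qed
  finally show "(\<lambda>j. laplace (f j) z) sums laplace (\<lambda>t. \<Sum>j. f j t) z"
    by (simp add: laplace_def set_lebesgue_integral_def F_def[abs_def])
qed

section \<open>The Laplace transform of the functions in the series\<close>

text \<open>The interval from x to x + 1 alone contributes this much to the integral of t powr b *
  exp (- t), whose value is Gamma (b + 1) = b * Gamma b.\<close>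

lemma Gamma_lower_bound:
  fixes b x :: real
  assumes b: "b > 0" and x: "x > 0"
  shows "x powr b * exp (- x - 1) \<le> b * Gamma b"
proof -
  let ?g = "\<lambda>t::real. indicator {0<..} t * (exp (- 1 * t) * t powr (b + 1 - 1))"
  have I: "has_bochner_integral lborel ?g (Gamma (b + 1))"
    using has_bochner_integral_powr_exp[of "b + 1" 1] b by simp
  have "x powr b * exp (- x - 1) = (\<integral>t. indicator {x..x+1} t * (x powr b * exp (- x - 1)) \<partial>lborel)"
    by simp
  also have "\<dots> \<le> integral\<^sup>L lborel ?g"
  proof (rule integral_mono)
    fix t :: real
    show "indicator {x..x+1} t * (x powr b * exp (- x - 1)) \<le> ?g t"
    proof (cases "t \<in> {x..x+1}")
      case True
      then have "x powr b * exp (- x - 1) \<le> t powr b * exp (- t)"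
        using x b by (intro mult_mono powr_mono2) auto
      then show ?thesis using True x by (simp add: mult.commute)
    qed simp
  qed (use I in \<open>auto simp: has_bochner_integral_iff\<close>)
  also have "\<dots> = b * Gamma b"
    using I b Gamma_plus1[of b] by (auto simp: has_bochner_integral_iff nonpos_Ints_def)
  finally show ?thesis .
qed

text \<open>Stirling-type bound, uniform in \<open>b\<close>: the lower bound for \<open>Gamma b\<close> is applied at the point \<open>2 * x * t\<close> for
  \<open>t \<ge> 1\<close> and at \<open>2 * x\<close> for \<open>t < 1\<close>, and the factor \<open>b\<close> is absorbed by \<open>b \<le> 2 powr b\<close>.\<close>

lemma powr_Gamma_bound:
  fixes b b0 x t :: real
  assumes b0: "b0 > 0" and b: "b \<ge> b0" and x: "x > 0" and t: "t > 0"
  shows "t powr (b - 1) / Gamma b \<le> exp (1 + 2 * x) * x powr (- b) * (t powr (b0 - 1) * exp (2 * x * t))"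
proof -
  have bp: "b > 0" using b0 b by simp
  have G: "Gamma b > 0" using Gamma_real_pos[OF bp] .
  \<comment> \<open>From ln (b / 2) \<le> b / 2 - 1 and ln 2 < 1 follows ln b < b / 2, while b * ln
    2 is at least 2 * b / 3.\<close>
  have b2: "b \<le> 2 powr b"
  proof -
    have "b * (2 / 3) \<le> b * ln 2" using ln2_ge_two_thirds bp by (intro mult_left_mono) auto
    moreover have "ln (b / 2) \<le> b / 2 - 1" using bp by (intro ln_le_minus_one) auto
    moreover have "ln (b / 2) = ln b - ln 2" using bp by (simp add: ln_div)
    ultimately have "ln b \<le> b * ln 2" using ln_2_less_1 bp by linarith
    then show ?thesis using bp by (metis exp_le_cancel_iff exp_ln powr_def zero_neq_numeral)
  qed
  have inv: "1 / Gamma b \<le> x powr (- b) * (exp (u * 2 * x + 1) * u powr (- b))" if u: "u > 0" for u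
  proof -
    have ux: "u * 2 * x > 0" using u x by simp
    have "(u * 2 * x) powr b * exp (- (u * 2 * x) - 1) \<le> b * Gamma b"
      by (rule Gamma_lower_bound[OF bp ux])
    also have "\<dots> \<le> 2 powr b * Gamma b" using b2 G by simp
    finally have "(u powr b * x powr b) * exp (- (u * 2 * x) - 1) \<le> Gamma b"
      using u x by (simp add: powr_mult)
    then have "u powr b * x powr b \<le> Gamma b * exp (u * 2 * x + 1)"
      by (simp add: exp_diff exp_minus exp_add field_simps)
    then show ?thesis using u x G by (simp add: powr_minus field_simps)
  qed
  show ?thesis
  proof (cases "t \<ge> 1")
    case True
    have "t powr (b - 1) / Gamma b \<le> t powr (b - 1) * (x powr (- b) * (exp (t * 2 * x + 1) * t powr (- b)))"
      using mult_left_mono[OF inv[OF t], of "t powr (b - 1)"] by simp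
    also have "\<dots> = exp (t * 2 * x) * exp 1 * x powr (- b) * (t powr (b - 1) * t powr (- b))"
      by (simp add: exp_add)
    also have "t powr (b - 1) * t powr (- b) = t powr (- 1)" by (simp add: powr_add [symmetric])
    also have "exp (t * 2 * x) * exp 1 * x powr (- b) * t powr (- 1) \<le>
       exp (t * 2 * x) * exp (1 + 2 * x) * x powr (- b) * t powr (b0 - 1)"
    proof -
      have "exp (1::real) \<le> exp (1 + 2 * x)" "t powr (- 1) \<le> t powr (b0 - 1)"
        using True b0 x powr_mono[of "- 1" "b0 - 1" t] by simp_all
      then show ?thesis by (intro mult_mono order_refl) auto
    qed
    finally show ?thesis by (simp add: mult_ac)
  next
    case False
    have "t powr (b - 1) / Gamma b \<le> t powr (b - 1) * (x powr (- b) * (exp (1 * 2 * x + 1) * 1 powr (- b)))"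
      using mult_left_mono[OF inv[of 1], of "t powr (b - 1)"] by simp
    also have "\<dots> = exp (1 + 2 * x) * x powr (- b) * (t powr (b - 1) * 1)" by (simp add: mult_ac add_ac)
    also have "\<dots> \<le> exp (1 + 2 * x) * x powr (- b) * (t powr (b0 - 1) * exp (2 * x * t))"
      using False b t x by (intro mult_left_mono mult_mono powr_mono') auto
    finally show ?thesis .
  qed
qed

lemma negative_binomial_sums:
  fixes x :: real
  assumes "\<bar>x\<bar> < 1"
  shows "(\<lambda>r. real ((j + r) choose r) * x ^ r) sums (1 / (1 - x) ^ Suc j)"
proof -
  have "(\<lambda>n. ((- real (Suc j)) gchoose n) * (- x) ^ n) sums (1 + (- x)) powr (- real (Suc j))"
    by (rule gen_binomial_real) (use assms in simp)
  also have "(\<lambda>n. ((- real (Suc j)) gchoose n) * (- x) ^ n) = (\<lambda>r. real ((j + r) choose r) * x ^ r)"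
  proof
    fix n
    have "((- real (Suc j)) gchoose n) = (- 1) ^ n * ((real n + real j) gchoose n)"
      by (subst gbinomial_negated_upper) (simp add: algebra_simps)
    also have "(real n + real j) gchoose n = real ((j + n) choose n)"
      by (simp add: binomial_gbinomial add.commute)
    finally show "((- real (Suc j)) gchoose n) * (- x) ^ n = real ((j + n) choose n) * x ^ n"
      by (simp add: power_mult_distrib [symmetric] mult_ac)
  qed
  also have "(1 + (- x)) powr (- real (Suc j)) = 1 / (1 - x) ^ Suc j"
    using assms by (simp add: powr_minus powr_realpow divide_inverse del: of_nat_Suc)
  finally show ?thesis .
qed

text \<open>After cancellation of the Gamma factors to a binomial coefficient, \<open>h_fun\<close> is the double series
  of the terms below with \<open>p = c2 / c1\<close>, \<open>w = (lam + k * mu) / c1\<close>, \<open>a = \<alpha>1\<close>, \<open>d = \<alpha>1 - \<alpha>2\<close> and \<open>v = 1 / N\<close>.\<close>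

definition mlexp :: "real \<Rightarrow> real \<Rightarrow> real \<Rightarrow> nat \<Rightarrow> nat \<Rightarrow> real" where
  "mlexp a d v j r = a + v + d * real j + a * real r"

definition mlterm :: "real \<Rightarrow> real \<Rightarrow> real \<Rightarrow> real \<Rightarrow> real \<Rightarrow> nat \<Rightarrow> nat \<Rightarrow> real \<Rightarrow> real" where
  "mlterm p w a d v j r t =
    (- p) ^ j * real ((j + r) choose r) * (- w) ^ r * (t powr (mlexp a d v j r - 1) / Gamma (mlexp a d v j r))"

context
  fixes p w a d v :: real
  assumes p: "p \<ge> 0" and w: "w > 0" and a: "a > 0" and d: "d > 0" and v: "v > 0"
begin

lemma mlexp_pos: "mlexp a d v j r > 0"
  using a v d by (auto simp: mlexp_def intro!: add_pos_nonneg)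

lemma powr_mlexp: "x > 0 \<Longrightarrow> x powr (- mlexp a d v j r) = x powr (- (a + v)) * (x powr (- d)) ^ j * (x powr (- a)) ^ r"
proof -
  assume x: "x > 0"
  have "- mlexp a d v j r = - (a + v) + (- d) * real j + (- a) * real r" by (simp add: mlexp_def)
  then have "x powr (- mlexp a d v j r) = x powr (- (a + v)) * x powr ((- d) * real j) * x powr ((- a) * real r)"
    by (simp only: powr_add)
  also have "x powr ((- d) * real j) = (x powr (- d)) ^ j" using x by (simp only: powr_powr [symmetric]) (simp add: powr_realpow)
  also have "x powr ((- a) * real r) = (x powr (- a)) ^ r" using x by (simp only: powr_powr [symmetric]) (simp add: powr_realpow)
  finally show ?thesis .
qed

text \<open>The point x is a free parameter. Enlarging it shrinks x powr (- d) and x powr (- a), so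
  that the constants become summable over j and r, at the price of the exponential rate 2 * x. The
  common exponent a + v is the smallest one, that of j = r = 0.\<close>

lemma mlterm_tame:
  assumes x: "x > 0"
  shows "tame (a + v) (2 * x) (exp (1 + 2 * x) * x powr (- (a + v)) * (p * x powr (- d)) ^ j *
     (real ((j + r) choose r) * (w * x powr (- a)) ^ r)) (mlterm p w a d v j r)"
  unfolding tame_def
proof (intro conjI allI impI)
  show "continuous_on {0<..} (mlterm p w a d v j r)"
    unfolding mlterm_def using Gamma_real_pos[OF mlexp_pos[of j r]]
    by (intro continuous_intros) auto
  fix t :: real assume t: "t > 0"
  have G: "Gamma (mlexp a d v j r) > 0" using Gamma_real_pos[OF mlexp_pos] .
  have "\<bar>mlterm p w a d v j r t\<bar> = p ^ j * real ((j + r) choose r) * w ^ r * (t powr (mlexp a d v j r - 1) / Gamma (mlexp a d v j r))"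
    using p w G by (simp add: mlterm_def abs_mult power_abs)
  also have "\<dots> \<le> p ^ j * real ((j + r) choose r) * w ^ r * 
      (exp (1 + 2 * x) * x powr (- mlexp a d v j r) * (t powr (a + v - 1) * exp (2 * x * t)))"
    using a d v p w by (intro mult_left_mono powr_Gamma_bound x t) (auto simp: mlexp_def)
  also have "\<dots> = exp (1 + 2 * x) * x powr (- (a + v)) * (p * x powr (- d)) ^ j *
     (real ((j + r) choose r) * (w * x powr (- a)) ^ r) * (t powr (a + v - 1) * exp (2 * x * t))"
    unfolding powr_mlexp[OF x] by (simp add: power_mult_distrib mult_ac)
  finally show "\<bar>mlterm p w a d v j r t\<bar> \<le> exp (1 + 2 * x) * x powr (- (a + v)) * (p * x powr (- d)) ^ j *
     (real ((j + r) choose r) * (w * x powr (- a)) ^ r) * (t powr (a + v - 1) * exp (2 * x * t))" .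
qed

lemma mlterm_laplace:
  assumes z: "z > 0"
  shows "laplace (mlterm p w a d v j r) z = z powr (- (a + v)) * (- p * z powr (- d)) ^ j *
     (real ((j + r) choose r) * (- w * z powr (- a)) ^ r)"
proof -
  have G: "Gamma (mlexp a d v j r) > 0" using Gamma_real_pos[OF mlexp_pos] .
  have "laplace (mlterm p w a d v j r) z = (\<integral>t. ((- p) ^ j * real ((j + r) choose r) * (- w) ^ r / Gamma (mlexp a d v j r)) *
      (indicator {0<..} t * (exp (- z * t) * t powr (mlexp a d v j r - 1))) \<partial>lborel)"
    unfolding laplace_def set_lebesgue_integral_def
    by (intro Bochner_Integration.integral_cong) (auto simp: mlterm_def)
  also have "\<dots> = ((- p) ^ j * real ((j + r) choose r) * (- w) ^ r / Gamma (mlexp a d v j r)) * (Gamma (mlexp a d v j r) / z powr (mlexp a d v j r))"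
    using has_bochner_integral_powr_exp[OF mlexp_pos[of j r] z] by (simp add: has_bochner_integral_iff)
  also have "\<dots> = (- p) ^ j * real ((j + r) choose r) * (- w) ^ r * z powr (- mlexp a d v j r)"
    using G by (simp add: powr_minus divide_inverse)
  also have "\<dots> = z powr (- (a + v)) * (- p * z powr (- d)) ^ j *
     (real ((j + r) choose r) * (- w * z powr (- a)) ^ r)"
    unfolding powr_mlexp[OF z] power_mult_distrib by (simp add: mult_ac)
  finally show ?thesis .
qed

text \<open>Constants at x and transforms at z are summed by the same two steps: a negative binomial
  series in r, then a geometric series in j. The condition \<open>small\<close> makes both converge
  for the constants.\<close>

lemma mlseries:
  assumes x: "x > 0" and small: "w * x powr (- a) + p * x powr (- d) < 1"
  shows "\<exists>C. tame (a + v) (2 * x) C (\<lambda>t. \<Sum>j. \<Sum>r. mlterm p w a d v j r t)"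
    and "\<And>z. z > 2 * x \<Longrightarrow> laplace (\<lambda>t. \<Sum>j. \<Sum>r. mlterm p w a d v j r t) z = z powr (- (a + v)) / (1 + w * z powr (- a) + p * z powr (- d))"
    and "\<And>t. t > 0 \<Longrightarrow> summable (\<lambda>j. \<Sum>r. mlterm p w a d v j r t)"
    and "\<And>t. t > 0 \<Longrightarrow> summable (\<lambda>r. mlterm p w a d v j r t)"
proof -
  have av: "a + v > 0" using a v by simp
  have px: "p * x powr (- d) \<ge> 0" using p by simp
  have wx: "w * x powr (- a) \<ge> 0" using w by simp
  \<comment> \<open>Summing the constants over r leaves 1 / u ^ Suc j, so the outer ratio is p * x
    powr (- d) / u; that it lies below 1 is exactly \<open>small\<close>.\<close>
  define u where "u = 1 - w * x powr (- a)"
  have u: "u > 0" "p * x powr (- d) < u" using small px by (auto simp: u_def)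
  define E where "E = exp (1 + 2 * x) * x powr (- (a + v))"
  define K where "K j r = E * (p * x powr (- d)) ^ j * (real ((j + r) choose r) * (w * x powr (- a)) ^ r)" for j r
  have Ks: "K j sums (E * (p * x powr (- d)) ^ j * (1 / u ^ Suc j))" for j
    unfolding K_def u_def using wx px small by (intro sums_mult negative_binomial_sums) auto
  have S: "tame (a + v) (2 * x) (suminf (K j)) (\<lambda>t. \<Sum>r. mlterm p w a d v j r t)" 
    "\<And>z. z > 2 * x \<Longrightarrow> (\<lambda>r. laplace (mlterm p w a d v j r) z) sums laplace (\<lambda>t. \<Sum>r. mlterm p w a d v j r t) z"
    "\<And>t. t > 0 \<Longrightarrow> summable (\<lambda>r. \<bar>mlterm p w a d v j r t\<bar>)" for j
    using tame_series[of "a + v" "2 * x" "K j" "mlterm p w a d v j"] mlterm_tame[OF x, of j] Ks[of j] av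
    by (auto simp: K_def E_def sums_iff)
  have Kj: "suminf (K j) = E / u * (p * x powr (- d) / u) ^ j" for j
    using Ks[of j] by (simp add: sums_iff power_divide)
  have "summable (\<lambda>j. suminf (K j))"
    unfolding Kj using u px by (intro summable_mult summable_geometric) auto
  note T = tame_series[of "a + v" "2 * x" "\<lambda>j. suminf (K j)" "\<lambda>j t. \<Sum>r. mlterm p w a d v j r t", OF S(1) this av]
  show "\<exists>C. tame (a + v) (2 * x) C (\<lambda>t. \<Sum>j. \<Sum>r. mlterm p w a d v j r t)" using T(1) by blast
  show "summable (\<lambda>j. \<Sum>r. mlterm p w a d v j r t)" if "t > 0" for t using T(3)[OF that] by (rule summable_rabs_cancel)
  show "summable (\<lambda>r. mlterm p w a d v j r t)" if "t > 0" for t using S(3)[OF that] by (rule summable_rabs_cancel)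
  fix z assume z: "z > 2 * x"
  \<comment> \<open>Both powers have negative exponents, so the smallness condition passes from x to
    every larger z.\<close>
  have z0: "z > 0" "z \<ge> x" using x z by auto
  define W where "W = w * z powr (- a)"
  define P where "P = p * z powr (- d)"
  have W: "0 \<le> W" "W \<le> w * x powr (- a)" unfolding W_def using w a x z0 by (auto intro!: mult_left_mono powr_mono2')
  have P: "0 \<le> P" "P \<le> p * x powr (- d)" unfolding P_def using p d x z0 by (auto intro!: mult_left_mono powr_mono2')
  have WP: "W + P < 1" using W P small by simp
  have L: "laplace (\<lambda>t. \<Sum>r. mlterm p w a d v j r t) z = z powr (- (a + v)) * (- P) ^ j * (1 / (1 - (- W)) ^ Suc j)" for j
  proof -
    have "(\<lambda>r. laplace (mlterm p w a d v j r) z) sums (z powr (- (a + v)) * (- P) ^ j * (1 / (1 - (- W)) ^ Suc j))"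
      unfolding mlterm_laplace[OF z0(1)] P_def W_def mult_minus_left [symmetric]
      using W P WP by (intro sums_mult negative_binomial_sums) (auto simp: W_def)
    then show ?thesis using S(2)[OF z] sums_unique2 by blast
  qed
  have "(\<lambda>j. z powr (- (a + v)) / (1 + W) * (- P / (1 + W)) ^ j) sums (z powr (- (a + v)) / (1 + W) * (1 / (1 - (- P / (1 + W)))))"
    using W P WP by (intro sums_mult geometric_sums) (auto simp: field_simps)
  also have "(\<lambda>j. z powr (- (a + v)) / (1 + W) * (- P / (1 + W)) ^ j) = (\<lambda>j. laplace (\<lambda>t. \<Sum>r. mlterm p w a d v j r t) z)"
    unfolding L by (simp only: power_divide) (simp add: field_simps)
  also have "z powr (- (a + v)) / (1 + W) * (1 / (1 - (- P / (1 + W)))) = z powr (- (a + v)) / (1 + W + P)"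
  proof -
    have n: "1 + W \<noteq> 0" using W by simp
    then have "1 - (- P / (1 + W)) = (1 + W + P) / (1 + W)" by (simp add: field_simps)
    then show ?thesis using n by simp
  qed
  finally show "laplace (\<lambda>t. \<Sum>j. \<Sum>r. mlterm p w a d v j r t) z = z powr (- (a + v)) / (1 + w * z powr (- a) + p * z powr (- d))"
    using T(2)[OF z] sums_unique2 by (auto simp: W_def P_def)
qed

end

lemma h_fun_eq_mlseries:
  assumes c: "c1 > 0" "c2 \<ge> 0" and al: "0 < \<alpha>2" "\<alpha>2 < \<alpha>1" and w: "lam + real k * mu > 0" and N: "N \<ge> 1" and t: "t > 0"
  defines "p \<equiv> c2 / c1" and "w' \<equiv> (lam + real k * mu) / c1" and "d \<equiv> \<alpha>1 - \<alpha>2" and "v \<equiv> 1 / real N"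
  assumes x: "x > 0" and small: "w' * x powr (- \<alpha>1) + p * x powr (- d) < 1"
  shows "h_fun lam mu k \<alpha>1 \<alpha>2 c1 c2 N t = (\<Sum>j. \<Sum>r. mlterm p w' \<alpha>1 d v j r t)"
proof -
  have pos: "p \<ge> 0" "w' > 0" "\<alpha>1 > 0" "d > 0" "v > 0" using c al w N by (auto simp: p_def w'_def d_def v_def)
  note S = mlseries[OF pos x small]
  have term_eq: "mlterm p w' \<alpha>1 d v j r t = (t powr (\<alpha>1 - (real N - 1) / real N) * ((- p) ^ j * t powr (d * real j))) * 
     (Gamma ((real j + 1) + real r) * (- w' * t powr \<alpha>1) ^ r / (fact r * Gamma (real j + 1) * Gamma (\<alpha>1 * real r + (\<alpha>1 + d * real j + v))))" for j r
  proof -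
    have G: "Gamma (real j + 1 + real r) = fact (j + r)" "Gamma (real j + 1) = fact j"
      using Gamma_fact[of "j + r", where ?'a = real] Gamma_fact[of j, where ?'a = real] by (simp_all add: add_ac)
    have ch: "real ((j + r) choose r) = fact (j + r) / (fact r * fact j)"
      using binomial_fact[of r "j + r", where ?'a = real] by simp
    have e1: "mlexp \<alpha>1 d v j r - 1 = (\<alpha>1 - (real N - 1) / real N) + d * real j + \<alpha>1 * real r"
      using N by (simp add: mlexp_def v_def field_simps)
    have e2: "mlexp \<alpha>1 d v j r = \<alpha>1 * real r + (\<alpha>1 + d * real j + v)"
      by (simp add: mlexp_def)
    have e3: "t powr (mlexp \<alpha>1 d v j r - 1) = t powr (\<alpha>1 - (real N - 1) / real N) * t powr (d * real j) * (t powr \<alpha>1) ^ r"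
      unfolding e1 powr_add using t by (simp add: powr_powr [symmetric] powr_realpow)
    show ?thesis unfolding mlterm_def e3 unfolding ch G e2 power_mult_distrib by simp
  qed
  define A where "A j r = Gamma ((real j + 1) + real r) * (- w' * t powr \<alpha>1) ^ r / (fact r * Gamma (real j + 1) * Gamma (\<alpha>1 * real r + (\<alpha>1 + d * real j + v)))" for j r
  define B where "B j = (- p) ^ j * t powr (d * real j)" for j
  define T where "T = t powr (\<alpha>1 - (real N - 1) / real N)"
  have te: "mlterm p w' \<alpha>1 d v j r t = T * (B j * A j r)" for j r
    using term_eq[of j r] by (simp add: A_def B_def T_def)
  have T0: "T \<noteq> 0" using t by (simp add: T_def)
  have s1: "summable (\<lambda>r. B j * A j r)" for j
    using S(4)[OF t, of j] T0 unfolding te by (simp add: summable_cmult_iff)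
  have in1: "(\<Sum>r. mlterm p w' \<alpha>1 d v j r t) = T * (\<Sum>r. B j * A j r)" for j
    unfolding te by (rule suminf_mult[OF s1])
  have s2: "summable (\<lambda>j. \<Sum>r. B j * A j r)" using S(3)[OF t] T0 unfolding in1 by (simp add: summable_cmult_iff)
  \<comment> \<open>If c2 = 0, then B j = 0 for j \<ge> 1. Summability of A j can then not be read
    off from that of the product, but both sides are 0.\<close>
  have in2: "(\<Sum>r. B j * A j r) = B j * (\<Sum>r. A j r)" for j
  proof (cases "B j = 0")
    case False
    then have "summable (A j)" using s1[of j] by (simp add: summable_cmult_iff)
    then show ?thesis by (rule suminf_mult)
  qed simp
  have "(\<Sum>j. \<Sum>r. mlterm p w' \<alpha>1 d v j r t) = T * (\<Sum>j. B j * (\<Sum>r. A j r))"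
    unfolding in1 using suminf_mult[OF s2, of T] in2 by simp
  also have "\<dots> = h_fun lam mu k \<alpha>1 \<alpha>2 c1 c2 N t"
    unfolding h_fun_def mittag_leffler3_def T_def B_def A_def p_def w'_def d_def v_def by simp
  finally show ?thesis by simp
qed

lemma tame_cong: "(\<And>t. t > 0 \<Longrightarrow> f t = g t) \<Longrightarrow> tame b c C f \<longleftrightarrow> tame b c C g"
  unfolding tame_def by (intro conj_cong continuous_on_cong) auto

lemma laplace_cong: "(\<And>t. t > 0 \<Longrightarrow> f t = g t) \<Longrightarrow> laplace f z = laplace g z"
  unfolding laplace_def by (intro set_lebesgue_integral_cong) auto

text \<open>The threshold 2 * x comes from the smallness condition, in which v = 1 / N does not
  occur, so it is common to all N. The N-th power turns z powr (- v) into 1 / z.\<close>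

lemma conv_power_h_fun_laplace:
  assumes c: "c1 > 0" "c2 \<ge> 0" and al: "0 < \<alpha>2" "\<alpha>2 < \<alpha>1" and w: "lam + real k * mu > 0"
  shows "\<exists>c>0. \<forall>N\<ge>1. \<exists>b>0. \<exists>C. tame b c C (conv_power (h_fun lam mu k \<alpha>1 \<alpha>2 c1 c2 N) N) \<and>
    (\<forall>z>c. laplace (conv_power (h_fun lam mu k \<alpha>1 \<alpha>2 c1 c2 N) N) z =
       c1 ^ N / (z * (lam + real k * mu + (c1 * z powr \<alpha>1 + c2 * z powr \<alpha>2)) ^ N))"
proof -
  define p where "p = c2 / c1"
  define w' where "w' = (lam + real k * mu) / c1"
  define d where "d = \<alpha>1 - \<alpha>2"
  have pos: "p \<ge> 0" "w' > 0" "\<alpha>1 > 0" "d > 0" using c al w by (auto simp: p_def w'_def d_def)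
  have "((\<lambda>x. w' * x powr (- \<alpha>1) + p * x powr (- d)) \<longlongrightarrow> w' * 0 + p * 0) at_top"
    using pos by (intro tendsto_intros tendsto_neg_powr filterlim_ident) auto
  then have "eventually (\<lambda>x. w' * x powr (- \<alpha>1) + p * x powr (- d) < 1) at_top"
    by (rule order_tendstoD) simp
  then have "eventually (\<lambda>x. x > 0 \<and> w' * x powr (- \<alpha>1) + p * x powr (- d) < 1) at_top"
    using eventually_gt_at_top[of 0] by eventually_elim simp
  then obtain x where x: "x > 0" "w' * x powr (- \<alpha>1) + p * x powr (- d) < 1"
    using eventually_happens'[OF trivial_limit_at_top_linorder] by blast
  show ?thesis
  proof (rule exI[of _ "2 * x"], intro conjI allI impI)
    fix N :: nat assume N: "N \<ge> 1"
    define v where "v = 1 / real N"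
    have v: "v > 0" using N by (simp add: v_def)
    let ?h = "h_fun lam mu k \<alpha>1 \<alpha>2 c1 c2 N"
    have he: "?h t = (\<Sum>j. \<Sum>r. mlterm p w' \<alpha>1 d v j r t)" if "t > 0" for t
      unfolding p_def w'_def d_def v_def
      by (rule h_fun_eq_mlseries[OF c al w N that x(1)]) (use x(2) in \<open>simp add: p_def w'_def d_def\<close>)
    note S = mlseries[OF pos v x]
    obtain C where "tame (\<alpha>1 + v) (2 * x) C (\<lambda>t. \<Sum>j. \<Sum>r. mlterm p w' \<alpha>1 d v j r t)"
      using S(1) by blast
    then have C: "tame (\<alpha>1 + v) (2 * x) C ?h"
      by (subst tame_cong[OF he])
    have av: "\<alpha>1 + v > 0" using pos v by simp
    have L: "laplace ?h z = z powr (- v) * (c1 / (lam + real k * mu + (c1 * z powr \<alpha>1 + c2 * z powr \<alpha>2)))" if z: "z > 2 * x" for z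
    proof -
      have z0: "z > 0" using x z by simp
      have "laplace ?h z = z powr (- (\<alpha>1 + v)) / (1 + w' * z powr (- \<alpha>1) + p * z powr (- d))"
        using trans[OF laplace_cong[OF he] S(2)[OF z]] .
      also have "\<dots> = z powr (- v) / (z powr \<alpha>1 * (1 + w' * z powr (- \<alpha>1) + p * z powr (- d)))"
        using z0 by (simp add: powr_diff powr_minus divide_inverse mult_ac)
      also have "z powr \<alpha>1 * (1 + w' * z powr (- \<alpha>1) + p * z powr (- d)) = z powr \<alpha>1 + w' + p * (z powr \<alpha>1 * z powr (- d))"
      proof -
        have "z powr \<alpha>1 * z powr (- \<alpha>1) = 1" using z0 by (simp add: powr_minus)
        then show ?thesis by (simp add: distrib_left mult.left_commute[of "z powr \<alpha>1"])
      qed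
      also have "z powr \<alpha>1 * z powr (- d) = z powr \<alpha>2" by (simp add: powr_add [symmetric] d_def)
      also have "z powr \<alpha>1 + w' + p * z powr \<alpha>2 = (lam + real k * mu + (c1 * z powr \<alpha>1 + c2 * z powr \<alpha>2)) / c1"
        using c by (simp add: p_def w'_def field_simps)
      finally show ?thesis by simp
    qed
    from conv_power_tame_laplace[OF C av N] obtain C'
      where C': "tame (real N * (\<alpha>1 + v)) (2 * x) C' (conv_power ?h N)"
        and L': "\<And>z. z > 2 * x \<Longrightarrow> laplace (conv_power ?h N) z = laplace ?h z ^ N" by blast
    show "\<exists>b>0. \<exists>C. tame b (2 * x) C (conv_power ?h N) \<and>
      (\<forall>z>2 * x. laplace (conv_power ?h N) z = c1 ^ N / (z * (lam + real k * mu + (c1 * z powr \<alpha>1 + c2 * z powr \<alpha>2)) ^ N))"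
    proof (rule exI[of _ "real N * (\<alpha>1 + v)"], intro conjI exI[of _ C'] C' allI impI)
      show "real N * (\<alpha>1 + v) > 0" using N av by simp
      fix z assume z: "z > 2 * x"
      have z0: "z > 0" using x z by simp
      have "(z powr (- v)) ^ N = z powr (- v * real N)" using z0
        by (simp only: powr_powr [symmetric]) (simp add: powr_realpow)
      also have "\<dots> = 1 / z" using N z0 by (simp add: v_def powr_minus_divide)
      finally show "laplace (conv_power ?h N) z = c1 ^ N / (z * (lam + real k * mu + (c1 * z powr \<alpha>1 + c2 * z powr \<alpha>2)) ^ N)"
        using L'[OF z] L[OF z] by (simp add: power_mult_distrib power_divide)
    qed
  qed (use x in simp)
qed

section \<open>Jump chains with exponential holding times\<close>

lemma nn_integral_exp_tail:
  fixes z v :: real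
  assumes "z > 0"
  shows "(\<integral>\<^sup>+t. ennreal (z * exp (- z * t)) * indicator {v..} t \<partial>lborel) = ennreal (exp (- z * v))"
proof -
  have "(\<integral>\<^sup>+t. ennreal (z * exp (- z * t)) * indicator {v..} t \<partial>lborel) = ennreal (0 - (- exp (- z * v)))"
  proof (rule nn_integral_FTC_atLeast)
    show "((\<lambda>t. - exp (- z * t)) \<longlongrightarrow> 0) at_top"
      using assms by real_asymp
  qed (use assms in \<open>auto intro!: derivative_eq_intros\<close>)
  then show ?thesis by simp
qed

text \<open>The weight exp (- z * V) is the integral of z * exp (- z * t) over t \<ge> V, and
  Tonelli does the rest. The factor g lets the identity serve both for one holding time along a
  weighted path and for a distribution function restricted to an event.\<close>

lemma (in sigma_finite_measure) nn_integral_exp_eq_cdf_transform: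
  fixes g :: "'a \<Rightarrow> ennreal" and V :: "'a \<Rightarrow> real"
  assumes [measurable]: "g \<in> borel_measurable M" "V \<in> borel_measurable M"
    and z: "z > 0" and nonneg: "AE \<omega> in M. g \<omega> \<noteq> 0 \<longrightarrow> V \<omega> \<ge> 0"
  shows "(\<integral>\<^sup>+\<omega>. g \<omega> * ennreal (exp (- z * V \<omega>)) \<partial>M) =
    (\<integral>\<^sup>+t. ennreal (z * exp (- z * t)) * indicator {0..} t * (\<integral>\<^sup>+\<omega>. g \<omega> * indicator {\<omega>. V \<omega> \<le> t} \<omega> \<partial>M) \<partial>lborel)"
proof -
  interpret P: pair_sigma_finite M lborel ..
  have ind: "(\<lambda>(\<omega>, t). indicator {\<omega>. V \<omega> \<le> t} \<omega> :: ennreal) \<in> borel_measurable (M \<Otimes>\<^sub>M lborel)"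
  proof -
    have "(\<lambda>(\<omega>, t). indicator {\<omega>. V \<omega> \<le> t} \<omega> :: ennreal) = (\<lambda>x. indicator {x. V (fst x) \<le> snd x} x)"
      by (auto simp: indicator_def fun_eq_iff)
    also have "\<dots> \<in> borel_measurable (M \<Otimes>\<^sub>M lborel)"
      by (rule borel_measurable_indicator') measurable
    finally show ?thesis .
  qed
  have "(\<integral>\<^sup>+\<omega>. g \<omega> * ennreal (exp (- z * V \<omega>)) \<partial>M) =
    (\<integral>\<^sup>+\<omega>. \<integral>\<^sup>+t. g \<omega> * (ennreal (z * exp (- z * t)) * indicator {0..} t * indicator {\<omega>. V \<omega> \<le> t} \<omega>) \<partial>lborel \<partial>M)"
  proof (rule nn_integral_cong_AE, use nonneg in eventually_elim)
    fix \<omega> assume V: "g \<omega> \<noteq> 0 \<longrightarrow> V \<omega> \<ge> 0"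
    show "g \<omega> * ennreal (exp (- z * V \<omega>)) =
      (\<integral>\<^sup>+t. g \<omega> * (ennreal (z * exp (- z * t)) * indicator {0..} t * indicator {\<omega>. V \<omega> \<le> t} \<omega>) \<partial>lborel)"
    proof (cases "g \<omega> = 0")
      case False
      then have "(\<integral>\<^sup>+t. ennreal (z * exp (- z * t)) * indicator {0..} t * indicator {\<omega>. V \<omega> \<le> t} \<omega> \<partial>lborel) =
          (\<integral>\<^sup>+t. ennreal (z * exp (- z * t)) * indicator {V \<omega>..} t \<partial>lborel)"
        using V by (intro nn_integral_cong) (auto simp: indicator_def)
      then have e: "(\<integral>\<^sup>+t. ennreal (z * exp (- z * t)) * indicator {0..} t * indicator {\<omega>. V \<omega> \<le> t} \<omega> \<partial>lborel) =
          ennreal (exp (- z * V \<omega>))"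
        using nn_integral_exp_tail[OF z] by simp
      have "(\<lambda>t. indicator {\<omega>. V \<omega> \<le> t} \<omega> :: ennreal) = indicator {V \<omega>..}"
        by (auto simp: indicator_def fun_eq_iff)
      then have [measurable]: "(\<lambda>t. indicator {\<omega>. V \<omega> \<le> t} \<omega> :: ennreal) \<in> borel_measurable lborel" by simp
      show ?thesis by (subst nn_integral_cmult) (measurable, simp only: e)
    qed simp
  qed
  also have "\<dots> = (\<integral>\<^sup>+t. \<integral>\<^sup>+\<omega>. g \<omega> * (ennreal (z * exp (- z * t)) * indicator {0..} t * indicator {\<omega>. V \<omega> \<le> t} \<omega>) \<partial>M \<partial>lborel)"
    by (rule P.Fubini' [symmetric]) (use ind in measurable)
  also have "\<dots> = (\<integral>\<^sup>+t. ennreal (z * exp (- z * t)) * indicator {0..} t * (\<integral>\<^sup>+\<omega>. g \<omega> * indicator {\<omega>. V \<omega> \<le> t} \<omega> \<partial>M) \<partial>lborel)"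
  proof (rule nn_integral_cong)
    fix t :: real
    have [measurable]: "(\<lambda>\<omega>. indicator {\<omega>. V \<omega> \<le> t} \<omega> :: ennreal) \<in> borel_measurable M"
      by (rule borel_measurable_indicator') measurable
    have "(\<lambda>\<omega>. g \<omega> * (ennreal (z * exp (- z * t)) * indicator {0..} t * indicator {\<omega>. V \<omega> \<le> t} \<omega>)) =
       (\<lambda>\<omega>. (ennreal (z * exp (- z * t)) * indicator {0..} t) * (g \<omega> * indicator {\<omega>. V \<omega> \<le> t} \<omega>))"
      by (simp add: mult_ac)
    then show "(\<integral>\<^sup>+\<omega>. g \<omega> * (ennreal (z * exp (- z * t)) * indicator {0..} t * indicator {\<omega>. V \<omega> \<le> t} \<omega>) \<partial>M) =
       ennreal (z * exp (- z * t)) * indicator {0..} t * (\<integral>\<^sup>+\<omega>. g \<omega> * indicator {\<omega>. V \<omega> \<le> t} \<omega> \<partial>M)"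
      by (simp only:) (rule nn_integral_cmult, measurable)
  qed
  finally show ?thesis .
qed

text \<open>In each state of the invariant set V the finitely many states of \<open>succ\<close>
  carry total jump probability 1, so that conditioning on the next state is a finite sum.\<close>

locale jump_hold = prob_space M for M :: "'w measure" +
  fixes q :: "'s::countable \<Rightarrow> 's \<Rightarrow> real" and x0 :: 's and Z :: "nat \<Rightarrow> 'w \<Rightarrow> 's" and S :: "nat \<Rightarrow> 'w \<Rightarrow> real"
    and V :: "'s set" and succ :: "'s \<Rightarrow> 's set"
  assumes Z [measurable]: "\<And>i. Z i \<in> measurable M (count_space UNIV)"
    and S [measurable]: "\<And>i. S i \<in> borel_measurable M"
    and law: "\<And>n z s. (\<And>i. i < n \<Longrightarrow> 0 \<le> s i) \<Longrightarrow>
        measure M {\<omega> \<in> space M. (\<forall>i\<le>n. Z i \<omega> = z i) \<and> (\<forall>i<n. s i < S i \<omega>)} =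
          of_bool (z 0 = x0) * (\<Prod>i<n. jump_prob q (z i) (z (Suc i)) * exp (- exit_rate q (z i) * s i))"
    and x0: "x0 \<in> V"
    and succ_V: "\<And>x. x \<in> V \<Longrightarrow> succ x \<subseteq> V"
    and succ_fin: "\<And>x. x \<in> V \<Longrightarrow> finite (succ x)"
    and succ_sum: "\<And>x. x \<in> V \<Longrightarrow> (\<Sum>y\<in>succ x. jump_prob q x y) = 1"
    and jump_nonneg: "\<And>x y. 0 \<le> jump_prob q x y"
    and exit_pos: "\<And>x. x \<in> V \<Longrightarrow> exit_rate q x > 0"
begin

definition path :: "nat \<Rightarrow> (nat \<Rightarrow> 's) \<Rightarrow> 'w set" where
  "path n z = {\<omega> \<in> space M. \<forall>i\<le>n. Z i \<omega> = z i}"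

definition valid :: "nat \<Rightarrow> (nat \<Rightarrow> 's) \<Rightarrow> bool" where
  "valid n z \<longleftrightarrow> z 0 = x0 \<and> (\<forall>i<n. z (Suc i) \<in> succ (z i))"

lemma path_sets [measurable]: "path n z \<in> sets M"
  unfolding path_def by measurable

lemma valid_V: "valid n z \<Longrightarrow> i \<le> n \<Longrightarrow> z i \<in> V"
proof (induction i)
  case 0
  then show ?case using x0 by (simp add: valid_def)
next
  case (Suc i)
  then have "z i \<in> V" "z (Suc i) \<in> succ (z i)" by (simp_all add: valid_def)
  then show ?case using succ_V by blast
qed

text \<open>The law is used with all thresholds 0. A prefix event and the disjoint union of its
  admissible one-step extensions have equal probability because the jump probabilities over
  \<open>succ\<close> sum to 1; what is left of the prefix event, including a next holding time
  \<le> 0, is null.\<close>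

lemma AE_valid: "AE \<omega> in M. Z 0 \<omega> = x0 \<and> (\<forall>i. S i \<omega> > 0 \<and> Z (Suc i) \<omega> \<in> succ (Z i \<omega>))"
proof -
  define E where "E n \<omega> \<longleftrightarrow> Z 0 \<omega> = x0 \<and> (\<forall>i<n. S i \<omega> > 0 \<and> Z (Suc i) \<omega> \<in> succ (Z i \<omega>))" for n \<omega>
  have "AE \<omega> in M. E n \<omega>" for n
  proof (induction n)
    case 0
    have "measure M {\<omega> \<in> space M. Z 0 \<omega> = x0} = 1" using law[of 0 "\<lambda>_. 0" "\<lambda>_. x0"] by simp
    then have "AE \<omega> in M. \<omega> \<in> {\<omega> \<in> space M. Z 0 \<omega> = x0}"
      by (subst (asm) prob_eq_1) auto
    then show ?case by (rule AE_mp) (auto simp: E_def)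
  next
    case (Suc n)
    have one: "AE \<omega> in M. \<omega> \<in> path n z \<longrightarrow> E n \<omega> \<longrightarrow> E (Suc n) \<omega>" if v: "valid n z" for z
    proof -
      define A where "A = {\<omega> \<in> space M. (\<forall>i\<le>n. Z i \<omega> = z i) \<and> (\<forall>i<n. 0 < S i \<omega>)}"
      define B where "B y = {\<omega> \<in> space M. (\<forall>i\<le>Suc n. Z i \<omega> = (z(Suc n := y)) i) \<and> (\<forall>i<Suc n. 0 < S i \<omega>)}" for y
      have [measurable]: "A \<in> sets M" "B y \<in> sets M" for y unfolding A_def B_def by measurable
      have zn: "z n \<in> V" using valid_V[OF v, of n] by simp
      have mA: "measure M A = (\<Prod>i<n. jump_prob q (z i) (z (Suc i)))"
        using law[of n "\<lambda>_. 0" z] v unfolding A_def valid_def by simp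
      have mB: "measure M (B y) = measure M A * jump_prob q (z n) y" for y
        using law[of "Suc n" "\<lambda>_. 0" "z(Suc n := y)"] v unfolding B_def mA valid_def
        by simp
      have dis: "disjoint_family_on B (succ (z n))"
        unfolding disjoint_family_on_def B_def by auto
      have "measure M (\<Union>y\<in>succ (z n). B y) = (\<Sum>y\<in>succ (z n). measure M (B y))"
        by (intro finite_measure_finite_Union succ_fin zn dis) auto
      also have "\<dots> = measure M A"
        unfolding mB using succ_sum[OF zn] by (simp add: sum_distrib_left [symmetric])
      finally have eq: "measure M (\<Union>y\<in>succ (z n). B y) = measure M A" .
      have sub: "(\<Union>y\<in>succ (z n). B y) \<subseteq> A"
        unfolding A_def B_def by fastforce
      have [measurable]: "(\<Union>y\<in>succ (z n). B y) \<in> sets M"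
        using succ_fin[OF zn] by (intro sets.finite_UN) auto
      have "measure M (A - (\<Union>y\<in>succ (z n). B y)) = 0"
        using finite_measure_Diff[OF _ _ sub] eq by simp
      then have "A - (\<Union>y\<in>succ (z n). B y) \<in> null_sets M"
        by (intro null_setsI) (auto simp: emeasure_eq_measure)
      then have "AE \<omega> in M. \<omega> \<notin> A - (\<Union>y\<in>succ (z n). B y)" by (rule AE_not_in)
      then show ?thesis
      proof eventually_elim
        case (elim \<omega>)
        show ?case
        proof (intro impI)
          assume p: "\<omega> \<in> path n z" and E: "E n \<omega>"
          then have "\<omega> \<in> A" by (auto simp: A_def path_def E_def)
          then obtain y where y: "y \<in> succ (z n)" "\<omega> \<in> B y" using elim by auto
          have "S n \<omega> > 0" "Z (Suc n) \<omega> = y" "Z n \<omega> = z n" using y(2) by (auto simp: B_def)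
          then show "E (Suc n) \<omega>" using E y(1) by (auto simp: E_def less_Suc_eq)
        qed
      qed
    qed
    \<comment> \<open>Prefixes are coded as lists, which form a countable type, so that the
      exceptional null sets can be united.\<close>
    have "AE \<omega> in M. \<forall>xs :: 's list. valid n (\<lambda>i. xs ! i) \<longrightarrow> \<omega> \<in> path n (\<lambda>i. xs ! i) \<longrightarrow> E n \<omega> \<longrightarrow> E (Suc n) \<omega>"
      unfolding AE_all_countable using one by auto
    then show ?case using Suc.IH AE_space
    proof eventually_elim
      case (elim \<omega>)
      define xs where "xs = map (\<lambda>i. Z i \<omega>) [0..<Suc n]"
      have xs: "xs ! i = Z i \<omega>" if "i \<le> n" for i using that by (simp add: xs_def nth_append del: upt_Suc)
      have "valid n (\<lambda>i. xs ! i)" "\<omega> \<in> path n (\<lambda>i. xs ! i)"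
        using elim xs by (auto simp: valid_def path_def E_def)
      then show ?case using elim by blast
    qed
  qed
  then have "AE \<omega> in M. \<forall>n. E n \<omega>" by (simp add: AE_all_countable)
  then show ?thesis by eventually_elim (auto simp: E_def)
qed

lemma nn_integral_path_split:
  assumes v: "valid n z" and [measurable]: "G \<in> borel_measurable M"
  shows "(\<integral>\<^sup>+\<omega>. indicator (path n z) \<omega> * G \<omega> \<partial>M) =
    (\<Sum>y\<in>succ (z n). \<integral>\<^sup>+\<omega>. indicator (path (Suc n) (z(Suc n := y))) \<omega> * G \<omega> \<partial>M)"
proof -
  have zn: "finite (succ (z n))" using valid_V[OF v, of n] succ_fin by simp
  have "(\<integral>\<^sup>+\<omega>. indicator (path n z) \<omega> * G \<omega> \<partial>M) =
      (\<integral>\<^sup>+\<omega>. (\<Sum>y\<in>succ (z n). indicator (path (Suc n) (z(Suc n := y))) \<omega> * G \<omega>) \<partial>M)"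
  proof (rule nn_integral_cong_AE, use AE_valid AE_space in eventually_elim)
    fix \<omega> assume E: "Z 0 \<omega> = x0 \<and> (\<forall>i. S i \<omega> > 0 \<and> Z (Suc i) \<omega> \<in> succ (Z i \<omega>))" and sp: "\<omega> \<in> space M"
    have "(\<Sum>y\<in>succ (z n). indicator (path (Suc n) (z(Suc n := y))) \<omega> :: ennreal) = indicator (path n z) \<omega>"
    proof (cases "\<omega> \<in> path n z")
      case True
      then have "Z n \<omega> = z n" by (auto simp: path_def)
      then have Zs: "Z (Suc n) \<omega> \<in> succ (z n)" using E by metis
      have "\<omega> \<in> path (Suc n) (z(Suc n := y)) \<longleftrightarrow> y = Z (Suc n) \<omega>" for y
        using True by (auto simp: path_def le_Suc_eq)
      then have "(\<Sum>y\<in>succ (z n). indicator (path (Suc n) (z(Suc n := y))) \<omega> :: ennreal) = 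
         (\<Sum>y\<in>succ (z n). if y = Z (Suc n) \<omega> then 1 else 0)"
        by (intro sum.cong) (auto simp: indicator_def)
      then show ?thesis using Zs zn True by simp
    next
      case False
      then have "\<omega> \<notin> path (Suc n) (z(Suc n := y))" for y
        using sp by (auto simp: path_def le_Suc_eq split: if_splits)
      then show ?thesis using False by simp
    qed
    then show "indicator (path n z) \<omega> * G \<omega> = (\<Sum>y\<in>succ (z n). indicator (path (Suc n) (z(Suc n := y))) \<omega> * G \<omega>)"
      by (simp add: sum_distrib_right [symmetric])
  qed
  also have "\<dots> = (\<Sum>y\<in>succ (z n). \<integral>\<^sup>+\<omega>. indicator (path (Suc n) (z(Suc n := y))) \<omega> * G \<omega> \<partial>M)"
    by (intro nn_integral_sum) measurable
  finally show ?thesis .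
qed

lemma valid_extend: "valid n z \<Longrightarrow> y \<in> succ (z n) \<Longrightarrow> valid (Suc n) (z(Suc n := y))"
  by (auto simp: valid_def less_Suc_eq)


text \<open>The value is the probability that an exponential clock of rate r rings before an
  independent one of rate \<psi>. It is computed from an explicit antiderivative.\<close>

lemma exp_race_integral:
  fixes \<psi> r :: real
  assumes "\<psi> > 0" "r > 0"
  shows "(\<integral>\<^sup>+t. ennreal (\<psi> * exp (- \<psi> * t)) * indicator {0..} t * ennreal (1 - exp (- r * t)) \<partial>lborel) = ennreal (r / (r + \<psi>))"
proof -
  have "(\<integral>\<^sup>+t. ennreal (\<psi> * exp (- \<psi> * t) * (1 - exp (- r * t))) * indicator {0..} t \<partial>lborel)
     = ennreal (0 - (- 1 + \<psi> / (r + \<psi>)))"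
  proof -
    have "(\<integral>\<^sup>+t. ennreal (\<psi> * exp (- \<psi> * t) * (1 - exp (- r * t))) * indicator {0..} t \<partial>lborel)
      = ennreal (0 - (- exp (- \<psi> * 0) + \<psi> / (r + \<psi>) * exp (- (r + \<psi>) * 0)))"
    proof (rule nn_integral_FTC_atLeast)
      show "((\<lambda>t. - exp (- \<psi> * t) + \<psi> / (r + \<psi>) * exp (- (r + \<psi>) * t)) \<longlongrightarrow> 0) at_top"
      proof -
        have A: "((\<lambda>t. exp (- u * t)) \<longlongrightarrow> 0) at_top" if "u > 0" for u :: real using that by real_asymp
        have "((\<lambda>t. - exp (- \<psi> * t) + \<psi> / (r + \<psi>) * exp (- (r + \<psi>) * t)) \<longlongrightarrow> - 0 + \<psi> / (r + \<psi>) * 0) at_top"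
          using assms by (intro tendsto_intros A) auto
        then show ?thesis by simp
      qed
      show "((\<lambda>t. - exp (- \<psi> * t) + \<psi> / (r + \<psi>) * exp (- (r + \<psi>) * t)) has_real_derivative
          \<psi> * exp (- \<psi> * t) * (1 - exp (- r * t))) (at t)" for t
      proof -
        have D: "((\<lambda>t. - exp (- \<psi> * t) + c * exp (- u * t)) has_real_derivative
            (\<psi> * exp (- \<psi> * t) + (c * (- u)) * exp (- u * t))) (at t)" for c u
          by (auto intro!: derivative_eq_intros)
        have e1: "exp (- (r + \<psi>) * t) = exp (- r * t) * exp (- \<psi> * t)" by (simp add: exp_add [symmetric] algebra_simps)
        have cancel: "\<psi> / u * (- u) = - \<psi>" if "u > 0" for u :: real using that by simp
        have e2: "\<psi> / (r + \<psi>) * (- (r + \<psi>)) = - \<psi>" by (rule cancel) (rule add_pos_pos[OF assms(2,1)])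
        have e3: "\<psi> * exp (- \<psi> * t) + (\<psi> / (r + \<psi>) * (- (r + \<psi>))) * exp (- (r + \<psi>) * t) = \<psi> * exp (- \<psi> * t) * (1 - exp (- r * t))"
          unfolding e1 e2 by (simp add: algebra_simps)
        show ?thesis using D[of "\<psi> / (r + \<psi>)" "r + \<psi>"] unfolding e3 .
      qed
    qed (use assms in auto)
    then show ?thesis by simp
  qed
  also have "0 - (- 1 + \<psi> / (r + \<psi>)) = r / (r + \<psi>)" using assms by (simp add: field_simps)
  also have "(\<integral>\<^sup>+t. ennreal (\<psi> * exp (- \<psi> * t) * (1 - exp (- r * t))) * indicator {0..} t \<partial>lborel) =
    (\<integral>\<^sup>+t. ennreal (\<psi> * exp (- \<psi> * t)) * indicator {0..} t * ennreal (1 - exp (- r * t)) \<partial>lborel)"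
    using assms by (intro nn_integral_cong) (auto simp: ennreal_mult mult_ac indicator_def)
  finally show ?thesis .
qed

text \<open>Interpolates between the assumed law (m = 0, survival events only) and the joint Laplace
  transform of the holding times on a path (m = n). Each induction step trades the survival event of
  one holding time for an exponential weight.\<close>

lemma survival_transform:
  assumes v: "valid n z" and \<psi>: "\<And>i. \<psi> i \<ge> 0"
  shows "m \<le> n \<Longrightarrow> (\<And>i. s i \<ge> 0) \<Longrightarrow>
    (\<integral>\<^sup>+\<omega>. indicator (path n z) \<omega> * (\<Prod>i<m. ennreal (exp (- \<psi> i * S i \<omega>))) *
        (\<Prod>i\<in>{m..<n}. indicator {\<omega>. s i < S i \<omega>} \<omega>) \<partial>M) =
    ennreal ((\<Prod>i<n. jump_prob q (z i) (z (Suc i))) * (\<Prod>i<m. exit_rate q (z i) / (exit_rate q (z i) + \<psi> i)) *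
        (\<Prod>i\<in>{m..<n}. exp (- exit_rate q (z i) * s i)))"
proof (induction m arbitrary: s)
  case 0
  have e: "indicator (path n z) \<omega> * (\<Prod>i\<in>{0..<n}. indicator {\<omega>. s i < S i \<omega>} \<omega>) =
      (indicator {\<omega> \<in> space M. (\<forall>i\<le>n. Z i \<omega> = z i) \<and> (\<forall>i<n. s i < S i \<omega>)} \<omega> :: ennreal)" for \<omega>
    by (cases "\<forall>i<n. s i < S i \<omega>") (auto simp: indicator_def path_def prod_zero_iff)
  have "z 0 = x0" using v by (simp add: valid_def)
  then show ?case
    using law[of n s z] 0
    by (simp add: e emeasure_eq_measure prod.distrib lessThan_atLeast0)
next
  case (Suc m)
  have mn: "m < n" "m \<le> n" using Suc.prems by auto
  define r where "r = exit_rate q (z m)"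
  have r: "r > 0" using exit_pos[OF valid_V[OF v, of m]] mn by (simp add: r_def)
  define g where "g \<omega> = indicator (path n z) \<omega> * (\<Prod>i<m. ennreal (exp (- \<psi> i * S i \<omega>))) *
        (\<Prod>i\<in>{Suc m..<n}. indicator {\<omega>. s i < S i \<omega>} \<omega>)" for \<omega>
  define c where "c = (\<Prod>i<n. jump_prob q (z i) (z (Suc i))) * (\<Prod>i<m. exit_rate q (z i) / (exit_rate q (z i) + \<psi> i)) *
        (\<Prod>i\<in>{Suc m..<n}. exp (- exit_rate q (z i) * s i))"
  have qpos: "i < n \<Longrightarrow> exit_rate q (z i) > 0" for i using exit_pos[OF valid_V[OF v, of i]] by simp
  have c0: "c \<ge> 0" unfolding c_def
    using mn \<psi>
    by (intro mult_nonneg_nonneg prod_nonneg ballI divide_nonneg_nonneg add_nonneg_nonneg jump_nonneg)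
      (auto intro!: less_imp_le qpos)
  have ind [measurable]: "(\<lambda>\<omega>. indicator {\<omega>. a < S i \<omega>} \<omega> :: ennreal) \<in> borel_measurable M" for a i
    by (rule borel_measurable_indicator') measurable
  have [measurable]: "g \<in> borel_measurable M" unfolding g_def by measurable
  have split: "{m..<n} = insert m {Suc m..<n}" using mn by auto
  \<comment> \<open>The induction hypothesis with the threshold at index m replaced by a is the
    survival function of S m under the weight g.\<close>
  have tail: "(\<integral>\<^sup>+\<omega>. g \<omega> * indicator {\<omega>. a < S m \<omega>} \<omega> \<partial>M) = ennreal (c * exp (- r * a))" if a: "a \<ge> 0" for a
  proof -
    have "(\<integral>\<^sup>+\<omega>. g \<omega> * indicator {\<omega>. a < S m \<omega>} \<omega> \<partial>M) =
       (\<integral>\<^sup>+\<omega>. indicator (path n z) \<omega> * (\<Prod>i<m. ennreal (exp (- \<psi> i * S i \<omega>))) *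
        (\<Prod>i\<in>{m..<n}. indicator {\<omega>. (s(m := a)) i < S i \<omega>} \<omega>) \<partial>M)"
      unfolding split g_def by (intro nn_integral_cong) (simp add: mult_ac)
    also have "\<dots> = ennreal ((\<Prod>i<n. jump_prob q (z i) (z (Suc i))) * (\<Prod>i<m. exit_rate q (z i) / (exit_rate q (z i) + \<psi> i)) *
        (\<Prod>i\<in>{m..<n}. exp (- exit_rate q (z i) * (s(m := a)) i)))"
      using Suc.prems a by (intro Suc.IH) (auto simp: mn)
    also have "\<dots> = ennreal (c * exp (- r * a))"
      unfolding split c_def r_def by (simp add: mult_ac)
    finally show ?thesis .
  qed
  have Spos: "AE \<omega> in M. S m \<omega> > 0" using AE_valid by eventually_elim auto
  have tot: "(\<integral>\<^sup>+\<omega>. g \<omega> \<partial>M) = ennreal c"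
  proof -
    have "(\<integral>\<^sup>+\<omega>. g \<omega> \<partial>M) = (\<integral>\<^sup>+\<omega>. g \<omega> * indicator {\<omega>. 0 < S m \<omega>} \<omega> \<partial>M)"
      by (rule nn_integral_cong_AE) (use Spos in \<open>eventually_elim, simp\<close>)
    then show ?thesis using tail[of 0] by simp
  qed
  have cdf: "(\<integral>\<^sup>+\<omega>. g \<omega> * indicator {\<omega>. S m \<omega> \<le> a} \<omega> \<partial>M) = ennreal (c * (1 - exp (- r * a)))" if a: "a \<ge> 0" for a
  proof -
    have [measurable]: "(\<lambda>\<omega>. indicator {\<omega>. S m \<omega> \<le> a} \<omega> :: ennreal) \<in> borel_measurable M"
      by (rule borel_measurable_indicator') measurable
    have "ennreal c = (\<integral>\<^sup>+\<omega>. g \<omega> * indicator {\<omega>. S m \<omega> \<le> a} \<omega> + g \<omega> * indicator {\<omega>. a < S m \<omega>} \<omega> \<partial>M)"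
      unfolding tot [symmetric] by (intro nn_integral_cong) (auto simp: indicator_def)
    also have "\<dots> = (\<integral>\<^sup>+\<omega>. g \<omega> * indicator {\<omega>. S m \<omega> \<le> a} \<omega> \<partial>M) + ennreal (c * exp (- r * a))"
      by (subst nn_integral_add) (measurable, simp add: tail[OF a])
    finally have "(\<integral>\<^sup>+\<omega>. g \<omega> * indicator {\<omega>. S m \<omega> \<le> a} \<omega> \<partial>M) = ennreal c - ennreal (c * exp (- r * a))"
      by (simp add: ennreal_add_diff_cancel_right)
    also have "\<dots> = ennreal (c - c * exp (- r * a))" using c0 by (intro ennreal_minus) auto
    finally show ?thesis by (simp add: algebra_simps)
  qed
  \<comment> \<open>The tail integral needs a positive parameter, so \<psi> m = 0 is separate; it
    occurs for the idle time before the first arrival.\<close>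
  have main: "(\<integral>\<^sup>+\<omega>. g \<omega> * ennreal (exp (- \<psi> m * S m \<omega>)) \<partial>M) = ennreal (c * (r / (r + \<psi> m)))"
  proof (cases "\<psi> m = 0")
    case True
    then show ?thesis using tot r by simp
  next
    case False
    then have pm: "\<psi> m > 0" using \<psi>[of m] by simp
    have "(\<integral>\<^sup>+\<omega>. g \<omega> * ennreal (exp (- \<psi> m * S m \<omega>)) \<partial>M) =
      (\<integral>\<^sup>+t. ennreal (\<psi> m * exp (- \<psi> m * t)) * indicator {0..} t * (\<integral>\<^sup>+\<omega>. g \<omega> * indicator {\<omega>. S m \<omega> \<le> t} \<omega> \<partial>M) \<partial>lborel)"
      by (rule nn_integral_exp_eq_cdf_transform) (use pm Spos in auto)
    also have "\<dots> = (\<integral>\<^sup>+t. ennreal c * (ennreal (\<psi> m * exp (- \<psi> m * t)) * indicator {0..} t * ennreal (1 - exp (- r * t))) \<partial>lborel)"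
    proof (rule nn_integral_cong)
      fix t :: real
      show "ennreal (\<psi> m * exp (- \<psi> m * t)) * indicator {0..} t * (\<integral>\<^sup>+\<omega>. g \<omega> * indicator {\<omega>. S m \<omega> \<le> t} \<omega> \<partial>M) =
        ennreal c * (ennreal (\<psi> m * exp (- \<psi> m * t)) * indicator {0..} t * ennreal (1 - exp (- r * t)))"
      proof (cases "t \<ge> 0")
        case True
        then have "(\<integral>\<^sup>+\<omega>. g \<omega> * indicator {\<omega>. S m \<omega> \<le> t} \<omega> \<partial>M) = ennreal c * ennreal (1 - exp (- r * t))"
          using cdf[OF True] c0 r by (simp add: ennreal_mult)
        then show ?thesis by (simp add: mult_ac)
      qed simp
    qed
    also have "\<dots> = ennreal c * ennreal (r / (r + \<psi> m))"
      by (subst nn_integral_cmult) (measurable, simp only: exp_race_integral[OF pm r])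
    also have "\<dots> = ennreal (c * (r / (r + \<psi> m)))" by (rule ennreal_mult' [OF c0, symmetric])
    finally show ?thesis .
  qed
  have "(\<integral>\<^sup>+\<omega>. indicator (path n z) \<omega> * (\<Prod>i<Suc m. ennreal (exp (- \<psi> i * S i \<omega>))) *
        (\<Prod>i\<in>{Suc m..<n}. indicator {\<omega>. s i < S i \<omega>} \<omega>) \<partial>M) = (\<integral>\<^sup>+\<omega>. g \<omega> * ennreal (exp (- \<psi> m * S m \<omega>)) \<partial>M)"
    unfolding g_def by (intro nn_integral_cong) (simp add: mult_ac)
  then show ?case unfolding main c_def r_def by (simp add: mult_ac)
qed

definition prefix :: "nat \<Rightarrow> (nat \<Rightarrow> 's) \<Rightarrow> (nat \<Rightarrow> real) \<Rightarrow> real" where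
  "prefix n z \<psi> = (\<Prod>i<n. jump_prob q (z i) (z (Suc i)) * (exit_rate q (z i) / (exit_rate q (z i) + \<psi> i)))"

lemma path_transform:
  assumes v: "valid n z" and \<psi>: "\<And>i. \<psi> i \<ge> 0"
  shows "(\<integral>\<^sup>+\<omega>. indicator (path n z) \<omega> * (\<Prod>i<n. ennreal (exp (- \<psi> i * S i \<omega>))) \<partial>M) = ennreal (prefix n z \<psi>)"
  using survival_transform[OF v, of \<psi> n "\<lambda>_. 0"] \<psi> by (simp only: prefix_def prod.distrib) simp

lemma prefix_nonneg: "valid n z \<Longrightarrow> (\<And>i. \<psi> i \<ge> 0) \<Longrightarrow> prefix n z \<psi> \<ge> 0"
  unfolding prefix_def using exit_pos valid_V
  by (intro prod_nonneg ballI mult_nonneg_nonneg divide_nonneg_nonneg add_nonneg_nonneg jump_nonneg)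
    (auto intro: less_imp_le)

lemma prefix_extend:
  "prefix (Suc n) (z(Suc n := y)) \<psi> = prefix n z \<psi> * (jump_prob q (z n) y * (exit_rate q (z n) / (exit_rate q (z n) + \<psi> n)))"
  unfolding prefix_def by simp

text \<open>Each jump multiplies the expectation of exp (- T n) by at most \<theta> / (\<theta> +
  1), because x / (x + 1) increases with the exit rate x. The expectation thus decays geometrically,
  and Markov's inequality gives probability 0 to the event that all jump times stay below K.\<close>

lemma AE_nonexplosion:
  assumes bdd: "\<And>x. x \<in> V \<Longrightarrow> exit_rate q x \<le> \<theta>"
  shows "AE \<omega> in M. \<forall>K. \<exists>n. (\<Sum>i<n. S i \<omega>) > (K :: real)"
proof -
  have th: "\<theta> > 0" using bdd[OF x0] exit_pos[OF x0] by simp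
  define r where "r = \<theta> / (\<theta> + 1)"
  have r: "0 \<le> r" "r < 1" using th by (auto simp: r_def)
  \<comment> \<open>The factor gained at a jump depends on the current state, so the induction runs
    over arbitrary fixed prefixes and a further jumps.\<close>
  have bound: "valid n z \<Longrightarrow> (\<integral>\<^sup>+\<omega>. indicator (path n z) \<omega> * (\<Prod>i<n + a. ennreal (exp (- 1 * S i \<omega>))) \<partial>M) \<le>
      ennreal (prefix n z (\<lambda>_. 1) * r ^ a)" for n z a
  proof (induction a arbitrary: n z)
    case 0
    then show ?case using path_transform[OF 0, of "\<lambda>_. 1"] by simp
  next
    case (Suc a)
    have zn: "z n \<in> V" using valid_V[OF Suc.prems, of n] by simp
    have "(\<integral>\<^sup>+\<omega>. indicator (path n z) \<omega> * (\<Prod>i<n + Suc a. ennreal (exp (- 1 * S i \<omega>))) \<partial>M) =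
      (\<Sum>y\<in>succ (z n). \<integral>\<^sup>+\<omega>. indicator (path (Suc n) (z(Suc n := y))) \<omega> * (\<Prod>i<Suc n + a. ennreal (exp (- 1 * S i \<omega>))) \<partial>M)"
    proof -
      define G where "G \<omega> = (\<Prod>i<Suc n + a. ennreal (exp (- 1 * S i \<omega>)))" for \<omega>
      have "G \<in> borel_measurable M" unfolding G_def by measurable
      from nn_integral_path_split[OF Suc.prems this] show ?thesis by (simp add: G_def)
    qed
    also have "\<dots> \<le> (\<Sum>y\<in>succ (z n). ennreal (prefix (Suc n) (z(Suc n := y)) (\<lambda>_. 1) * r ^ a))"
      by (intro sum_mono Suc.IH valid_extend Suc.prems)
    also have "\<dots> = ennreal (\<Sum>y\<in>succ (z n). prefix (Suc n) (z(Suc n := y)) (\<lambda>_. 1) * r ^ a)"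
      using r Suc.prems by (intro sum_ennreal) (auto intro!: mult_nonneg_nonneg prefix_nonneg valid_extend)
    also have "(\<Sum>y\<in>succ (z n). prefix (Suc n) (z(Suc n := y)) (\<lambda>_. 1) * r ^ a) =
        prefix n z (\<lambda>_. 1) * r ^ a * (exit_rate q (z n) / (exit_rate q (z n) + 1)) * (\<Sum>y\<in>succ (z n). jump_prob q (z n) y)"
      unfolding prefix_extend sum_distrib_left by (simp add: mult_ac)
    also have "\<dots> \<le> prefix n z (\<lambda>_. 1) * r ^ a * r"
    proof -
      have "exit_rate q (z n) / (exit_rate q (z n) + 1) \<le> r"
        using bdd[OF zn] exit_pos[OF zn] th by (simp add: r_def field_simps)
      moreover have "0 \<le> prefix n z (\<lambda>_. 1) * r ^ a" using prefix_nonneg[OF Suc.prems, of "\<lambda>_. 1"] r by simp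
      ultimately show ?thesis unfolding succ_sum[OF zn] mult_1_right by (rule mult_left_mono)
    qed
    finally show ?case by (simp add: mult_ac ennreal_leI)
  qed
  define T where "T n \<omega> = (\<Sum>i<n. S i \<omega>)" for n \<omega>
  have [measurable]: "T n \<in> borel_measurable M" for n unfolding T_def by measurable
  have lt: "(\<integral>\<^sup>+\<omega>. ennreal (exp (- T a \<omega>)) \<partial>M) \<le> ennreal (r ^ a)" for a
  proof -
    have v: "valid 0 (\<lambda>_. x0)" by (simp add: valid_def)
    have "(\<integral>\<^sup>+\<omega>. ennreal (exp (- T a \<omega>)) \<partial>M) = (\<integral>\<^sup>+\<omega>. indicator (path 0 (\<lambda>_. x0)) \<omega> * (\<Prod>i<0 + a. ennreal (exp (- 1 * S i \<omega>))) \<partial>M)"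
    proof (rule nn_integral_cong_AE, use AE_valid AE_space in eventually_elim)
      fix \<omega> assume "Z 0 \<omega> = x0 \<and> (\<forall>i. S i \<omega> > 0 \<and> Z (Suc i) \<omega> \<in> succ (Z i \<omega>))" "\<omega> \<in> space M"
      then show "ennreal (exp (- T a \<omega>)) = indicator (path 0 (\<lambda>_. x0)) \<omega> * (\<Prod>i<0 + a. ennreal (exp (- 1 * S i \<omega>)))"
        by (simp add: path_def T_def prod_ennreal exp_sum [symmetric] sum_negf)
    qed
    also have "\<dots> \<le> ennreal (r ^ a)" using bound[OF v, of a] by (simp add: prefix_def)
    finally show ?thesis .
  qed
  have null: "AE \<omega> in M. \<exists>n. T n \<omega> > real K" for K
  proof -
    define A where "A = {\<omega> \<in> space M. \<forall>n. T n \<omega> \<le> real K}"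
    have [measurable]: "A \<in> sets M" unfolding A_def by measurable
    have l1: "measure M A \<le> exp (real K) * r ^ n" for n
    proof -
      have "ennreal (measure M A) = (\<integral>\<^sup>+\<omega>. indicator A \<omega> \<partial>M)" by (simp add: emeasure_eq_measure)
      also have "\<dots> \<le> (\<integral>\<^sup>+\<omega>. ennreal (exp (real K)) * ennreal (exp (- T n \<omega>)) \<partial>M)"
      proof (rule nn_integral_mono)
        fix \<omega>
        show "indicator A \<omega> \<le> ennreal (exp (real K)) * ennreal (exp (- T n \<omega>))"
          by (cases "\<omega> \<in> A") (auto simp: A_def ennreal_mult'[symmetric] exp_add[symmetric] simp del: ennreal_1 simp flip: ennreal_1 intro!: ennreal_leI)
      qed
      also have "\<dots> = ennreal (exp (real K)) * (\<integral>\<^sup>+\<omega>. ennreal (exp (- T n \<omega>)) \<partial>M)"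
        by (rule nn_integral_cmult) measurable
      also have "\<dots> \<le> ennreal (exp (real K)) * ennreal (r ^ n)" by (intro mult_left_mono lt) auto
      also have "\<dots> = ennreal (exp (real K) * r ^ n)" by (simp add: ennreal_mult')
      finally show ?thesis using r by (simp add: ennreal_le_iff)
    qed
    have l2: "(\<lambda>n. exp (real K) * r ^ n) \<longlonglongrightarrow> exp (real K) * 0"
      using r by (intro tendsto_intros LIMSEQ_realpow_zero) auto
    have "measure M A \<le> exp (real K) * 0"
      by (rule LIMSEQ_le_const[OF l2]) (use l1 in blast)
    then have "A \<in> null_sets M" by (intro null_setsI) (auto simp: emeasure_eq_measure measure_le_0_iff)
    then have "AE \<omega> in M. \<omega> \<notin> A" by (rule AE_not_in)
    then show ?thesis using AE_space by eventually_elim (auto simp: A_def not_le)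
  qed
  have "AE \<omega> in M. \<forall>K::nat. \<exists>n. T n \<omega> > real K"
    unfolding AE_all_countable using null by simp
  then show ?thesis
  proof eventually_elim
    case (elim \<omega>)
    show ?case
    proof
      fix K :: real
      obtain k :: nat where "K \<le> real k" using real_arch_simple by blast
      moreover obtain n where "T n \<omega> > real k" using elim by blast
      ultimately show "\<exists>n. (\<Sum>i<n. S i \<omega>) > K" by (auto simp: T_def intro!: exI[of _ n])
    qed
  qed
qed

end

section \<open>The embedded walk of the Erlang queue\<close>

text \<open>The total weight of the walks of length \<open>a\<close> from \<open>m\<close> that reach \<open>0\<close> for the first time at their end,
  where a step \<open>-1\<close> has weight \<open>p\<close> and a step \<open>+k\<close> has weight \<open>r\<close>.\<close>

fun hit_weight :: "real \<Rightarrow> real \<Rightarrow> nat \<Rightarrow> nat \<Rightarrow> nat \<Rightarrow> real" where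
  "hit_weight p r k 0 0 = 1"
| "hit_weight p r k 0 (Suc a) = 0"
| "hit_weight p r k (Suc m) 0 = 0"
| "hit_weight p r k (Suc m) (Suc a) = p * hit_weight p r k m a + r * hit_weight p r k (Suc m + k) a"

lemma hit_weight_nonneg: "p \<ge> 0 \<Longrightarrow> r \<ge> 0 \<Longrightarrow> hit_weight p r k m a \<ge> 0"
  by (induction p r k m a rule: hit_weight.induct) auto

text \<open>With h up-steps a walk from m to 0 needs m + h * k down-steps, so only lengths m + h *
  (k + 1) occur.\<close>

lemma hit_weight_zero:
  "(\<And>h. a \<noteq> m + h * (k + 1)) \<Longrightarrow> hit_weight p r k m a = 0"
proof (induction a arbitrary: m)
  case 0
  then show ?case by (cases m) (auto dest: spec[of _ 0] meta_spec[of _ 0])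
next
  case (Suc a)
  show ?case
  proof (cases m)
    case m: (Suc m')
    have "a \<noteq> m' + h * (k + 1)" for h using Suc.prems[of h] m by auto
    moreover have "a \<noteq> (Suc m' + k) + h * (k + 1)" for h using Suc.prems[of "Suc h"] m by auto
    ultimately show ?thesis using Suc.IH[of m'] Suc.IH[of "Suc m' + k"] m by simp
  qed simp
qed

text \<open>With a = m + h * (k + 1) the numerical coefficient is (m / a) * (a choose h), the ballot
  number: the share m / a of all arrangements of the steps reaches 0 only at the end. The proof is
  by decomposition at the first step.\<close>

lemma hit_weight_ballot:
  "hit_weight p r k m (m + h * (k + 1)) =
    (if m = 0 then of_bool (h = 0)
     else real m * fact (m + h * (k + 1) - 1) / (fact h * fact (m + h * k)) * p ^ (m + h * k) * r ^ h)"
proof -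
  have "a = m + h * (k + 1) \<Longrightarrow> hit_weight p r k m a =
    (if m = 0 then of_bool (h = 0)
     else real m * fact (a - 1) / (fact h * fact (m + h * k)) * p ^ (m + h * k) * r ^ h)" for a
  proof (induction a arbitrary: m h)
    case 0
    then show ?case by auto
  next
    case (Suc a)
    show ?case
    proof (cases m)
      case 0
      then have "h \<noteq> 0" using Suc.prems by (intro notI) simp
      then show ?thesis by (simp add: 0)
    next
      case m: (Suc m')
      have a1: "a = m' + h * (k + 1)" using Suc.prems m by simp
      define B where "B = fact a * p ^ (m + h * k) * r ^ h / (fact h * fact (m + h * k))"
      have goal: "hit_weight p r k m (Suc a) = real m * B \<Longrightarrow> ?thesis"
        using m by (simp add: B_def)
      have IH1: "hit_weight p r k m' a = (if m' = 0 then of_bool (h = 0)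
         else real m' * fact (a - 1) / (fact h * fact (m' + h * k)) * p ^ (m' + h * k) * r ^ h)"
        by (rule Suc.IH[OF a1])
      show ?thesis
      proof (cases h)
        case h0: 0
        \<comment> \<open>For h = 0 the remaining length m' is smaller than the level after an
          up-step, so this branch cannot reach 0.\<close>
        have "hit_weight p r k (Suc m' + k) a = 0"
          by (rule hit_weight_zero) (use a1 h0 in auto)
        moreover have "p * hit_weight p r k m' a = real m * B"
        proof (cases m')
          case 0 then show ?thesis using IH1 h0 m a1 by (simp add: B_def)
        next
          case (Suc m'')
          then have ne: "m' \<noteq> 0" by simp
          have f1: "real m' * fact (m' - 1) = fact m'" using ne by (metis fact_reduce of_nat_fact neq0_conv of_nat_mult of_nat_id)
          have "hit_weight p r k m' a = real m' * fact (m' - 1) / fact m' * p ^ m'"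
            using IH1 ne a1 h0 by simp
          then have e: "hit_weight p r k m' a = p ^ m'" unfolding f1 by simp
          have "real m * B = (real m * fact m') / fact m * p ^ m"
            using a1 h0 by (simp add: B_def)
          also have "real m * fact m' = fact m" by (simp add: m)
          finally show ?thesis unfolding e by (simp add: m)
        qed
        ultimately show ?thesis by (intro goal) (simp add: m)
      next
        case h: (Suc h')
        have a2: "a = (Suc m' + k) + h' * (k + 1)" using a1 h by simp
        have ex: "Suc m' + k + h' * k = m + h * k" using m h by simp
        have IH2: "r * hit_weight p r k (Suc m' + k) a = real (m + k) * fact (a - 1) / (fact h' * fact (m + h * k)) * p ^ (m + h * k) * r ^ h"
          using Suc.IH[OF a2] unfolding ex by (simp add: h m)
        have apos: "a > 0" using a2 by simp
        then obtain a' where a': "a = Suc a'" by (cases a) auto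
        define C where "C = fact (a - 1) * p ^ (m + h * k) * r ^ h / (fact h * fact (m + h * k))"
        have BC: "B = real a * C" by (simp add: B_def C_def a')
        have t2: "r * hit_weight p r k (Suc m' + k) a = real (m + k) * real h * C"
        proof -
          have gen: "A * F / (g * G) * P * R = A * H * (F * P * R / ((H * g) * G))" if "H \<noteq> 0" for A F g G P R H :: real
            using that by simp
          have "fact h = real h * fact h'" by (simp add: h)
          then show ?thesis unfolding IH2 C_def by (simp only:) (rule gen, simp add: h)
        qed
        have t1: "p * hit_weight p r k m' a = real m' * real (m + h * k) * C"
        proof (cases "m' = 0")
          case True then show ?thesis using IH1 h by simp
        next
          case False
          have mh: "m + h * k = Suc (m' + h * k)" using m by simp
          have "p * hit_weight p r k m' a = real m' * fact (a - 1) * p ^ (m + h * k) * r ^ h / (fact h * fact (m' + h * k))"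
            using IH1 False unfolding mh by simp
          also have "\<dots> = real m' * real (m + h * k) * C"
          proof -
            have gen: "A * F * P * R / (g * G) = A * S * (F * P * R / (g * (S * G)))" if "S \<noteq> 0" for A F g G P R S :: real
              using that by simp
            show ?thesis unfolding C_def mh fact_Suc by (rule gen) (rule of_nat_neq_0)
          qed
          finally show ?thesis .
        qed
        \<comment> \<open>The down-step and the up-step contribute m' * (m + h * k) * C and (m + k)
          * h * C, so the ballot recursion comes down to this identity; here a is the length left
          after the first step.\<close>
        have "real m' * real (m + h * k) + real (m + k) * real h = real m * real a"
          unfolding a1 m by (simp add: algebra_simps)
        then have "p * hit_weight p r k m' a + r * hit_weight p r k (Suc m' + k) a = real m * B"
          unfolding t1 t2 BC by (metis distrib_right mult.assoc)
        then show ?thesis by (intro goal) (simp add: m)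
      qed
    qed
  qed
  then show ?thesis by blast
qed

section \<open>State space and jump probabilities of the Erlang queue\<close>

definition erlang_states :: "nat \<Rightarrow> (nat \<times> nat) set" where
  "erlang_states k = insert (0, 0) {(n, s). 1 \<le> n \<and> 1 \<le> s \<and> s \<le> k}"

definition erlang_up :: "nat \<times> nat \<Rightarrow> nat \<times> nat" where
  "erlang_up x = (fst x + 1, snd x)"

definition erlang_down :: "nat \<Rightarrow> nat \<times> nat \<Rightarrow> nat \<times> nat" where
  "erlang_down k x = (if snd x \<ge> 2 then (fst x, snd x - 1) else if fst x \<ge> 2 then (fst x - 1, k) else (0, 0))"

definition erlang_succ :: "nat \<Rightarrow> nat \<times> nat \<Rightarrow> (nat \<times> nat) set" where
  "erlang_succ k x = (if x = (0, 0) then {(1, k)} else {erlang_up x, erlang_down k x})"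

text \<open>The number of phases that have to be completed before the system is empty.\<close>

definition erlang_level :: "nat \<Rightarrow> nat \<times> nat \<Rightarrow> nat" where
  "erlang_level k x = (if fst x = 0 then 0 else (fst x - 1) * k + snd x)"

lemma erlang_level_up: "fst x \<noteq> 0 \<Longrightarrow> erlang_level k (erlang_up x) = erlang_level k x + k"
  by (cases x; cases "fst x") (auto simp: erlang_level_def erlang_up_def)

lemma erlang_level_down:
  assumes "x \<in> erlang_states k" "x \<noteq> (0, 0)"
  shows "erlang_level k x = Suc (erlang_level k (erlang_down k x))"
proof -
  obtain n s where x: "x = (Suc n, s)" "1 \<le> s" "s \<le> k"
    using assms by (cases x; cases "fst x") (auto simp: erlang_states_def)
  show ?thesis
    using x by (cases n; cases "s \<ge> 2") (auto simp: erlang_level_def erlang_down_def)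
qed

lemma erlang_up_down_neq: "x \<noteq> (0, 0) \<Longrightarrow> erlang_up x \<noteq> erlang_down k x"
  by (auto simp: erlang_up_def erlang_down_def)

lemma exit_rate_finite_support:
  assumes "finite T" "x \<notin> T" "\<And>y. y \<notin> T \<Longrightarrow> y \<noteq> x \<Longrightarrow> q x y = 0"
  shows "exit_rate q x = (\<Sum>y\<in>T. q x y)"
proof -
  have "exit_rate q x = (\<Sum>\<^sub>\<infinity>y\<in>T. q x y)"
    unfolding exit_rate_def by (rule infsum_cong_neutral) (use assms in auto)
  then show ?thesis using assms(1) by simp
qed

lemma erlang_rate_up: "x \<in> erlang_states k \<Longrightarrow> x \<noteq> (0, 0) \<Longrightarrow> erlang_rate lam mu k x (erlang_up x) = lam"
  by (cases x) (auto simp: erlang_states_def erlang_up_def)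

lemma erlang_rate_down: "x \<in> erlang_states k \<Longrightarrow> x \<noteq> (0, 0) \<Longrightarrow> erlang_rate lam mu k x (erlang_down k x) = real k * mu"
  by (cases x) (auto simp: erlang_states_def erlang_down_def)

lemma erlang_rate_other:
  "x \<in> erlang_states k \<Longrightarrow> y \<notin> erlang_succ k x \<Longrightarrow> erlang_rate lam mu k x y = 0"
  by (cases x) (auto simp: erlang_states_def erlang_succ_def erlang_down_def erlang_up_def split: if_splits)

lemma erlang_succ_not_self: "k \<ge> 1 \<Longrightarrow> x \<in> erlang_states k \<Longrightarrow> x \<notin> erlang_succ k x"
  by (cases x) (auto simp: erlang_states_def erlang_succ_def erlang_down_def erlang_up_def split: if_splits)

lemma erlang_exit_rate_empty: "k \<ge> 1 \<Longrightarrow> exit_rate (erlang_rate lam mu k) (0, 0) = lam"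
  by (subst exit_rate_finite_support[of "{(1, k)}"]) auto

lemma erlang_exit_rate:
  assumes "k \<ge> 1" "x \<in> erlang_states k" "x \<noteq> (0, 0)"
  shows "exit_rate (erlang_rate lam mu k) x = lam + real k * mu"
proof -
  have "exit_rate (erlang_rate lam mu k) x = (\<Sum>y\<in>erlang_succ k x. erlang_rate lam mu k x y)"
    using assms erlang_succ_not_self[OF assms(1,2)] erlang_rate_other[OF assms(2)]
    by (intro exit_rate_finite_support) (auto simp: erlang_succ_def)
  also have "\<dots> = lam + real k * mu"
    using assms erlang_up_down_neq[OF assms(3), of k]
    by (simp add: erlang_succ_def erlang_rate_up erlang_rate_down)
  finally show ?thesis .
qed

lemma erlang_jump_prob:
  assumes "k \<ge> 1" "x \<in> erlang_states k" "x \<noteq> (0, 0)"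
  shows "jump_prob (erlang_rate lam mu k) x (erlang_up x) = lam / (lam + real k * mu)"
    and "jump_prob (erlang_rate lam mu k) x (erlang_down k x) = real k * mu / (lam + real k * mu)"
proof -
  have "erlang_up x \<noteq> x" "erlang_down k x \<noteq> x"
    using erlang_succ_not_self[OF assms(1,2)] assms(3) by (auto simp: erlang_succ_def)
  then show "jump_prob (erlang_rate lam mu k) x (erlang_up x) = lam / (lam + real k * mu)"
    and "jump_prob (erlang_rate lam mu k) x (erlang_down k x) = real k * mu / (lam + real k * mu)"
    unfolding jump_prob_def erlang_exit_rate[OF assms] using assms
    by (simp_all add: erlang_rate_up erlang_rate_down)
qed

lemma erlang_jump_prob_empty:
  "k \<ge> 1 \<Longrightarrow> lam > 0 \<Longrightarrow> jump_prob (erlang_rate lam mu k) (0, 0) (1, k) = 1"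
  unfolding jump_prob_def by (simp add: erlang_exit_rate_empty)

section \<open>Laplace transform of the first busy cycle\<close>

locale erlang_chain = prob_space M for M :: "'w measure" +
  fixes lam mu :: real and k :: nat and Z :: "nat \<Rightarrow> 'w \<Rightarrow> nat \<times> nat" and S :: "nat \<Rightarrow> 'w \<Rightarrow> real"
  assumes lam: "lam > 0" and mu: "mu > 0" and k: "k \<ge> 1"
    and Zm: "\<And>i. Z i \<in> measurable M (count_space UNIV)"
    and Sm: "\<And>i. S i \<in> borel_measurable M"
    and jlaw: "\<And>n z s. (\<And>i. i < n \<Longrightarrow> 0 \<le> s i) \<Longrightarrow>
        measure M {\<omega> \<in> space M. (\<forall>i\<le>n. Z i \<omega> = z i) \<and> (\<forall>i<n. s i < S i \<omega>)} =
          of_bool (z 0 = (0, 0)) * (\<Prod>i<n. jump_prob (erlang_rate lam mu k) (z i) (z (Suc i)) *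
            exp (- exit_rate (erlang_rate lam mu k) (z i) * s i))"
begin

sublocale jump_hold M "erlang_rate lam mu k" "(0, 0)" Z S "erlang_states k" "erlang_succ k"
proof
  show "Z i \<in> measurable M (count_space UNIV)" "S i \<in> borel_measurable M" for i by (rule Zm, rule Sm)
  show "measure M {\<omega> \<in> space M. (\<forall>i\<le>n. Z i \<omega> = z i) \<and> (\<forall>i<n. s i < S i \<omega>)} =
          of_bool (z 0 = (0, 0)) * (\<Prod>i<n. jump_prob (erlang_rate lam mu k) (z i) (z (Suc i)) *
            exp (- exit_rate (erlang_rate lam mu k) (z i) * s i))"
    if "\<And>i. i < n \<Longrightarrow> 0 \<le> s i" for n z s by (rule jlaw[OF that])
  show "(0, 0) \<in> erlang_states k" by (simp add: erlang_states_def)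
  fix x y assume x: "x \<in> erlang_states k"
  show "erlang_succ k x \<subseteq> erlang_states k"
    using x k by (cases x) (auto simp: erlang_states_def erlang_succ_def erlang_down_def erlang_up_def)
  show "finite (erlang_succ k x)" by (simp add: erlang_succ_def)
  show "(\<Sum>y\<in>erlang_succ k x. jump_prob (erlang_rate lam mu k) x y) = 1"
  proof (cases "x = (0, 0)")
    case True
    then show ?thesis using erlang_jump_prob_empty[OF k lam] by (simp add: erlang_succ_def)
  next
    case False
    have "lam + real k * mu > 0" using lam mu by (intro add_pos_nonneg) auto
    then show ?thesis using False erlang_up_down_neq[OF False, of k] erlang_jump_prob[OF k x False]
      by (simp add: erlang_succ_def add_divide_distrib [symmetric])
  qed
  show "exit_rate (erlang_rate lam mu k) x > 0"
    using erlang_exit_rate_empty[OF k] erlang_exit_rate[OF k x] lam mu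
    by (cases "x = (0, 0)") (auto intro!: add_pos_nonneg)
next
  fix x y
  have r0: "erlang_rate lam mu k x y \<ge> 0" for y using lam mu by (cases x) auto
  then have "exit_rate (erlang_rate lam mu k) x \<ge> 0" unfolding exit_rate_def by (intro infsum_nonneg) auto
  then show "0 \<le> jump_prob (erlang_rate lam mu k) x y" using r0 by (simp add: jump_prob_def)
qed

definition returns :: "nat \<Rightarrow> nat \<Rightarrow> 'w \<Rightarrow> bool" where
  "returns n a \<omega> \<longleftrightarrow> Z (n + a) \<omega> = (0, 0) \<and> (\<forall>i\<in>{n..<n + a}. Z i \<omega> \<noteq> (0, 0))"

lemma returns_measurable [measurable]: "Measurable.pred M (returns n a)"
  unfolding returns_def by measurable

text \<open>Index 0 has weight 0 because the idle time before the first arrival is not part of the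
  busy period. In every nonempty state the exit rate is lam + k * mu, so a jump contributes k * mu
  or lam over lam + k * mu + \<psi>. Conditioning on the next state then reproduces the recursion of
  \<open>hit_weight\<close>, with the number of outstanding phases as position.\<close>

lemma return_transform_path:
  assumes \<psi>: "\<psi> > 0"
  shows "valid n z \<Longrightarrow> n \<ge> 1 \<Longrightarrow>
   (\<integral>\<^sup>+\<omega>. indicator (path n z) \<omega> * ((\<Prod>i<n + a. ennreal (exp (- (if i = 0 then 0 else \<psi>) * S i \<omega>))) * indicator {\<omega>. returns n a \<omega>} \<omega>) \<partial>M) =
   ennreal (prefix n z (\<lambda>i. if i = 0 then 0 else \<psi>) *
      hit_weight (real k * mu / (lam + real k * mu + \<psi>)) (lam / (lam + real k * mu + \<psi>)) k (erlang_level k (z n)) a)"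
proof (induction a arbitrary: n z)
  case 0
  let ?P = "\<lambda>\<omega>. (\<Prod>i<n. ennreal (exp (- (if i = 0 then 0 else \<psi>) * S i \<omega>)))"
  have r: "returns n 0 \<omega> \<longleftrightarrow> z n = (0, 0)" if "\<omega> \<in> path n z" for \<omega>
    using that by (auto simp: returns_def path_def)
  show ?case
  proof (cases "z n = (0, 0)")
    case True
    have "(\<integral>\<^sup>+\<omega>. indicator (path n z) \<omega> * (?P \<omega> * indicator {\<omega>. returns n 0 \<omega>} \<omega>) \<partial>M) = (\<integral>\<^sup>+\<omega>. indicator (path n z) \<omega> * ?P \<omega> \<partial>M)"
      by (intro nn_integral_cong) (use r True in \<open>auto simp: indicator_def\<close>)
    then show ?thesis
      using path_transform[OF 0(1), of "\<lambda>i. if i = 0 then 0 else \<psi>"] \<psi> True by (simp add: erlang_level_def)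
  next
    case False
    have "(\<integral>\<^sup>+\<omega>. indicator (path n z) \<omega> * (?P \<omega> * indicator {\<omega>. returns n 0 \<omega>} \<omega>) \<partial>M) = (\<integral>\<^sup>+\<omega>. 0 \<partial>M)"
      by (intro nn_integral_cong) (use r False in \<open>auto simp: indicator_def\<close>)
    moreover have "erlang_level k (z n) = Suc (erlang_level k (erlang_down k (z n)))"
      using valid_V[OF 0(1), of n] False by (intro erlang_level_down) auto
    ultimately show ?thesis by simp
  qed
next
  case (Suc a)
  let ?\<psi> = "\<lambda>i::nat. if i = 0 then 0 else \<psi>"
  let ?p = "real k * mu / (lam + real k * mu + \<psi>)" and ?r = "lam / (lam + real k * mu + \<psi>)"
  have zn: "z n \<in> erlang_states k" using valid_V[OF Suc.prems(1), of n] by simp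
  show ?case
  proof (cases "z n = (0, 0)")
    case True
    have "(\<integral>\<^sup>+\<omega>. indicator (path n z) \<omega> * ((\<Prod>i<n + Suc a. ennreal (exp (- ?\<psi> i * S i \<omega>))) * indicator {\<omega>. returns n (Suc a) \<omega>} \<omega>) \<partial>M) = (\<integral>\<^sup>+\<omega>. 0 \<partial>M)"
      by (intro nn_integral_cong) (use True in \<open>auto simp: indicator_def returns_def path_def\<close>)
    then show ?thesis using True by (simp add: erlang_level_def)
  next
    case False
    define G where "G \<omega> = (\<Prod>i<n + Suc a. ennreal (exp (- ?\<psi> i * S i \<omega>))) * indicator {\<omega>. returns n (Suc a) \<omega>} \<omega>" for \<omega>
    have [measurable]: "(\<lambda>\<omega>. indicator {\<omega>. returns n (Suc a) \<omega>} \<omega> :: ennreal) \<in> borel_measurable M"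
      by (rule borel_measurable_indicator') measurable
    have Gm: "G \<in> borel_measurable M" unfolding G_def by measurable
    have th: "lam + real k * mu > 0" using lam mu by (intro add_pos_nonneg) auto
    let ?u = "erlang_up (z n)" and ?d = "erlang_down k (z n)"
    have ud: "?u \<noteq> ?d" using erlang_up_down_neq[OF False] .
    have "(\<integral>\<^sup>+\<omega>. indicator (path n z) \<omega> * G \<omega> \<partial>M) =
      (\<Sum>y\<in>erlang_succ k (z n). \<integral>\<^sup>+\<omega>. indicator (path (Suc n) (z(Suc n := y))) \<omega> * G \<omega> \<partial>M)"
      by (rule nn_integral_path_split[OF Suc.prems(1) Gm])
    also have "\<dots> = (\<Sum>y\<in>erlang_succ k (z n). ennreal (prefix (Suc n) (z(Suc n := y)) ?\<psi> * hit_weight ?p ?r k (erlang_level k y) a))"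
    proof (rule sum.cong[OF refl])
      fix y assume y: "y \<in> erlang_succ k (z n)"
      have "(\<integral>\<^sup>+\<omega>. indicator (path (Suc n) (z(Suc n := y))) \<omega> * G \<omega> \<partial>M) =
        (\<integral>\<^sup>+\<omega>. indicator (path (Suc n) (z(Suc n := y))) \<omega> * ((\<Prod>i<Suc n + a. ennreal (exp (- ?\<psi> i * S i \<omega>))) * indicator {\<omega>. returns (Suc n) a \<omega>} \<omega>) \<partial>M)"
      proof (rule nn_integral_cong)
        fix \<omega>
        show "indicator (path (Suc n) (z(Suc n := y))) \<omega> * G \<omega> = indicator (path (Suc n) (z(Suc n := y))) \<omega> * ((\<Prod>i<Suc n + a. ennreal (exp (- ?\<psi> i * S i \<omega>))) * indicator {\<omega>. returns (Suc n) a \<omega>} \<omega>)"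
        proof (cases "\<omega> \<in> path (Suc n) (z(Suc n := y))")
          case True
          then have "Z n \<omega> = z n" by (auto simp: path_def dest!: spec[of _ n])
          moreover have "{n..<n + Suc a} = insert n {Suc n..<Suc n + a}" by auto
          ultimately have "returns n (Suc a) \<omega> \<longleftrightarrow> returns (Suc n) a \<omega>" using False by (auto simp: returns_def)
          then show ?thesis by (simp add: G_def indicator_def)
        qed simp
      qed
      also have "\<dots> = ennreal (prefix (Suc n) (z(Suc n := y)) ?\<psi> * hit_weight ?p ?r k (erlang_level k ((z(Suc n := y)) (Suc n))) a)"
        by (rule Suc.IH[OF valid_extend[OF Suc.prems(1) y] le_SucI[OF Suc.prems(2)]])
      also have "(z(Suc n := y)) (Suc n) = y" by simp
      finally show "(\<integral>\<^sup>+\<omega>. indicator (path (Suc n) (z(Suc n := y))) \<omega> * G \<omega> \<partial>M) =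
        ennreal (prefix (Suc n) (z(Suc n := y)) ?\<psi> * hit_weight ?p ?r k (erlang_level k y) a)" .
    qed
    also have "\<dots> = ennreal (\<Sum>y\<in>erlang_succ k (z n). prefix (Suc n) (z(Suc n := y)) ?\<psi> * hit_weight ?p ?r k (erlang_level k y) a)"
    proof (rule sum_ennreal)
      fix y assume "y \<in> erlang_succ k (z n)"
      then have "valid (Suc n) (z(Suc n := y))" by (rule valid_extend[OF Suc.prems(1)])
      then show "0 \<le> prefix (Suc n) (z(Suc n := y)) ?\<psi> * hit_weight ?p ?r k (erlang_level k y) a"
        using \<psi> lam mu th by (intro mult_nonneg_nonneg prefix_nonneg hit_weight_nonneg) auto
    qed
    also have "(\<Sum>y\<in>erlang_succ k (z n). prefix (Suc n) (z(Suc n := y)) ?\<psi> * hit_weight ?p ?r k (erlang_level k y) a) =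
       prefix n z ?\<psi> * hit_weight ?p ?r k (erlang_level k (z n)) (Suc a)"
    proof -
      have f: "prefix (Suc n) (z(Suc n := ?u)) ?\<psi> = prefix n z ?\<psi> * ?r"
         "prefix (Suc n) (z(Suc n := ?d)) ?\<psi> = prefix n z ?\<psi> * ?p"
        unfolding prefix_extend erlang_jump_prob[OF k zn False] erlang_exit_rate[OF k zn False]
        using th Suc.prems(2) by auto
      have lu: "erlang_level k ?u = erlang_level k (z n) + k"
        using zn False by (intro erlang_level_up) (auto simp: erlang_states_def)
      have ld: "erlang_level k (z n) = Suc (erlang_level k ?d)" by (rule erlang_level_down[OF zn False])
      have s: "erlang_succ k (z n) = {?u, ?d}" using False by (simp add: erlang_succ_def)
      show ?thesis unfolding s using ud f lu ld by (simp add: algebra_simps)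
    qed
    finally show ?thesis unfolding G_def .
  qed
qed

theorem return_transform:
  assumes \<psi>: "\<psi> > 0"
  shows "(\<integral>\<^sup>+\<omega>. ennreal (exp (- \<psi> * (\<Sum>i\<in>{1..<1 + a}. S i \<omega>))) * indicator {\<omega>. returns 1 a \<omega>} \<omega> \<partial>M) =
     ennreal (hit_weight (real k * mu / (lam + real k * mu + \<psi>)) (lam / (lam + real k * mu + \<psi>)) k k a)"
proof -
  define z :: "nat \<Rightarrow> nat \<times> nat" where "z i = (if i = 0 then (0, 0) else (1, k))" for i
  have v: "valid 1 z" by (simp add: valid_def z_def erlang_succ_def)
  have pre: "prefix 1 z (\<lambda>i. if i = 0 then 0 else \<psi>) = 1"
    using erlang_jump_prob_empty[OF k lam] erlang_exit_rate_empty[OF k] lam by (simp add: prefix_def z_def)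
  have lev: "erlang_level k (z 1) = k" by (simp add: z_def erlang_level_def)
  have "(\<integral>\<^sup>+\<omega>. ennreal (exp (- \<psi> * (\<Sum>i\<in>{1..<1 + a}. S i \<omega>))) * indicator {\<omega>. returns 1 a \<omega>} \<omega> \<partial>M) =
     (\<integral>\<^sup>+\<omega>. indicator (path 1 z) \<omega> * ((\<Prod>i<1 + a. ennreal (exp (- (if i = 0 then 0 else \<psi>) * S i \<omega>))) * indicator {\<omega>. returns 1 a \<omega>} \<omega>) \<partial>M)"
  proof (rule nn_integral_cong_AE, use AE_valid AE_space in eventually_elim)
    fix \<omega> assume v: "Z 0 \<omega> = (0, 0) \<and> (\<forall>i. S i \<omega> > 0 \<and> Z (Suc i) \<omega> \<in> erlang_succ k (Z i \<omega>))" and sp: "\<omega> \<in> space M"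
    have "Z 0 \<omega> = (0, 0)" "Z 1 \<omega> = (1, k)" using v by (auto simp: erlang_succ_def dest!: spec[of _ 0])
    then have p: "\<omega> \<in> path 1 z" using sp by (auto simp: path_def z_def le_Suc_eq)
    have "{..<1 + a} = insert 0 {1..<1 + a}" by auto
    then have "(\<Prod>i<1 + a. ennreal (exp (- (if i = 0 then 0 else \<psi>) * S i \<omega>))) = (\<Prod>i\<in>{1..<1 + a}. ennreal (exp (- (if i = 0 then 0 else \<psi>) * S i \<omega>)))"
      by simp
    also have "\<dots> = (\<Prod>i\<in>{1..<1 + a}. ennreal (exp (- \<psi> * S i \<omega>)))" by (intro prod.cong) auto
    also have "\<dots> = ennreal (exp (- \<psi> * (\<Sum>i\<in>{1..<1 + a}. S i \<omega>)))"
      unfolding sum_distrib_left by (subst prod_ennreal) (simp_all only: exp_sum finite_atLeastLessThan exp_ge_zero)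
    finally show "ennreal (exp (- \<psi> * (\<Sum>i\<in>{1..<1 + a}. S i \<omega>))) * indicator {\<omega>. returns 1 a \<omega>} \<omega> =
      indicator (path 1 z) \<omega> * ((\<Prod>i<1 + a. ennreal (exp (- (if i = 0 then 0 else \<psi>) * S i \<omega>))) * indicator {\<omega>. returns 1 a \<omega>} \<omega>)"
      using p by simp
  qed
  also have "\<dots> = ennreal (hit_weight (real k * mu / (lam + real k * mu + \<psi>)) (lam / (lam + real k * mu + \<psi>)) k k a)"
    using return_transform_path[OF \<psi> v, of a] unfolding pre lev by simp
  finally show ?thesis .
qed

end

section \<open>Sample paths\<close>

definition left_lim :: "(real \<Rightarrow> real) \<Rightarrow> real \<Rightarrow> real" where
  "left_lim d s = Sup (d ` {0..<s})"

locale subordinator_path =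
  fixes d :: "real \<Rightarrow> real"
  assumes d0: "d 0 = 0" and strict: "\<And>a b. 0 \<le> a \<Longrightarrow> a < b \<Longrightarrow> d a < d b"
    and unbounded: "\<And>K. \<exists>s\<ge>0. d s > K"
    and right_cont: "\<And>t. t \<ge> 0 \<Longrightarrow> continuous (at_right t) d"
begin

lemma mono: "0 \<le> a \<Longrightarrow> a \<le> b \<Longrightarrow> d a \<le> d b"
  using strict[of a b] by (cases "a = b") auto

definition y :: "real \<Rightarrow> real" where
  "y t = (if t = 0 then 0 else Inf {s. 0 \<le> s \<and> t < d s})"

lemma left_lim_upper: "0 \<le> u \<Longrightarrow> u < s \<Longrightarrow> d u \<le> left_lim d s"
  unfolding left_lim_def by (intro cSUP_upper bdd_aboveI2[of _ _ "d s"]) (auto intro: mono)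

lemma left_lim_le_iff: "s > 0 \<Longrightarrow> left_lim d s \<le> t \<longleftrightarrow> (\<forall>u. 0 \<le> u \<longrightarrow> u < s \<longrightarrow> d u \<le> t)"
  unfolding left_lim_def by (subst cSUP_le_iff) (auto intro!: bdd_aboveI2[of _ _ "d s"] mono)

lemma left_lim_pos: "s > 0 \<Longrightarrow> left_lim d s > 0"
  using strict[of 0 "s/2"] left_lim_upper[of "s/2" s] by (simp add: d0)

lemma left_lim_strict: "0 < s \<Longrightarrow> s < r \<Longrightarrow> left_lim d s < left_lim d r"
proof -
  assume s: "0 < s" "s < r"
  have "left_lim d s \<le> d s" using s by (subst left_lim_le_iff) (auto intro: mono)
  also have "d s < d ((s + r) / 2)" using s by (intro strict) auto
  also have "\<dots> \<le> left_lim d r" using s by (intro left_lim_upper) auto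
  finally show ?thesis .
qed

lemma le_y_iff: assumes "t > 0" shows "s \<le> y t \<longleftrightarrow> (\<forall>u. 0 \<le> u \<longrightarrow> u < s \<longrightarrow> d u \<le> t)"
proof -
  have ne: "{s. 0 \<le> s \<and> t < d s} \<noteq> {}" using unbounded[of t] by auto
  have bb: "bdd_below {s. 0 \<le> s \<and> t < d s}" by (rule bdd_belowI[of _ 0]) auto
  have "s \<le> y t \<longleftrightarrow> (\<forall>u\<in>{s. 0 \<le> s \<and> t < d s}. s \<le> u)"
    using assms le_cInf_iff[OF ne bb] by (simp add: y_def)
  then show ?thesis by (auto simp: not_le)
qed

text \<open>The inverse reaches level s at the left limit of d at s: both sides say that d is at
  most t below level s. At t = 0 both fail, since y 0 = 0 and the left limit is positive. The
  evaluation of the time-changed busy period rests on this equivalence.\<close>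

lemma le_y_iff_left_lim: "t \<ge> 0 \<Longrightarrow> s > 0 \<Longrightarrow> s \<le> y t \<longleftrightarrow> left_lim d s \<le> t"
  using le_y_iff[of t s] left_lim_le_iff[of s t] left_lim_pos[of s] by (cases "t = 0") (auto simp: y_def)

lemma y_nonneg: "t \<ge> 0 \<Longrightarrow> y t \<ge> 0"
proof (cases "t = 0")
  case False
  assume "t \<ge> 0"
  then show ?thesis using le_y_iff[of t 0] False by auto
qed (simp add: y_def)

text \<open>Levels slightly above q have values of d close to d q by right continuity, and a
  rational r above such a value has y r > q. Restricting to rational r makes the infimum countable,
  hence measurable in the inverse process.\<close>

lemma inverse_recovers:
  assumes q: "q \<ge> 0"
  shows "(INF r\<in>{r::rat. r > 0}. if y (of_rat r) > q then ereal (of_rat r) else \<infinity>) = ereal (d q)"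
proof (rule antisym)
  show "ereal (d q) \<le> (INF r\<in>{r::rat. r > 0}. if y (of_rat r) > q then ereal (of_rat r) else \<infinity>)"
  proof (rule INF_greatest)
    fix r :: rat assume "r \<in> {r. r > 0}"
    then have r: "(of_rat r :: real) > 0" by simp
    show "ereal (d q) \<le> (if y (of_rat r) > q then ereal (of_rat r) else \<infinity>)"
    proof (cases "y (of_rat r) > q")
      case True
      then have "d q \<le> of_rat r" using le_y_iff[OF r, of "y (of_rat r)"] q by auto
      then show ?thesis using True by simp
    qed simp
  qed
  show "(INF r\<in>{r::rat. r > 0}. if y (of_rat r) > q then ereal (of_rat r) else \<infinity>) \<le> ereal (d q)"
  proof (rule ereal_le_epsilon2)
    fix e :: real assume e: "e > 0"
    have "eventually (\<lambda>s. d s < d q + e) (at_right q)"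
      using right_cont[OF q] e by (intro order_tendstoD(2)[of d "d q"]) (auto simp: continuous_within)
    then obtain b where b: "b > q" "\<And>s. q < s \<Longrightarrow> s < b \<Longrightarrow> d s < d q + e"
      by (auto simp: eventually_at_right_field)
    define s where "s = (q + b) / 2"
    have s: "q < s" "d s < d q + e" using b by (auto simp: s_def field_simps intro!: b(2))
    obtain r :: rat where r: "d s < of_rat r" "of_rat r < d q + e" using of_rat_dense[OF s(2)] by blast
    have "0 < d s" using strict[of 0 s] s q by (simp add: d0)
    then have r0: "(of_rat r :: real) > 0" using r(1) by (rule less_trans)
    have "s \<le> y (of_rat r)" unfolding le_y_iff[OF r0] using r(1) mono[of _ s] by (meson less_imp_le order_trans)
    then have yr: "y (of_rat r) > q" using s by simp
    have "(INF r\<in>{r::rat. r > 0}. if y (of_rat r) > q then ereal (of_rat r) else \<infinity>) \<le> (if y (of_rat r) > q then ereal (of_rat r) else \<infinity>)"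
      using r0 by (intro INF_lower) auto
    also have "\<dots> \<le> ereal (d q) + ereal e" using yr r by simp
    finally show "(INF r\<in>{r::rat. r > 0}. if y (of_rat r) > q then ereal (of_rat r) else \<infinity>) \<le> ereal (d q) + ereal e" .
  qed
qed

lemma left_lim_tendsto:
  assumes s: "s > 0" and X: "\<And>n. 0 \<le> X n" "\<And>n. X n < s" "X \<longlonglongrightarrow> s"
  shows "(\<lambda>n. d (X n)) \<longlonglongrightarrow> left_lim d s"
proof (rule order_tendstoI)
  fix a assume "a < left_lim d s"
  then obtain u where u: "0 \<le> u" "u < s" "a < d u" using left_lim_le_iff[OF s, of a] by (auto simp: not_le)
  have "eventually (\<lambda>n. u < X n) sequentially" using X(3) u by (intro order_tendstoD) auto
  then show "eventually (\<lambda>n. a < d (X n)) sequentially"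
    by eventually_elim (use u strict in \<open>auto intro: less_trans\<close>)
next
  fix a assume "left_lim d s < a"
  then have "d (X n) < a" for n using left_lim_upper[OF X(1)[of n] X(2)[of n]] by simp
  then show "eventually (\<lambda>n. d (X n) < a) sequentially" by simp
qed

text \<open>The inverse lies below \<sigma> before the left limit at \<sigma>, and in [\<sigma>,
  \<rho>) at that very time because left limits increase strictly. So the infimum is attained and no
  part of the busy interval is jumped over.\<close>

lemma busy_start_time_change:
  assumes \<sigma>: "0 < \<sigma>" "\<sigma> < \<rho>"
    and x0: "\<And>u. 0 \<le> u \<Longrightarrow> u < \<sigma> \<Longrightarrow> fst (x u) = 0"
    and x1: "\<And>u. \<sigma> \<le> u \<Longrightarrow> u < \<rho> \<Longrightarrow> fst (x u) \<noteq> 0"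
  shows "busy_start (\<lambda>t. x (y t)) = ereal (left_lim d \<sigma>)"
  unfolding busy_start_def
proof (rule antisym)
  let ?L = "left_lim d"
  have l: "?L \<sigma> > 0" "?L \<sigma> < ?L \<rho>" using left_lim_pos left_lim_strict \<sigma> by auto
  then have "\<sigma> \<le> y (?L \<sigma>)" "y (?L \<sigma>) < \<rho>"
    using le_y_iff_left_lim[of "?L \<sigma>" \<sigma>] le_y_iff_left_lim[of "?L \<sigma>" \<rho>] \<sigma> by auto
  then show "(INF t\<in>{t. 0 \<le> t \<and> fst (x (y t)) \<noteq> 0}. ereal t) \<le> ereal (?L \<sigma>)"
    using x1 l by (intro INF_lower) auto
  show "ereal (?L \<sigma>) \<le> (INF t\<in>{t. 0 \<le> t \<and> fst (x (y t)) \<noteq> 0}. ereal t)"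
  proof (rule INF_greatest, clarsimp)
    fix t assume t: "0 \<le> t" "0 < fst (x (y t))"
    then have "\<sigma> \<le> y t" using x0[of "y t"] y_nonneg[of t] by force
    then show "?L \<sigma> \<le> t" using le_y_iff_left_lim[OF t(1) \<sigma>(1)] by simp
  qed
qed

text \<open>The bound \<rho>' marks a nonempty idle interval after \<rho>. At the left limit of d at
  \<rho> the inverse lies in [\<rho>, \<rho>'), so the system is seen empty at that time.\<close>

lemma busy_period_time_change:
  assumes \<sigma>: "0 < \<sigma>" "\<sigma> < \<rho>" "\<rho> < \<rho>'"
    and x0: "\<And>u. 0 \<le> u \<Longrightarrow> u < \<sigma> \<Longrightarrow> fst (x u) = 0"
    and x1: "\<And>u. \<sigma> \<le> u \<Longrightarrow> u < \<rho> \<Longrightarrow> fst (x u) \<noteq> 0"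
    and x2: "\<And>u. \<rho> \<le> u \<Longrightarrow> u < \<rho>' \<Longrightarrow> fst (x u) = 0"
  shows "busy_period (\<lambda>t. x (y t)) = ereal (left_lim d \<rho> - left_lim d \<sigma>)"
proof -
  let ?L = "left_lim d"
  have st: "busy_start (\<lambda>t. x (y t)) = ereal (?L \<sigma>)" by (rule busy_start_time_change) (use assms in auto)
  have l: "?L \<sigma> > 0" "?L \<sigma> < ?L \<rho>" "?L \<rho> < ?L \<rho>'" using left_lim_pos left_lim_strict \<sigma> by auto
  have "busy_end (\<lambda>t. x (y t)) = ereal (?L \<rho>)"
    unfolding busy_end_def st
  proof (rule antisym)
    have "\<rho> \<le> y (?L \<rho>)" "y (?L \<rho>) < \<rho>'"
      using le_y_iff_left_lim[of "?L \<rho>" \<rho>] le_y_iff_left_lim[of "?L \<rho>" \<rho>'] \<sigma> l by auto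
    then show "(INF t\<in>{t. ereal (?L \<sigma>) < ereal t \<and> fst (x (y t)) = 0}. ereal t) \<le> ereal (?L \<rho>)"
      using x2 l by (intro INF_lower) auto
    show "ereal (?L \<rho>) \<le> (INF t\<in>{t. ereal (?L \<sigma>) < ereal t \<and> fst (x (y t)) = 0}. ereal t)"
    proof (rule INF_greatest, clarsimp)
      fix t assume t: "?L \<sigma> < t" "fst (x (y t)) = 0"
      have "\<sigma> \<le> y t" using le_y_iff_left_lim[of t \<sigma>] t l \<sigma> by simp
      then have "\<rho> \<le> y t" using x1[of "y t"] t by force
      then show "?L \<rho> \<le> t" using le_y_iff_left_lim[of t \<rho>] t l \<sigma> by simp
    qed
  qed
  then show ?thesis unfolding busy_period_def st by simp
qed

lemma busy_period_time_change_infinite: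
  assumes \<sigma>: "0 < \<sigma>"
    and x0: "\<And>u. 0 \<le> u \<Longrightarrow> u < \<sigma> \<Longrightarrow> fst (x u) = 0"
    and x1: "\<And>u. \<sigma> \<le> u \<Longrightarrow> fst (x u) \<noteq> 0"
  shows "busy_period (\<lambda>t. x (y t)) = \<infinity>"
proof -
  have st: "busy_start (\<lambda>t. x (y t)) = ereal (left_lim d \<sigma>)"
    by (rule busy_start_time_change[of _ "\<sigma> + 1"]) (use assms in auto)
  have "{t. ereal (left_lim d \<sigma>) < ereal t \<and> fst (x (y t)) = 0} = {}"
  proof (clarsimp)
    fix t assume t: "left_lim d \<sigma> < t"
    have "\<sigma> \<le> y t" using le_y_iff_left_lim[of t \<sigma>] t left_lim_pos[OF \<sigma>] \<sigma> by simp
    then show "0 < fst (x (y t))" using x1 by blast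
  qed
  note E = this
  have "busy_end (\<lambda>t. x (y t)) = \<infinity>" unfolding busy_end_def st E by (simp add: top_ereal_def)
  then show ?thesis unfolding busy_period_def st by simp
qed

end

section \<open>The first cycle of a queue path, seen at rational times\<close>

definition busy_start_q :: "(real \<Rightarrow> nat \<times> nat) \<Rightarrow> ereal" where
  "busy_start_q x = (INF r\<in>{r::rat. 0 \<le> r}. if fst (x (of_rat r)) \<noteq> 0 then ereal (of_rat r) else \<infinity>)"

text \<open>Countable infima over path values, hence measurable for the algebra of the queue. The
  default \<infinity> keeps the index set independent of the path.\<close>

definition busy_end_q :: "(real \<Rightarrow> nat \<times> nat) \<Rightarrow> ereal" where
  "busy_end_q x = (INF r\<in>{r::rat. 0 \<le> r}.
     if busy_start_q x < ereal (of_rat r) \<and> fst (x (of_rat r)) = 0 then ereal (of_rat r) else \<infinity>)"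

text \<open>The number of jumps in a busy cycle has to be a function of the path of \<open>Q\<close> in order to be independent
  of the time change; it is recovered from the values at rational times.\<close>

definition alternates :: "(real \<Rightarrow> nat \<times> nat) \<Rightarrow> nat \<Rightarrow> bool" where
  "alternates x m \<longleftrightarrow> (\<exists>rs::rat list. length rs = Suc m \<and>
     (\<forall>i\<le>m. 0 \<le> rs ! i \<and> ereal (of_rat (rs ! i)) < busy_end_q x) \<and>
     (\<forall>i<m. rs ! i < rs ! Suc i \<and> x (of_rat (rs ! i)) \<noteq> x (of_rat (rs ! Suc i))))"

lemma rat_INF_eq:
  fixes a b :: real
  assumes a: "0 \<le> a" "a < b"
    and low: "\<And>r::rat. 0 \<le> r \<Longrightarrow> P (of_rat r) \<Longrightarrow> a \<le> of_rat r"
    and P: "\<And>r. a < r \<Longrightarrow> r < b \<Longrightarrow> P r"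
  shows "(INF r\<in>{r::rat. 0 \<le> r}. if P (of_rat r) then ereal (of_rat r) else \<infinity>) = ereal a"
proof (rule antisym)
  show "ereal a \<le> (INF r\<in>{r::rat. 0 \<le> r}. if P (of_rat r) then ereal (of_rat r) else \<infinity>)"
    by (rule INF_greatest) (use low in auto)
  show "(INF r\<in>{r::rat. 0 \<le> r}. if P (of_rat r) then ereal (of_rat r) else \<infinity>) \<le> ereal a"
  proof (rule ereal_le_epsilon2)
    fix e :: real assume e: "e > 0"
    have "a < min b (a + e)" using a e by simp
    from of_rat_dense[OF this] obtain r :: rat where r: "a < of_rat r" "of_rat r < min b (a + e)" by blast
    have "(INF r\<in>{r::rat. 0 \<le> r}. if P (of_rat r) then ereal (of_rat r) else \<infinity>) \<le> (if P (of_rat r) then ereal (of_rat r) else \<infinity>)"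
    proof (rule INF_lower)
      have "0 \<le> (of_rat r :: real)" using r(1) a by linarith
      then show "r \<in> {r. 0 \<le> r}" by simp
    qed
    also have "\<dots> \<le> ereal a + ereal e" using r P[of "of_rat r"] by simp
    finally show "(INF r\<in>{r::rat. 0 \<le> r}. if P (of_rat r) then ereal (of_rat r) else \<infinity>) \<le> ereal a + ereal e" .
  qed
qed

locale queue_path =
  fixes x :: "real \<Rightarrow> nat \<times> nat" and z :: "nat \<Rightarrow> nat \<times> nat" and s :: "nat \<Rightarrow> real"
  assumes s_pos: "\<And>i. s i > 0" and diverges: "\<And>K. \<exists>n. (\<Sum>i<n. s i) > K"
    and x_eq: "\<And>n t. (\<Sum>i<n. s i) \<le> t \<Longrightarrow> t < (\<Sum>i<Suc n. s i) \<Longrightarrow> x t = z n"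
    and z0: "z 0 = (0, 0)" and z1: "z 1 \<noteq> (0, 0)"
    and z_jump: "\<And>i. z (Suc i) \<noteq> z i" and z_fst: "\<And>i. fst (z i) = 0 \<longleftrightarrow> z i = (0, 0)"
begin

definition p :: "nat \<Rightarrow> real" where "p n = (\<Sum>i<n. s i)"

lemma p_less: "m < n \<Longrightarrow> p m < p n"
  by (rule strict_monoD[of p]) (auto simp: strict_mono_Suc_iff p_def s_pos)

lemma p_less_iff: "p m < p n \<longleftrightarrow> m < n"
  using p_less[of m n] p_less[of n m] by (cases m n rule: linorder_cases) auto

lemma p_0: "p 0 = 0" by (simp add: p_def)

lemma index_exists: "t \<ge> 0 \<Longrightarrow> \<exists>n. p n \<le> t \<and> t < p (Suc n)"
proof -
  assume t: "t \<ge> 0"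
  obtain N where "p N > t" using diverges[of t] by (auto simp: p_def)
  then have ex: "\<exists>n. t < p n" by blast
  define n where "n = (LEAST n. t < p n)"
  have n: "t < p n" unfolding n_def by (rule LeastI_ex[OF ex])
  have "n \<noteq> 0" using n t p_0 by (intro notI) simp
  then obtain m where m: "n = Suc m" by (cases n) auto
  have "\<not> t < p m" using not_less_Least[of m "\<lambda>n. t < p n"] m by (auto simp: n_def)
  then show ?thesis using n m by (intro exI[of _ m]) auto
qed

lemma x_val: "p n \<le> t \<Longrightarrow> t < p (Suc n) \<Longrightarrow> x t = z n"
  unfolding p_def by (rule x_eq)

lemma index_between:
  assumes "p m \<le> t" "t < p n"
  shows "\<exists>i. m \<le> i \<and> i < n \<and> p i \<le> t \<and> t < p (Suc i) \<and> x t = z i"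
proof -
  have "0 \<le> p m" unfolding p_def by (intro sum_nonneg) (simp add: s_pos less_imp_le)
  then obtain i where i: "p i \<le> t" "t < p (Suc i)" using index_exists[of t] assms by auto
  have "p i < p n" "p m < p (Suc i)" using i assms by auto
  then show ?thesis using i x_val[OF i] by (intro exI[of _ i]) (auto simp: p_less_iff)
qed

lemma fst_before: "0 \<le> u \<Longrightarrow> u < p 1 \<Longrightarrow> fst (x u) = 0"
  using x_val[of 0 u] z0 p_0 by simp

lemma fst_busy:
  assumes "\<forall>i\<in>{1..<1 + a}. z i \<noteq> (0, 0)" "p 1 \<le> u" "u < p (1 + a)"
  shows "fst (x u) \<noteq> 0"
proof -
  obtain i where "1 \<le> i" "i < 1 + a" "x u = z i" using index_between[OF assms(2,3)] by blast
  then show ?thesis using assms(1) z_fst[of i] by simp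
qed

lemma fst_after:
  assumes "z (1 + a) = (0, 0)" "p (1 + a) \<le> u" "u < p (Suc (1 + a))"
  shows "fst (x u) = 0"
  using x_val[OF assms(2,3)] assms(1) by simp

lemma fst_never:
  assumes "\<forall>i\<ge>1. z i \<noteq> (0, 0)" "p 1 \<le> u"
  shows "fst (x u) \<noteq> 0"
proof -
  obtain n where "u < p n" using diverges[of u] by (auto simp: p_def)
  from index_between[OF assms(2) this] obtain i where "1 \<le> i" "x u = z i" by blast
  then show ?thesis using assms(1) z_fst[of i] by simp
qed

lemma p_pos: "n > 0 \<Longrightarrow> p n > 0" using p_less[of 0 n] p_0 by simp

lemma busy_start_q_eq: "busy_start_q x = ereal (p 1)"
  unfolding busy_start_q_def
proof (rule rat_INF_eq[of _ "p 2"])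
  show "p 1 < p 2" by (rule p_less) simp
  show "0 \<le> p 1" using p_pos[of 1] by simp
  show "p 1 \<le> of_rat r" if "0 \<le> r" "fst (x (of_rat r)) \<noteq> 0" for r
    using fst_before[of "of_rat r"] that by (meson not_less zero_le_of_rat_iff)
  show "fst (x r) \<noteq> 0" if "p 1 < r" "r < p 2" for r
    using fst_busy[of 1 r] z1 that by (auto simp: numeral_2_eq_2)
qed

lemma busy_end_q_eq:
  assumes ret: "z (1 + a) = (0, 0)" "\<forall>i\<in>{1..<1 + a}. z i \<noteq> (0, 0)"
  shows "busy_end_q x = ereal (p (1 + a))"
  unfolding busy_end_q_def busy_start_q_eq
proof (rule rat_INF_eq[of _ "p (Suc (1 + a))"])
  have a: "a > 0" using ret(1) z1 by (cases a) auto
  show "p (1 + a) < p (Suc (1 + a))" by (rule p_less) simp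
  show "0 \<le> p (1 + a)" using p_pos[of "1 + a"] by simp
  show "p (1 + a) \<le> of_rat r" if "0 \<le> r" "ereal (p 1) < ereal (of_rat r) \<and> fst (x (of_rat r)) = 0" for r
    using fst_busy[OF ret(2), of "of_rat r"] that by (meson ereal_less(1) less_eq_real_def less_ereal.simps(1) not_less)
  show "ereal (p 1) < ereal r \<and> fst (x r) = 0" if "p (1 + a) < r" "r < p (Suc (1 + a))" for r
    using fst_after[OF ret(1), of r] that p_less[of 1 "1 + a"] a by simp
qed

lemma busy_end_q_infinite:
  assumes "\<forall>i\<ge>1. z i \<noteq> (0, 0)"
  shows "busy_end_q x = \<infinity>"
proof -
  have "(if busy_start_q x < ereal (of_rat r) \<and> fst (x (of_rat r)) = 0 then ereal (of_rat r) else \<infinity>) = \<infinity>" for r :: rat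
    using fst_never[OF assms, of "of_rat r"] by (auto simp: busy_start_q_eq)
  then show ?thesis unfolding busy_end_q_def by (simp add: exI[of _ 0])
qed

text \<open>Before time p (1 + a) the path runs through the holding intervals 0, ..., a, whose
  consecutive states differ, so at most a changes can be seen and one rational in each interval
  shows them all. The first arrival is counted and the final jump to the empty state is not, which
  gives a, the number of jumps in the cycle.\<close>

lemma alternates_iff:
  assumes ret: "z (1 + a) = (0, 0)" "\<forall>i\<in>{1..<1 + a}. z i \<noteq> (0, 0)"
  shows "alternates x m \<longleftrightarrow> m \<le> a"
proof
  assume m: "m \<le> a"
  have "\<exists>r::rat. p i < of_rat r \<and> of_rat r < p (Suc i)" for i
    using of_rat_dense[OF p_less[of i "Suc i"]] by blast
  then obtain r :: "nat \<Rightarrow> rat" where r: "\<And>i. p i < of_rat (r i)" "\<And>i. of_rat (r i) < p (Suc i)" by metis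
  have p0: "p i \<ge> 0" for i using p_pos[of i] p_0 by (cases i) auto
  have xr: "x (of_rat (r i)) = z i" for i by (rule x_val) (use r less_imp_le in auto)
  show "alternates x m"
    unfolding alternates_def busy_end_q_eq[OF ret]
  proof (intro exI[of _ "map r [0..<Suc m]"] conjI allI impI)
    fix i assume i: "i \<le> m"
    then have e: "map r [0..<Suc m] ! i = r i" by (simp add: nth_append del: upt_Suc)
    have "0 \<le> (of_rat (r i) :: real)" using r(1)[of i] p0[of i] by linarith
    then show "0 \<le> map r [0..<Suc m] ! i" unfolding e by simp
    have "p (Suc i) \<le> p (1 + a)" using i m p_less[of "Suc i" "1 + a"] by (cases "i = a") auto
    then show "ereal (of_rat (map r [0..<Suc m] ! i)) < ereal (p (1 + a))" unfolding e using r(2)[of i] by simp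
  next
    fix i assume i: "i < m"
    then have e: "map r [0..<Suc m] ! i = r i" "map r [0..<Suc m] ! Suc i = r (Suc i)"
      by (simp_all add: nth_append del: upt_Suc)
    have "(of_rat (r i) :: real) < of_rat (r (Suc i))" using r(2)[of i] r(1)[of "Suc i"] by linarith
    then show "map r [0..<Suc m] ! i < map r [0..<Suc m] ! Suc i" unfolding e by (simp add: of_rat_less)
    show "x (of_rat (map r [0..<Suc m] ! i)) \<noteq> x (of_rat (map r [0..<Suc m] ! Suc i))"
      unfolding e xr using z_jump[of i] by metis
  qed simp
next
  assume "alternates x m"
  then obtain rs :: "rat list" where rs: "length rs = Suc m"
    "\<And>i. i \<le> m \<Longrightarrow> 0 \<le> rs ! i" "\<And>i. i \<le> m \<Longrightarrow> (of_rat (rs ! i) :: real) < p (1 + a)"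
    "\<And>i. i < m \<Longrightarrow> rs ! i < rs ! Suc i" "\<And>i. i < m \<Longrightarrow> x (of_rat (rs ! i)) \<noteq> x (of_rat (rs ! Suc i))"
    unfolding alternates_def busy_end_q_eq[OF ret] by auto
  \<comment> \<open>Every observed change of state needs at least one jump in between, so the i-th
    observation is not before the i-th jump time.\<close>
  have "i \<le> m \<Longrightarrow> p i \<le> of_rat (rs ! i)" for i
  proof (induction i)
    case 0
    then show ?case using rs(2)[of 0] p_0 by simp
  next
    case (Suc i)
    then have i: "i < m" "p i \<le> of_rat (rs ! i)" by auto
    obtain j where j: "i \<le> j" "p j \<le> of_rat (rs ! i)" "of_rat (rs ! i) < p (Suc j)" "x (of_rat (rs ! i)) = z j"
      using index_between[OF i(2) rs(3)[of i]] i by auto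
    have lt: "(of_rat (rs ! i) :: real) < of_rat (rs ! Suc i)" using rs(4)[OF i(1)] by (simp add: of_rat_less)
    have "p (Suc j) \<le> of_rat (rs ! Suc i)"
    proof (rule ccontr)
      assume "\<not> ?thesis"
      then have "x (of_rat (rs ! Suc i)) = z j" using j lt by (intro x_val) auto
      then show False using rs(5)[OF i(1)] j by simp
    qed
    moreover have "p (Suc i) \<le> p (Suc j)" using j(1) p_less[of "Suc i" "Suc j"] by (cases "i = j") auto
    ultimately show ?case by simp
  qed
  then have "p m < p (1 + a)" using rs(3)[of m] by (meson le_less_trans order_refl)
  then show "m \<le> a" by (simp add: p_less_iff)
qed

end

section \<open>Mixed stable subordinators\<close>

lemma measurable_coarser:
  assumes f: "f \<in> measurable A N" and sub: "sets A \<subseteq> sets M" and sp: "space A = space M"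
  shows "f \<in> measurable M N"
proof (rule measurableI)
  show "f x \<in> space N" if "x \<in> space M" for x using measurable_space[OF f] that sp by simp
  show "f -` S \<inter> space M \<in> sets M" if "S \<in> sets N" for S
    using measurable_sets[OF f that] sub unfolding sp by blast
qed

text \<open>The product rule for events extends from indicators to f by the standard construction of
  nonnegative functions measurable for B.\<close>

lemma (in prob_space) indep_set_nn_integral:
  assumes indep: "indep_set (sets A) (sets B)" and sp: "space B = space M"
    and E: "E \<in> sets A" and f: "f \<in> borel_measurable B"
  shows "(\<integral>\<^sup>+\<omega>. indicator E \<omega> * f \<omega> \<partial>M) = emeasure M E * (\<integral>\<^sup>+\<omega>. f \<omega> \<partial>M)"
proof -
  have EM [measurable]: "E \<in> sets M" using indep_setD_ev1[OF indep] E by auto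
  have BM: "S \<in> sets M" if "S \<in> sets B" for S using indep_setD_ev2[OF indep] that by auto
  have meas: "g \<in> borel_measurable M" if "g \<in> borel_measurable B" for g :: "'a \<Rightarrow> ennreal"
    using that indep_setD_ev2[OF indep] sp by (rule measurable_coarser)
  show ?thesis
    using f
  proof (induct rule: borel_measurable_induct)
    case (cong f g)
    have e1: "(\<integral>\<^sup>+\<omega>. indicator E \<omega> * f \<omega> \<partial>M) = (\<integral>\<^sup>+\<omega>. indicator E \<omega> * g \<omega> \<partial>M)"
      by (rule nn_integral_cong) (simp add: cong(3) sp)
    have e2: "(\<integral>\<^sup>+\<omega>. f \<omega> \<partial>M) = (\<integral>\<^sup>+\<omega>. g \<omega> \<partial>M)"
      by (rule nn_integral_cong) (simp add: cong(3) sp)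
    show ?case unfolding e1 e2 by (rule cong(4))
  next
    case (set S)
    have "(\<integral>\<^sup>+\<omega>. indicator E \<omega> * indicator S \<omega> \<partial>M) = (\<integral>\<^sup>+\<omega>. indicator (E \<inter> S) \<omega> \<partial>M)"
      by (intro nn_integral_cong) (auto simp: indicator_def)
    also have "\<dots> = emeasure M (E \<inter> S)" using BM[OF set] by simp
    also have "\<dots> = emeasure M E * emeasure M S"
      using indep_setD[OF indep E set] by (simp add: emeasure_eq_measure ennreal_mult)
    also have "emeasure M S = (\<integral>\<^sup>+\<omega>. indicator S \<omega> \<partial>M)" using BM[OF set] by simp
    finally show ?case .
  next
    case (mult u c)
    have m [measurable]: "u \<in> borel_measurable M" by (rule meas[OF mult(2)])
    have "(\<integral>\<^sup>+\<omega>. indicator E \<omega> * (c * u \<omega>) \<partial>M) = (\<integral>\<^sup>+\<omega>. c * (indicator E \<omega> * u \<omega>) \<partial>M)"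
      by (simp only: mult.left_commute)
    also have "\<dots> = c * (emeasure M E * (\<integral>\<^sup>+\<omega>. u \<omega> \<partial>M))"
      by (subst nn_integral_cmult) (measurable, simp only: mult(4))
    finally show ?case unfolding nn_integral_cmult[OF m] by (simp only: mult.left_commute)
  next
    case (add u v)
    have m [measurable]: "u \<in> borel_measurable M" "v \<in> borel_measurable M"
      by (rule meas[OF add(1)], rule meas[OF add(4)])
    have "(\<integral>\<^sup>+\<omega>. indicator E \<omega> * (v \<omega> + u \<omega>) \<partial>M) = (\<integral>\<^sup>+\<omega>. indicator E \<omega> * v \<omega> + indicator E \<omega> * u \<omega> \<partial>M)"
      by (simp only: distrib_left)
    also have "\<dots> = emeasure M E * (\<integral>\<^sup>+\<omega>. v \<omega> \<partial>M) + emeasure M E * (\<integral>\<^sup>+\<omega>. u \<omega> \<partial>M)"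
      by (subst nn_integral_add) (measurable, simp only: add(3) add(7))
    finally show ?case unfolding nn_integral_add[OF m(2) m(1)] by (simp only: distrib_left)
  next
    case (seq U)
    have m [measurable]: "U i \<in> borel_measurable M" for i by (rule meas[OF seq(1)])
    have inc: "incseq (\<lambda>i \<omega>. indicator E \<omega> * U i \<omega>)"
      using seq(4) unfolding incseq_def le_fun_def by (blast intro: mult_left_mono zero_le)
    have "(\<integral>\<^sup>+\<omega>. indicator E \<omega> * (SUP i. U i \<omega>) \<partial>M) = (\<integral>\<^sup>+\<omega>. (SUP i. indicator E \<omega> * U i \<omega>) \<partial>M)"
      by (simp only: SUP_mult_left_ennreal)
    also have "\<dots> = (SUP i. \<integral>\<^sup>+\<omega>. indicator E \<omega> * U i \<omega> \<partial>M)"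
      by (rule nn_integral_monotone_convergence_SUP[OF inc]) measurable
    also have "\<dots> = emeasure M E * (SUP i. \<integral>\<^sup>+\<omega>. U i \<omega> \<partial>M)"
      by (simp only: seq(3) SUP_mult_left_ennreal)
    also have "(SUP i. \<integral>\<^sup>+\<omega>. U i \<omega> \<partial>M) = (\<integral>\<^sup>+\<omega>. (SUP i. U i \<omega>) \<partial>M)"
      by (rule nn_integral_monotone_convergence_SUP [symmetric, OF seq(4)]) measurable
    finally show ?case unfolding SUP_apply .
  qed
qed

text \<open>Splitting by the value of W lets a random index be treated as a constant on each piece.
  It is applied to the pair of grid points that approximate the two random levels.\<close>

lemma nn_integral_countable_selector:
  fixes F G :: "nat \<Rightarrow> 'a \<Rightarrow> ennreal"
  assumes [measurable]: "W \<in> measurable M (count_space UNIV)" "\<And>m. F m \<in> borel_measurable M" "\<And>m. G m \<in> borel_measurable M"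
    and eq: "\<And>m. (\<integral>\<^sup>+\<omega>. indicator {\<omega>. W \<omega> = m} \<omega> * F m \<omega> \<partial>M) = (\<integral>\<^sup>+\<omega>. indicator {\<omega>. W \<omega> = m} \<omega> * G m \<omega> \<partial>M)"
  shows "(\<integral>\<^sup>+\<omega>. F (W \<omega>) \<omega> \<partial>M) = (\<integral>\<^sup>+\<omega>. G (W \<omega>) \<omega> \<partial>M)"
proof -
  have [measurable]: "(\<lambda>\<omega>. indicator {\<omega>. W \<omega> = m} \<omega> :: ennreal) \<in> borel_measurable M" for m
    by (rule borel_measurable_indicator') measurable
  have dec: "(\<integral>\<^sup>+\<omega>. H (W \<omega>) \<omega> \<partial>M) = (\<Sum>m. \<integral>\<^sup>+\<omega>. indicator {\<omega>. W \<omega> = m} \<omega> * H m \<omega> \<partial>M)"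
    if [measurable]: "\<And>m. H m \<in> borel_measurable M" for H :: "nat \<Rightarrow> 'a \<Rightarrow> ennreal"
  proof -
    have "H (W \<omega>) \<omega> = (\<Sum>m. indicator {\<omega>. W \<omega> = m} \<omega> * H m \<omega>)" for \<omega>
    proof -
      have "(\<lambda>m. if m = W \<omega> then H m \<omega> else 0) sums H (W \<omega>) \<omega>" by (rule sums_single)
      also have "(\<lambda>m. if m = W \<omega> then H m \<omega> else 0) = (\<lambda>m. indicator {\<omega>. W \<omega> = m} \<omega> * H m \<omega>)"
        by (auto simp: fun_eq_iff)
      finally show ?thesis by (simp add: sums_iff)
    qed
    then show ?thesis by (simp only:) (rule nn_integral_suminf, measurable)
  qed
  show ?thesis by (simp add: dec eq)
qed

lemma process_algebra_component:
  assumes "t \<ge> 0" "space N = UNIV"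
  shows "X t \<in> measurable (process_algebra M N X) N"
proof -
  have "(\<lambda>\<omega>. \<lambda>t\<in>{0..}. X t \<omega>) \<in> measurable (process_algebra M N X) (PiM {0..} (\<lambda>_. N))"
    unfolding process_algebra_def by (rule measurable_vimage_algebra1) (auto simp: space_PiM assms)
  from measurable_compose[OF this measurable_component_singleton[of t "{0..}"]] assms show ?thesis by simp
qed

lemma space_process_algebra [simp]: "space (process_algebra M N X) = space M"
  by (simp add: process_algebra_def)

text \<open>The grid point lies strictly below \<open>s\<close>, so that \<open>D\<close> along the grid converges to the left limit.\<close>

definition dyadic_below :: "nat \<Rightarrow> real \<Rightarrow> nat" where
  "dyadic_below n s = nat (\<lceil>2 ^ n * s\<rceil> - 1)"

lemma dyadic_below:
  assumes "s > 0"
  shows "real (dyadic_below n s) / 2 ^ n < s" "s - 1 / 2 ^ n \<le> real (dyadic_below n s) / 2 ^ n"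
proof -
  have "2 ^ n * s > 0" using assms by simp
  then have e: "real (dyadic_below n s) = of_int (\<lceil>2 ^ n * s\<rceil> - 1)"
    unfolding dyadic_below_def by (subst of_nat_nat) linarith+
  have "real (dyadic_below n s) < 2 ^ n * s" "2 ^ n * s - 1 \<le> real (dyadic_below n s)"
    unfolding e by linarith+
  then have "real (dyadic_below n s) / 2 ^ n < 2 ^ n * s / 2 ^ n" "(2 ^ n * s - 1) / 2 ^ n \<le> real (dyadic_below n s) / 2 ^ n"
    by (intro divide_strict_right_mono divide_right_mono; simp)+
  then show "real (dyadic_below n s) / 2 ^ n < s" "s - 1 / 2 ^ n \<le> real (dyadic_below n s) / 2 ^ n"
    by (simp_all add: diff_divide_distrib)
qed

lemma dyadic_below_mono: "s \<le> r \<Longrightarrow> dyadic_below n s \<le> dyadic_below n r"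
  unfolding dyadic_below_def by (intro nat_mono diff_right_mono ceiling_mono mult_left_mono) auto

lemma dyadic_below_tendsto:
  assumes "s > 0" shows "(\<lambda>n. real (dyadic_below n s) / 2 ^ n) \<longlonglongrightarrow> s"
proof (rule tendsto_sandwich)
  have "(\<lambda>n. 1 / 2 ^ n :: real) \<longlonglongrightarrow> 0" by real_asymp
  then have "(\<lambda>n. s - 1 / 2 ^ n) \<longlonglongrightarrow> s - 0" by (intro tendsto_intros)
  then show "(\<lambda>n. s - 1 / 2 ^ n) \<longlonglongrightarrow> s" by simp
qed (use dyadic_below[OF assms] in \<open>auto intro!: always_eventually less_imp_le\<close>)

section \<open>Almost sure path properties of the mixed stable subordinator\<close>

locale mixed_sub = prob_space M for M :: "'w measure" +
  fixes \<alpha>1 \<alpha>2 c1 c2 :: real and D :: "real \<Rightarrow> 'w \<Rightarrow> real"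
  assumes sub: "mixed_stable_subordinator M \<alpha>1 \<alpha>2 c1 c2 D"
    and c1: "c1 > 0" and c2: "c2 \<ge> 0" and a1: "\<alpha>1 > 0"
begin

definition phi :: "real \<Rightarrow> real" where "phi z = c1 * z powr \<alpha>1 + c2 * z powr \<alpha>2"

lemma phi_pos: "z > 0 \<Longrightarrow> phi z > 0"
  using c1 c2 by (auto simp: phi_def intro!: add_pos_nonneg)

lemma D_measurable [measurable]: "t \<ge> 0 \<Longrightarrow> D t \<in> borel_measurable M"
  using sub by (simp add: mixed_stable_subordinator_def nondecreasing_levy_process_def)

lemma increment_laplace:
  assumes "0 \<le> s" "s \<le> t" "z > 0"
  shows "(\<integral>\<^sup>+\<omega>. ennreal (exp (- z * (D t \<omega> - D s \<omega>))) \<partial>M) = ennreal (exp (- phi z * (t - s)))"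
proof -
  have [measurable]: "D t \<in> borel_measurable M" "D s \<in> borel_measurable M" "D (t - s) \<in> borel_measurable M"
    using assms by auto
  have "distr M borel (\<lambda>\<omega>. D (s + (t - s)) \<omega> - D s \<omega>) = distr M borel (D (t - s))"
    using sub assms unfolding mixed_stable_subordinator_def nondecreasing_levy_process_def by (metis diff_ge_0_iff_ge)
  then have d: "distr M borel (\<lambda>\<omega>. D t \<omega> - D s \<omega>) = distr M borel (D (t - s))" by simp
  have "(\<integral>\<omega>. exp (- z * (D t \<omega> - D s \<omega>)) \<partial>M) = (\<integral>x. exp (- z * x) \<partial>distr M borel (\<lambda>\<omega>. D t \<omega> - D s \<omega>))"
    by (subst integral_distr) auto
  also have "\<dots> = (\<integral>\<omega>. exp (- z * D (t - s) \<omega>) \<partial>M)"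
    unfolding d by (subst integral_distr) auto
  also have "\<dots> = exp (- (t - s) * (c1 * z powr \<alpha>1 + c2 * z powr \<alpha>2))"
    using sub assms unfolding mixed_stable_subordinator_def by (metis diff_ge_0_iff_ge)
  also have "\<dots> = exp (- phi z * (t - s))" by (simp add: phi_def algebra_simps)
  finally have I: "(\<integral>\<omega>. exp (- z * (D t \<omega> - D s \<omega>)) \<partial>M) = exp (- phi z * (t - s))" .
  \<comment> \<open>A nonintegrable function has Bochner integral 0, whereas the value just found is
    positive.\<close>
  then have "integrable M (\<lambda>\<omega>. exp (- z * (D t \<omega> - D s \<omega>)))"
    using not_integrable_integral_eq[of M "\<lambda>\<omega>. exp (- z * (D t \<omega> - D s \<omega>))"] by fastforce
  from nn_integral_eq_integral[OF this] I show ?thesis by simp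
qed

lemma AE_D_basic: "AE \<omega> in M. D 0 \<omega> = 0 \<and> mono_on {0..} (\<lambda>t. D t \<omega>) \<and> (\<forall>t\<ge>0. continuous (at_right t) (\<lambda>s. D s \<omega>))"
  using sub by (simp add: mixed_stable_subordinator_def nondecreasing_levy_process_def)

text \<open>Exponential Markov inequality. Letting z tend to infinity with K = 0 gives strict
  growth; letting t tend to infinity with z = 1 gives unboundedness.\<close>

lemma prob_increment_le:
  assumes "0 \<le> s" "s \<le> t" "z > 0"
  shows "measure M {\<omega> \<in> space M. D t \<omega> - D s \<omega> \<le> K} \<le> exp (z * K) * exp (- phi z * (t - s))"
proof -
  have [measurable]: "D t \<in> borel_measurable M" "D s \<in> borel_measurable M" using assms by auto
  let ?A = "{\<omega> \<in> space M. D t \<omega> - D s \<omega> \<le> K}"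
  have "ennreal (measure M ?A) = (\<integral>\<^sup>+\<omega>. indicator ?A \<omega> \<partial>M)" by (simp add: emeasure_eq_measure)
  also have "\<dots> \<le> (\<integral>\<^sup>+\<omega>. ennreal (exp (z * K)) * ennreal (exp (- z * (D t \<omega> - D s \<omega>))) \<partial>M)"
  proof (rule nn_integral_mono)
    fix \<omega>
    show "indicator ?A \<omega> \<le> ennreal (exp (z * K)) * ennreal (exp (- z * (D t \<omega> - D s \<omega>)))"
    proof (cases "\<omega> \<in> ?A")
      case True
      then have "z * (D t \<omega> - D s \<omega>) \<le> z * K" using assms by (intro mult_left_mono) auto
      then have "1 \<le> exp (z * K) * exp (- z * (D t \<omega> - D s \<omega>))" by (simp add: exp_add [symmetric])
      then have "ennreal 1 \<le> ennreal (exp (z * K) * exp (- z * (D t \<omega> - D s \<omega>)))" by (rule ennreal_leI)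
      then show ?thesis using True by (simp add: ennreal_mult')
    qed simp
  qed
  also have "\<dots> = ennreal (exp (z * K)) * (\<integral>\<^sup>+\<omega>. ennreal (exp (- z * (D t \<omega> - D s \<omega>))) \<partial>M)"
    by (rule nn_integral_cmult) measurable
  also have "\<dots> = ennreal (exp (z * K) * exp (- phi z * (t - s)))"
    unfolding increment_laplace[OF assms] by (simp add: ennreal_mult')
  finally show ?thesis by (simp add: ennreal_le_iff)
qed

text \<open>Since c1 > 0 and \<alpha>1 > 0, the exponent phi z is unbounded in z, which drives the
  bound for a nonpositive increment to 0.\<close>

lemma AE_increment_pos:
  assumes "0 \<le> s" "s < t"
  shows "AE \<omega> in M. D s \<omega> < D t \<omega>"
proof -
  have [measurable]: "D t \<in> borel_measurable M" "D s \<in> borel_measurable M" using assms by auto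
  let ?A = "{\<omega> \<in> space M. D t \<omega> - D s \<omega> \<le> 0}"
  have l1: "measure M ?A \<le> exp (- (c1 * (t - s)) * z powr \<alpha>1)" if "z > 0" for z
  proof -
    have "measure M ?A \<le> exp (- phi z * (t - s))" using prob_increment_le[of s t z 0] assms that by simp
    also have "\<dots> \<le> exp (- (c1 * (t - s)) * z powr \<alpha>1)"
    proof -
      have "0 \<le> c2 * z powr \<alpha>2 * (t - s)" using assms c2 by simp
      then show ?thesis by (simp add: phi_def algebra_simps)
    qed
    finally show ?thesis .
  qed
  have ct: "c1 * (t - s) > 0" using c1 assms by simp
  have l2: "((\<lambda>z. exp (- (c1 * (t - s)) * z powr \<alpha>1)) \<longlongrightarrow> 0) at_top"
  proof -
    have "((\<lambda>z. exp (- c * z powr \<alpha>1)) \<longlongrightarrow> 0) at_top" if "c > 0" for c :: real using that a1 by real_asymp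
    from this[OF ct] show ?thesis .
  qed
  have l3: "eventually (\<lambda>z. measure M ?A \<le> exp (- (c1 * (t - s)) * z powr \<alpha>1)) at_top"
    using eventually_gt_at_top[of 0] by eventually_elim (rule l1)
  have "measure M ?A \<le> 0"
    by (rule tendsto_lowerbound[OF l2 l3]) simp
  then have "?A \<in> null_sets M" by (intro null_setsI) (auto simp: emeasure_eq_measure measure_le_0_iff)
  then have "AE \<omega> in M. \<omega> \<notin> ?A" by (rule AE_not_in)
  then show ?thesis using AE_space by eventually_elim auto
qed

lemma AE_unbounded: "AE \<omega> in M. \<forall>K. \<exists>s\<ge>0. D s \<omega> > K"
proof -
  have null: "AE \<omega> in M. \<exists>n::nat. D (real n) \<omega> - D 0 \<omega> > real K" for K :: nat
  proof -
    define A where "A = {\<omega> \<in> space M. \<forall>n::nat. D (real n) \<omega> - D 0 \<omega> \<le> real K}"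
    have [measurable]: "A \<in> sets M" unfolding A_def by measurable
    have l1: "measure M A \<le> exp (real K) * exp (- phi 1) ^ n" for n
    proof -
      have "measure M A \<le> measure M {\<omega> \<in> space M. D (real n) \<omega> - D 0 \<omega> \<le> real K}"
        by (rule finite_measure_mono) (auto simp: A_def)
      also have "\<dots> \<le> exp (real K) * exp (- phi 1) ^ n"
        using prob_increment_le[of 0 "real n" 1 "real K"] by (simp add: exp_of_nat_mult [symmetric] mult_ac)
      finally show ?thesis .
    qed
    have l2: "(\<lambda>n. exp (real K) * exp (- phi 1) ^ n) \<longlonglongrightarrow> exp (real K) * 0"
      using phi_pos[of 1] by (intro tendsto_intros LIMSEQ_realpow_zero) auto
    have "measure M A \<le> exp (real K) * 0"
      by (rule LIMSEQ_le_const[OF l2]) (use l1 in blast)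
    then have "A \<in> null_sets M" by (intro null_setsI) (auto simp: emeasure_eq_measure measure_le_0_iff)
    then have "AE \<omega> in M. \<omega> \<notin> A" by (rule AE_not_in)
    then show ?thesis using AE_space by eventually_elim (auto simp: A_def not_le)
  qed
  have "AE \<omega> in M. \<forall>K::nat. \<exists>n::nat. D (real n) \<omega> - D 0 \<omega> > real K"
    unfolding AE_all_countable using null by simp
  then show ?thesis using AE_D_basic
  proof eventually_elim
    case (elim \<omega>)
    show ?case
    proof
      fix K :: real
      obtain k :: nat where "K \<le> real k" using real_arch_simple by blast
      moreover obtain n :: nat where "D (real n) \<omega> - D 0 \<omega> > real k" using elim by blast
      ultimately show "\<exists>s\<ge>0. D s \<omega> > K" using elim by (intro exI[of _ "real n"]) auto
    qed
  qed
qed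

text \<open>Strict growth is known almost surely for each pair of levels, hence simultaneously for
  all rational pairs. Inserting two rationals between a and b and using monotonicity extends it to
  all levels.\<close>

lemma AE_subordinator_path: "AE \<omega> in M. subordinator_path (\<lambda>t. D t \<omega>)"
proof -
  have "AE \<omega> in M. \<forall>p :: rat \<times> rat. 0 \<le> fst p \<longrightarrow> fst p < snd p \<longrightarrow> D (of_rat (fst p)) \<omega> < D (of_rat (snd p)) \<omega>"
    unfolding AE_all_countable using AE_increment_pos by (auto simp: of_rat_less)
  then show ?thesis using AE_D_basic AE_unbounded
  proof eventually_elim
    case (elim \<omega>)
    show ?case
    proof
      fix a b :: real assume ab: "0 \<le> a" "a < b"
      obtain p :: rat where p: "a < of_rat p" "of_rat p < b" using of_rat_dense[OF ab(2)] by blast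
      obtain r :: rat where r: "of_rat p < (of_rat r :: real)" "of_rat r < b" using of_rat_dense[OF p(2)] by blast
      have p0: "0 < (of_rat p :: real)" using ab p by linarith
      have m: "D u \<omega> \<le> D v \<omega>" if "0 \<le> u" "u \<le> v" for u v
        using elim that by (auto simp: mono_on_def)
      have "D a \<omega> \<le> D (of_rat p) \<omega>" using m ab p by simp
      also have "\<dots> < D (of_rat r) \<omega>" using elim p0 r by (auto simp: of_rat_less dest!: spec[of _ "(p, r)"])
      also have "\<dots> \<le> D b \<omega>" using r p0 by (intro m) linarith+
      finally show "D a \<omega> < D b \<omega>" .
    qed (use elim in auto)
  qed
qed

text \<open>Only the inverse of \<open>D\<close> is assumed to be independent of the queue, so \<open>D\<close> has to be recovered from it.\<close>

definition Dq :: "real \<Rightarrow> 'w \<Rightarrow> real" where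
  "Dq q \<omega> = real_of_ereal (INF r\<in>{r::rat. r > 0}. if inverse_process D (of_rat r) \<omega> > q then ereal (of_rat r) else \<infinity>)"

lemma Dq_measurable [measurable]: "Dq q \<in> borel_measurable (process_algebra M borel (inverse_process D))"
proof -
  have [measurable]: "inverse_process D (of_rat r) \<in> borel_measurable (process_algebra M borel (inverse_process D))"
    if "r > 0" for r :: rat
    using that by (intro process_algebra_component) auto
  have "(\<lambda>\<omega>. INF r\<in>{r::rat. r > 0}. if inverse_process D (of_rat r) \<omega> > q then ereal (of_rat r) else \<infinity>)
     \<in> borel_measurable (process_algebra M borel (inverse_process D))"
    by (intro borel_measurable_INF) auto
  then show ?thesis unfolding Dq_def[abs_def] by measurable
qed

lemma AE_Dq: "AE \<omega> in M. \<forall>q\<ge>0. Dq q \<omega> = D q \<omega>"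
  using AE_subordinator_path
proof eventually_elim
  case (elim \<omega>)
  interpret subordinator_path "\<lambda>t. D t \<omega>" by fact
  have "inverse_process D t \<omega> = y t" for t by (simp add: inverse_process_def y_def)
  then show ?case using inverse_recovers by (simp add: Dq_def)
qed

text \<open>A left limit at a random level is a supremum over uncountably many indices. Along the
  grid below the level only countably many fixed indices occur, so each approximation is measurable,
  and so is their limit.\<close>

lemma left_lim_difference_measurable:
  assumes [measurable]: "s \<in> borel_measurable M" "r \<in> borel_measurable M"
  shows "\<exists>V\<in>borel_measurable M. AE \<omega> in M. 0 < s \<omega> \<and> 0 < r \<omega> \<longrightarrow>
    V \<omega> = left_lim (\<lambda>t. D t \<omega>) (r \<omega>) - left_lim (\<lambda>t. D t \<omega>) (s \<omega>)"
proof -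
  define X where "X f n \<omega> = D (real (dyadic_below n (f \<omega>)) / 2 ^ n) \<omega>" for f :: "'w \<Rightarrow> real" and n \<omega>
  have X [measurable]: "X f n \<in> borel_measurable M" if "f \<in> borel_measurable M" for f n
  proof -
    have "(\<lambda>\<omega>. dyadic_below n (f \<omega>)) \<in> measurable M (count_space UNIV)"
      unfolding dyadic_below_def using that by measurable
    from measurable_compose_countable[where f = "\<lambda>i \<omega>. D (real i / 2 ^ n) \<omega>", OF _ this]
    show ?thesis unfolding X_def by simp
  qed
  define V where "V \<omega> = lim (\<lambda>n. X r n \<omega> - X s n \<omega>)" for \<omega>
  have "V \<in> borel_measurable M" unfolding V_def by measurable
  moreover have "AE \<omega> in M. 0 < s \<omega> \<and> 0 < r \<omega> \<longrightarrow>
    V \<omega> = left_lim (\<lambda>t. D t \<omega>) (r \<omega>) - left_lim (\<lambda>t. D t \<omega>) (s \<omega>)"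
    using AE_subordinator_path
  proof eventually_elim
    case (elim \<omega>)
    interpret subordinator_path "\<lambda>t. D t \<omega>" by fact
    have "(\<lambda>n. X f n \<omega>) \<longlonglongrightarrow> left_lim (\<lambda>t. D t \<omega>) (f \<omega>)" if "f \<omega> > 0" for f
      unfolding X_def using dyadic_below[OF that] dyadic_below_tendsto[OF that] that by (intro left_lim_tendsto) auto
    then show ?case unfolding V_def by (auto intro!: limI tendsto_diff)
  qed
  ultimately show ?thesis by blast
qed

text \<open>On the grid the random levels, determined by the queue, take countably many values. For
  a fixed pair of grid points independence separates the increment of D from the event, and the Levy
  property gives its transform. Refinement of the grid, with all integrands bounded by 1, yields the
  left limits on one side and r - s on the other.\<close>

lemma time_changed_laplace:
  fixes s r V :: "'w \<Rightarrow> real"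
  assumes indep: "indep_set (sets A) (sets (process_algebra M borel (inverse_process D)))"
    and sp: "space A = space M"
    and sA [measurable]: "s \<in> borel_measurable A" and rA [measurable]: "r \<in> borel_measurable A"
    and E [measurable]: "E \<in> sets A"
    and sr: "AE \<omega> in M. \<omega> \<in> E \<longrightarrow> 0 < s \<omega> \<and> s \<omega> < r \<omega>"
    and Vm [measurable]: "V \<in> borel_measurable M"
    and V: "AE \<omega> in M. \<omega> \<in> E \<longrightarrow> V \<omega> = left_lim (\<lambda>t. D t \<omega>) (r \<omega>) - left_lim (\<lambda>t. D t \<omega>) (s \<omega>)"
    and z: "z > 0"
  shows "(\<integral>\<^sup>+\<omega>. indicator E \<omega> * ennreal (exp (- z * V \<omega>)) \<partial>M) =
    (\<integral>\<^sup>+\<omega>. indicator E \<omega> * ennreal (exp (- phi z * (r \<omega> - s \<omega>))) \<partial>M)"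
proof -
  let ?B = "process_algebra M borel (inverse_process D)"
  have AM: "S \<in> sets M" if "S \<in> sets A" for S using indep_setD_ev1[OF indep] that by auto
  have BM: "S \<in> sets M" if "S \<in> sets ?B" for S using indep_setD_ev2[OF indep] that by auto
  note sub1 = measurable_coarser[OF _ indep_setD_ev1[OF indep] sp]
  have EM [measurable]: "E \<in> sets M" using AM E by blast
  have sM [measurable]: "s \<in> borel_measurable M" "r \<in> borel_measurable M" by (rule sub1[OF sA], rule sub1[OF rA])
  define X where "X n \<omega> = real (dyadic_below n (s \<omega>)) / 2 ^ n" for n \<omega>
  define Y where "Y n \<omega> = real (dyadic_below n (r \<omega>)) / 2 ^ n" for n \<omega>
  have dyA [measurable]: "(\<lambda>\<omega>. dyadic_below n (f \<omega>)) \<in> measurable N (count_space UNIV)"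
    if "f \<in> borel_measurable N" for f :: "'w \<Rightarrow> real" and n and N
    unfolding dyadic_below_def using that by measurable
  have DM: "(\<lambda>\<omega>. D (real (dyadic_below n (f \<omega>)) / 2 ^ n) \<omega>) \<in> borel_measurable M"
    if "f \<in> borel_measurable M" for f :: "'w \<Rightarrow> real" and n
    by (rule measurable_compose_countable[where f = "\<lambda>i \<omega>. D (real i / 2 ^ n) \<omega>", OF _ dyA[OF that]]) (rule D_measurable, simp)
  have [measurable]: "(\<lambda>\<omega>. D (X n \<omega>) \<omega>) \<in> borel_measurable M" "(\<lambda>\<omega>. D (Y n \<omega>) \<omega>) \<in> borel_measurable M"
     "X n \<in> borel_measurable M" "Y n \<in> borel_measurable M" for n
    unfolding X_def Y_def by (rule DM, measurable)+ measurable
  have claim: "(\<integral>\<^sup>+\<omega>. indicator E \<omega> * ennreal (exp (- z * (D (Y n \<omega>) \<omega> - D (X n \<omega>) \<omega>))) \<partial>M) =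
     (\<integral>\<^sup>+\<omega>. indicator E \<omega> * ennreal (exp (- phi z * (Y n \<omega> - X n \<omega>))) \<partial>M)" for n
  proof -
    \<comment> \<open>The two grid indices are packed into one natural number, so that a single
      selector freezes both levels.\<close>
    define W where "W \<omega> = prod_encode (dyadic_below n (s \<omega>), dyadic_below n (r \<omega>))" for \<omega>
    define i where "i m = real (fst (prod_decode m)) / 2 ^ n" for m
    define j where "j m = real (snd (prod_decode m)) / 2 ^ n" for m
    have ij0: "i m \<ge> 0" "j m \<ge> 0" for m by (simp_all add: i_def j_def)
    have WA: "W \<in> measurable A (count_space UNIV)"
      unfolding W_def by (intro measurable_compose[OF measurable_Pair[OF dyA[OF sA] dyA[OF rA]], of prod_encode])
        (simp add: pair_measure_countable)
    have WM: "W \<in> measurable M (count_space UNIV)" by (rule sub1[OF WA])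
    define F where "F m \<omega> = indicator E \<omega> * ennreal (exp (- z * (D (j m) \<omega> - D (i m) \<omega>)))" for m \<omega>
    define G where "G m \<omega> = indicator E \<omega> * ennreal (exp (- phi z * (j m - i m)))" for m \<omega>
    have [measurable]: "D (i m) \<in> borel_measurable M" "D (j m) \<in> borel_measurable M" for m using ij0 by auto
    have "(\<integral>\<^sup>+\<omega>. F (W \<omega>) \<omega> \<partial>M) = (\<integral>\<^sup>+\<omega>. G (W \<omega>) \<omega> \<partial>M)"
    proof (rule nn_integral_countable_selector[OF WM])
      show "F m \<in> borel_measurable M" "G m \<in> borel_measurable M" for m unfolding F_def G_def by measurable
      fix m
      define C where "C = E \<inter> {\<omega> \<in> space A. W \<omega> = m}"
      have "{\<omega> \<in> space A. W \<omega> = m} \<in> sets A" using WA by measurable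
      then have CA: "C \<in> sets A" using E unfolding C_def by blast
      have CM [measurable]: "C \<in> sets M" by (rule AM[OF CA])
      have Fe: "(\<integral>\<^sup>+\<omega>. indicator {\<omega>. W \<omega> = m} \<omega> * F m \<omega> \<partial>M) = (\<integral>\<^sup>+\<omega>. indicator C \<omega> * ennreal (exp (- z * (D (j m) \<omega> - D (i m) \<omega>))) \<partial>M)"
        unfolding F_def by (intro nn_integral_cong) (auto simp: C_def indicator_def sp)
      have Ge: "(\<integral>\<^sup>+\<omega>. indicator {\<omega>. W \<omega> = m} \<omega> * G m \<omega> \<partial>M) = (\<integral>\<^sup>+\<omega>. indicator C \<omega> * ennreal (exp (- phi z * (j m - i m))) \<partial>M)"
        unfolding G_def by (intro nn_integral_cong) (auto simp: C_def indicator_def sp)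
      show "(\<integral>\<^sup>+\<omega>. indicator {\<omega>. W \<omega> = m} \<omega> * F m \<omega> \<partial>M) = (\<integral>\<^sup>+\<omega>. indicator {\<omega>. W \<omega> = m} \<omega> * G m \<omega> \<partial>M)"
      proof (cases "fst (prod_decode m) \<le> snd (prod_decode m)")
        case True
        then have le: "i m \<le> j m" by (simp add: i_def j_def divide_right_mono)
        \<comment> \<open>The passage to \<open>Dq\<close> makes the increment measurable for the
          algebra of the inverse process, where the product rule applies; afterwards it is undone to
          use the law of the increments of D.\<close>
        have "(\<integral>\<^sup>+\<omega>. indicator C \<omega> * ennreal (exp (- z * (D (j m) \<omega> - D (i m) \<omega>))) \<partial>M) =
           (\<integral>\<^sup>+\<omega>. indicator C \<omega> * ennreal (exp (- z * (Dq (j m) \<omega> - Dq (i m) \<omega>))) \<partial>M)"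
          by (rule nn_integral_cong_AE, rule AE_mp[OF AE_Dq], rule AE_I2) (use ij0 in simp)
        also have "\<dots> = emeasure M C * (\<integral>\<^sup>+\<omega>. ennreal (exp (- z * (Dq (j m) \<omega> - Dq (i m) \<omega>))) \<partial>M)"
          by (rule indep_set_nn_integral[OF indep _ CA]) (simp, measurable)
        also have "(\<integral>\<^sup>+\<omega>. ennreal (exp (- z * (Dq (j m) \<omega> - Dq (i m) \<omega>))) \<partial>M) = (\<integral>\<^sup>+\<omega>. ennreal (exp (- z * (D (j m) \<omega> - D (i m) \<omega>))) \<partial>M)"
          by (rule nn_integral_cong_AE, rule AE_mp[OF AE_Dq], rule AE_I2) (use ij0 in simp)
        also have "\<dots> = ennreal (exp (- phi z * (j m - i m)))"
          by (rule increment_laplace[OF ij0(1) le z])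
        also have "emeasure M C * \<dots> = (\<integral>\<^sup>+\<omega>. indicator C \<omega> * ennreal (exp (- phi z * (j m - i m))) \<partial>M)"
          by (subst nn_integral_multc) auto
        finally show ?thesis unfolding Fe Ge .
      next
        case False
        \<comment> \<open>Grid indices preserve the order of the levels, and s < r almost surely on
          E, so the reversed order occurs only on a null set.\<close>
        have "AE \<omega> in M. \<omega> \<notin> C"
          using sr
        proof eventually_elim
          case (elim \<omega>)
          show ?case
          proof
            assume "\<omega> \<in> C"
            then have "s \<omega> < r \<omega>" "prod_decode m = (dyadic_below n (s \<omega>), dyadic_below n (r \<omega>))"
              using elim by (auto simp: C_def W_def)
            then show False using False dyadic_below_mono[of "s \<omega>" "r \<omega>" n] by simp
          qed
        qed
        then have "AE \<omega> in M. indicator C \<omega> = (0::ennreal)" by eventually_elim simp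
        then show ?thesis unfolding Fe Ge
          by (intro nn_integral_cong_AE) (auto elim!: eventually_mono)
      qed
    qed
    then show ?thesis by (simp add: F_def G_def W_def i_def j_def X_def Y_def)
  qed
  have good: "AE \<omega> in M. \<omega> \<in> E \<longrightarrow> (\<forall>n. 0 \<le> X n \<omega> \<and> X n \<omega> \<le> Y n \<omega> \<and> X n \<omega> < s \<omega> \<and> Y n \<omega> < r \<omega>) \<and>
      (\<lambda>n. X n \<omega>) \<longlonglongrightarrow> s \<omega> \<and> (\<lambda>n. Y n \<omega>) \<longlonglongrightarrow> r \<omega>"
    using sr
  proof eventually_elim
    case (elim \<omega>)
    show ?case
    proof
      assume "\<omega> \<in> E"
      then have p: "s \<omega> > 0" "r \<omega> > 0" "s \<omega> \<le> r \<omega>" using elim by auto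
      show "(\<forall>n. 0 \<le> X n \<omega> \<and> X n \<omega> \<le> Y n \<omega> \<and> X n \<omega> < s \<omega> \<and> Y n \<omega> < r \<omega>) \<and>
        (\<lambda>n. X n \<omega>) \<longlonglongrightarrow> s \<omega> \<and> (\<lambda>n. Y n \<omega>) \<longlonglongrightarrow> r \<omega>"
        unfolding X_def Y_def
        using dyadic_below(1)[OF p(1)] dyadic_below(1)[OF p(2)] dyadic_below_tendsto[OF p(1)] dyadic_below_tendsto[OF p(2)]
          dyadic_below_mono[OF p(3)] by (auto intro!: divide_right_mono)
    qed
  qed
  have lim1: "(\<lambda>n. \<integral>\<^sup>+\<omega>. indicator E \<omega> * ennreal (exp (- z * (D (Y n \<omega>) \<omega> - D (X n \<omega>) \<omega>))) \<partial>M) \<longlonglongrightarrow>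
      (\<integral>\<^sup>+\<omega>. indicator E \<omega> * ennreal (exp (- z * V \<omega>)) \<partial>M)"
  proof (rule nn_integral_dominated_convergence[where w = "\<lambda>_. 1"])
    show "AE \<omega> in M. indicator E \<omega> * ennreal (exp (- z * (D (Y n \<omega>) \<omega> - D (X n \<omega>) \<omega>))) \<le> 1" for n
      using good AE_subordinator_path
    proof eventually_elim
      case (elim \<omega>)
      interpret subordinator_path "\<lambda>t. D t \<omega>" by fact
      show ?case
      proof (cases "\<omega> \<in> E")
        case True
        then have "D (X n \<omega>) \<omega> \<le> D (Y n \<omega>) \<omega>" using elim by (intro mono) auto
        then have "exp (- z * (D (Y n \<omega>) \<omega> - D (X n \<omega>) \<omega>)) \<le> 1" using z by simp
        then have "ennreal (exp (- z * (D (Y n \<omega>) \<omega> - D (X n \<omega>) \<omega>))) \<le> ennreal 1" by (rule ennreal_leI)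
        then show ?thesis using True by simp
      qed simp
    qed
    show "AE \<omega> in M. (\<lambda>n. indicator E \<omega> * ennreal (exp (- z * (D (Y n \<omega>) \<omega> - D (X n \<omega>) \<omega>)))) \<longlonglongrightarrow>
        indicator E \<omega> * ennreal (exp (- z * V \<omega>))"
      using good AE_subordinator_path V sr
    proof eventually_elim
      case (elim \<omega>)
      interpret subordinator_path "\<lambda>t. D t \<omega>" by fact
      show ?case
      proof (cases "\<omega> \<in> E")
        case True
        have "(\<lambda>n. D (X n \<omega>) \<omega>) \<longlonglongrightarrow> left_lim (\<lambda>t. D t \<omega>) (s \<omega>)"
          using elim True by (intro left_lim_tendsto) auto
        moreover have "0 \<le> Y n \<omega>" for n using elim True by (meson order_trans)
        then have "(\<lambda>n. D (Y n \<omega>) \<omega>) \<longlonglongrightarrow> left_lim (\<lambda>t. D t \<omega>) (r \<omega>)"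
          using elim True by (intro left_lim_tendsto) auto
        ultimately have "(\<lambda>n. ennreal (exp (- z * (D (Y n \<omega>) \<omega> - D (X n \<omega>) \<omega>)))) \<longlonglongrightarrow> ennreal (exp (- z * V \<omega>))"
          using elim(3) True by (auto intro!: tendsto_intros)
        then show ?thesis using True by simp
      qed simp
    qed
  qed (auto simp: emeasure_space_1)
  have lim2: "(\<lambda>n. \<integral>\<^sup>+\<omega>. indicator E \<omega> * ennreal (exp (- phi z * (Y n \<omega> - X n \<omega>))) \<partial>M) \<longlonglongrightarrow>
      (\<integral>\<^sup>+\<omega>. indicator E \<omega> * ennreal (exp (- phi z * (r \<omega> - s \<omega>))) \<partial>M)"
  proof (rule nn_integral_dominated_convergence[where w = "\<lambda>_. 1"])
    show "AE \<omega> in M. indicator E \<omega> * ennreal (exp (- phi z * (Y n \<omega> - X n \<omega>))) \<le> 1" for n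
      using good
    proof eventually_elim
      case (elim \<omega>)
      show ?case
      proof (cases "\<omega> \<in> E")
        case True
        then have "exp (- phi z * (Y n \<omega> - X n \<omega>)) \<le> 1" using phi_pos[OF z] elim by simp
        then have "ennreal (exp (- phi z * (Y n \<omega> - X n \<omega>))) \<le> ennreal 1" by (rule ennreal_leI)
        then show ?thesis using True by simp
      qed simp
    qed
    show "AE \<omega> in M. (\<lambda>n. indicator E \<omega> * ennreal (exp (- phi z * (Y n \<omega> - X n \<omega>)))) \<longlonglongrightarrow>
        indicator E \<omega> * ennreal (exp (- phi z * (r \<omega> - s \<omega>)))"
      using good
    proof eventually_elim
      case (elim \<omega>)
      show ?case
      proof (cases "\<omega> \<in> E")
        case True
        then have "(\<lambda>n. ennreal (exp (- phi z * (Y n \<omega> - X n \<omega>)))) \<longlonglongrightarrow> ennreal (exp (- phi z * (r \<omega> - s \<omega>)))"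
          using elim by (auto intro!: tendsto_intros)
        then show ?thesis using True by simp
      qed simp
    qed
  qed (auto simp: emeasure_space_1)
  show ?thesis using LIMSEQ_unique[OF lim1 lim2[folded claim]] .
qed

end

section \<open>The busy period\<close>

lemma alternates_Suc: "alternates x (Suc m) \<Longrightarrow> alternates x m"
  unfolding alternates_def
proof (elim exE conjE)
  fix rs :: "rat list"
  assume "length rs = Suc (Suc m)" "\<forall>i\<le>Suc m. 0 \<le> rs ! i \<and> ereal (of_rat (rs ! i)) < busy_end_q x"
    "\<forall>i<Suc m. rs ! i < rs ! Suc i \<and> x (of_rat (rs ! i)) \<noteq> x (of_rat (rs ! Suc i))"
  then show "\<exists>rs. length rs = Suc m \<and> (\<forall>i\<le>m. 0 \<le> rs ! i \<and> ereal (of_rat (rs ! i)) < busy_end_q x) \<and>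
    (\<forall>i<m. rs ! i < rs ! Suc i \<and> x (of_rat (rs ! i)) \<noteq> x (of_rat (rs ! Suc i)))"
    by (intro exI[of _ "take (Suc m) rs"]) auto
qed

lemma alternates_antimono: "m \<le> n \<Longrightarrow> alternates x n \<Longrightarrow> alternates x m"
  by (induction rule: inc_induct) (auto intro: alternates_Suc)

definition jumps_in_cycle :: "(real \<Rightarrow> nat \<times> nat) \<Rightarrow> nat \<Rightarrow> bool" where
  "jumps_in_cycle x a \<longleftrightarrow> busy_end_q x < \<infinity> \<and> alternates x a \<and> \<not> alternates x (Suc a)"

lemma jumps_in_cycle_unique: "jumps_in_cycle x a \<Longrightarrow> jumps_in_cycle x b \<Longrightarrow> a = b"
  unfolding jumps_in_cycle_def using alternates_antimono[of "Suc a" b x] alternates_antimono[of "Suc b" a x]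
  by (cases a b rule: linorder_cases) auto

context
  fixes N :: "'w measure" and Q :: "real \<Rightarrow> 'w \<Rightarrow> nat \<times> nat"
  assumes Q: "\<And>t. t \<ge> 0 \<Longrightarrow> Q t \<in> measurable N (count_space UNIV)"
begin

lemma busy_start_q_measurable: "(\<lambda>\<omega>. busy_start_q (\<lambda>t. Q t \<omega>)) \<in> borel_measurable N"
  unfolding busy_start_q_def
proof (rule borel_measurable_INF)
  fix r :: rat assume "r \<in> {r. 0 \<le> r}"
  then have [measurable]: "Q (of_rat r) \<in> measurable N (count_space UNIV)" by (intro Q) simp
  show "(\<lambda>\<omega>. if fst (Q (of_rat r) \<omega>) \<noteq> 0 then ereal (of_rat r) else \<infinity>) \<in> borel_measurable N"
    by measurable
qed simp

lemma busy_end_q_measurable: "(\<lambda>\<omega>. busy_end_q (\<lambda>t. Q t \<omega>)) \<in> borel_measurable N"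
  unfolding busy_end_q_def
proof (rule borel_measurable_INF)
  fix r :: rat assume "r \<in> {r. 0 \<le> r}"
  then have [measurable]: "Q (of_rat r) \<in> measurable N (count_space UNIV)" by (intro Q) simp
  define B where "B \<omega> = busy_start_q (\<lambda>t. Q t \<omega>)" for \<omega>
  have [measurable]: "B \<in> borel_measurable N" unfolding B_def[abs_def] by (rule busy_start_q_measurable)
  have [measurable]: "Measurable.pred N (\<lambda>\<omega>. fst (Q (of_rat r) \<omega>) = 0)"
    by (rule measurable_compose[of "Q (of_rat r)" N "count_space UNIV" "\<lambda>x. fst x = 0"]) simp_all
  show "(\<lambda>\<omega>. if busy_start_q (\<lambda>t. Q t \<omega>) < ereal (of_rat r) \<and> fst (Q (of_rat r) \<omega>) = 0 then ereal (of_rat r) else \<infinity>) \<in> borel_measurable N"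
    unfolding B_def[symmetric] by measurable
qed simp

lemma alternates_measurable: "Measurable.pred N (\<lambda>\<omega>. alternates (\<lambda>t. Q t \<omega>) m)"
proof -
  define R where "R = {rs::rat list. length rs = Suc m \<and> (\<forall>i\<le>m. 0 \<le> rs ! i) \<and> (\<forall>i<m. rs ! i < rs ! Suc i)}"
  have e: "alternates x m \<longleftrightarrow> (\<exists>rs\<in>R. (\<forall>i\<in>{..m}. ereal (of_rat (rs ! i)) < busy_end_q x) \<and>
     (\<forall>i\<in>{..<m}. x (of_rat (rs ! i)) \<noteq> x (of_rat (rs ! Suc i))))" for x
    unfolding alternates_def R_def by auto
  define B where "B \<omega> = busy_end_q (\<lambda>t. Q t \<omega>)" for \<omega>
  have [measurable]: "B \<in> borel_measurable N" unfolding B_def[abs_def] by (rule busy_end_q_measurable)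
  show ?thesis unfolding e B_def[symmetric]
  proof (rule pred_intros_countable_bounded(4))
    fix rs assume rs: "rs \<in> R"
    show "Measurable.pred N (\<lambda>\<omega>. (\<forall>i\<in>{..m}. ereal (of_rat (rs ! i)) < B \<omega>) \<and>
      (\<forall>i\<in>{..<m}. Q (of_rat (rs ! i)) \<omega> \<noteq> Q (of_rat (rs ! Suc i)) \<omega>))"
    proof (intro pred_intros_logic pred_intros_finite)
      fix i assume "i \<in> {..<m}"
      then have [measurable]: "Q (of_rat (rs ! i)) \<in> measurable N (count_space UNIV)" "Q (of_rat (rs ! Suc i)) \<in> measurable N (count_space UNIV)"
        using rs by (auto intro!: Q simp: R_def)
      have "Measurable.pred N (\<lambda>\<omega>. \<exists>c. Q (of_rat (rs ! i)) \<omega> = c \<and> Q (of_rat (rs ! Suc i)) \<omega> = c)" by measurable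
      then show "Measurable.pred N (\<lambda>\<omega>. Q (of_rat (rs ! i)) \<omega> = Q (of_rat (rs ! Suc i)) \<omega>)"
        by (rule measurable_cong[THEN iffD1, rotated]) auto
    qed simp_all
  qed
qed

lemma jumps_in_cycle_measurable: "Measurable.pred N (\<lambda>\<omega>. jumps_in_cycle (\<lambda>t. Q t \<omega>) a)"
proof -
  define B where "B \<omega> = busy_end_q (\<lambda>t. Q t \<omega>)" for \<omega>
  have [measurable]: "B \<in> borel_measurable N" unfolding B_def[abs_def] by (rule busy_end_q_measurable)
  define A where "A m \<omega> = alternates (\<lambda>t. Q t \<omega>) m" for m \<omega>
  have [measurable]: "Measurable.pred N (A m)" for m unfolding A_def[abs_def] by (rule alternates_measurable)
  show ?thesis unfolding jumps_in_cycle_def B_def[symmetric] A_def[symmetric] by measurable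
qed

end

lemma (in queue_path) first_return:
  assumes "\<not> (\<forall>i\<ge>1. z i \<noteq> (0, 0))"
  shows "\<exists>b. z (1 + b) = (0, 0) \<and> (\<forall>i\<in>{1..<1 + b}. z i \<noteq> (0, 0))"
proof -
  obtain i where i: "i \<ge> 1" "z i = (0, 0)" using assms by auto
  define b where "b = (LEAST b. z (1 + b) = (0, 0))"
  have "z (1 + (i - 1)) = (0, 0)" using i by simp
  then have "z (1 + b) = (0, 0)" unfolding b_def by (rule LeastI)
  moreover have "z j \<noteq> (0, 0)" if "j \<in> {1..<1 + b}" for j
  proof -
    have "j - 1 < b" using that by auto
    from not_less_Least[OF this[unfolded b_def]] that show ?thesis by simp
  qed
  ultimately show ?thesis by blast
qed

text \<open>Joins the two descriptions of a cycle: the left side is a functional of the queue path,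
  to which independence applies, and the right side is an event of the jump chain, whose law is
  known.\<close>

lemma (in queue_path) jumps_in_cycle_iff:
  "jumps_in_cycle x a \<longleftrightarrow> z (1 + a) = (0, 0) \<and> (\<forall>i\<in>{1..<1 + a}. z i \<noteq> (0, 0))"
proof
  assume r: "z (1 + a) = (0, 0) \<and> (\<forall>i\<in>{1..<1 + a}. z i \<noteq> (0, 0))"
  then show "jumps_in_cycle x a"
    using busy_end_q_eq[of a] alternates_iff[of a] by (simp add: jumps_in_cycle_def)
next
  assume J: "jumps_in_cycle x a"
  then have "\<not> (\<forall>i\<ge>1. z i \<noteq> (0, 0))"
    using busy_end_q_infinite by (auto simp: jumps_in_cycle_def)
  then obtain b where b: "z (1 + b) = (0, 0)" and b': "\<forall>i\<in>{1..<1 + b}. z i \<noteq> (0, 0)"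
    using first_return by blast
  have "a = b" using J alternates_iff[OF b b'] by (simp add: jumps_in_cycle_def)
  then show "z (1 + a) = (0, 0) \<and> (\<forall>i\<in>{1..<1 + a}. z i \<noteq> (0, 0))" using b b' by simp
qed

lemma (in queue_path) no_cycle:
  "(\<And>a. \<not> jumps_in_cycle x a) \<Longrightarrow> \<forall>i\<ge>1. z i \<noteq> (0, 0)"
  using first_return jumps_in_cycle_iff by blast

lemma (in prob_space) measure_completion_AE_eq:
  assumes T: "T \<in> sets M" and S: "S \<subseteq> space M" and ae: "AE \<omega> in M. \<omega> \<in> S \<longleftrightarrow> \<omega> \<in> T"
  shows "measure (completion M) S = measure M T"
proof -
  have n: "AE \<omega> in M. \<not> (\<omega> \<in> S \<and> \<omega> \<notin> T)" "AE \<omega> in M. \<not> (\<omega> \<in> T \<and> \<omega> \<notin> S)"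
    using ae by (eventually_elim, simp)+
  have "Measurable.pred (completion M) (\<lambda>\<omega>. \<omega> \<in> S \<and> \<omega> \<notin> T)" "Measurable.pred (completion M) (\<lambda>\<omega>. \<omega> \<in> T \<and> \<omega> \<notin> S)"
    using sets_completion_AE[OF n(1)] sets_completion_AE[OF n(2)] by simp_all
  then have m: "{\<omega> \<in> space M. \<omega> \<in> S \<and> \<omega> \<notin> T} \<in> sets (completion M)" "{\<omega> \<in> space M. \<omega> \<in> T \<and> \<omega> \<notin> S} \<in> sets (completion M)"
    by (simp_all add: pred_def)
  have "S = (T \<union> {\<omega> \<in> space M. \<omega> \<in> S \<and> \<omega> \<notin> T}) - {\<omega> \<in> space M. \<omega> \<in> T \<and> \<omega> \<notin> S}"
    using S sets.sets_into_space[OF T] by auto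
  also have "\<dots> \<in> sets (completion M)" using m T by (intro sets.Diff sets.Un) auto
  finally have Sm: "S \<in> sets (completion M)" .
  have "measure (completion M) S = measure (completion M) T"
    by (rule measure_eq_AE[OF AE_completion[OF ae] Sm]) (use T in auto)
  then show ?thesis using T by simp
qed

lemma (in prob_space) restricted_cdf_right_continuous:
  fixes V :: "'a \<Rightarrow> real"
  assumes [measurable]: "E \<in> sets M" "V \<in> borel_measurable M"
  shows "continuous (at_right t) (\<lambda>t. measure M {\<omega> \<in> E. V \<omega> \<le> t})"
  unfolding continuous_within_sequentially
proof safe
  fix X :: "nat \<Rightarrow> real" assume X: "\<forall>n. X n \<in> {t<..}" "X \<longlonglongrightarrow> t"
  have ES: "E \<subseteq> space M" by (rule sets.sets_into_space) simp
  have e: "measure M {\<omega> \<in> E. V \<omega> \<le> u} = (\<integral>\<omega>. indicator E \<omega> * indicator {..u} (V \<omega>) \<partial>M)" for u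
  proof -
    have s: "{\<omega> \<in> E. V \<omega> \<le> u} = {\<omega> \<in> space M. \<omega> \<in> E \<and> V \<omega> \<le> u}" using ES by auto
    have "(\<integral>\<omega>. indicator E \<omega> * indicator {..u} (V \<omega>) \<partial>M) = (\<integral>\<omega>. indicator {\<omega> \<in> space M. \<omega> \<in> E \<and> V \<omega> \<le> u} \<omega> \<partial>M :: real)"
      by (intro Bochner_Integration.integral_cong) (auto simp: indicator_def)
    then show ?thesis unfolding s by simp
  qed
  have "(\<lambda>n. \<integral>\<omega>. indicator E \<omega> * indicator {..X n} (V \<omega>) \<partial>M :: real) \<longlonglongrightarrow> (\<integral>\<omega>. indicator E \<omega> * indicator {..t} (V \<omega>) \<partial>M)"
  proof (rule integral_dominated_convergence[where w = "\<lambda>_. 1::real"])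
    show "AE \<omega> in M. (\<lambda>n. indicator E \<omega> * indicator {..X n} (V \<omega>) :: real) \<longlonglongrightarrow> indicator E \<omega> * indicator {..t} (V \<omega>)"
    proof (intro AE_I2 tendsto_intros)
      fix \<omega>
      show "(\<lambda>n. indicator {..X n} (V \<omega>)) \<longlonglongrightarrow> (indicator {..t} (V \<omega>) :: real)"
      proof (cases "V \<omega> \<le> t")
        case True
        then have "V \<omega> \<le> X n" for n using X(1) by (metis greaterThan_iff less_imp_le order_trans)
        then show ?thesis using True by simp
      next
        case False
        then have "eventually (\<lambda>n. X n < V \<omega>) sequentially" using X(2) by (intro order_tendstoD) auto
        then have "eventually (\<lambda>n. indicator {..X n} (V \<omega>) = (0::real)) sequentially" by eventually_elim simp
        then show ?thesis using False by (simp add: tendsto_eventually)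
      qed
    qed
  qed (auto simp: indicator_def)
  then show "((\<lambda>t. measure M {\<omega> \<in> E. V \<omega> \<le> t}) \<circ> X) \<longlonglongrightarrow> measure M {\<omega> \<in> E. V \<omega> \<le> t}"
    by (simp add: e o_def)
qed

text \<open>By Tonelli, the expectation of exp (- z * V) on E is z times the transform of the
  restricted distribution function. The resulting 1 / z is the one that the exponent 1 / N in
  \<open>h_fun\<close> provides on the other side.\<close>

lemma (in prob_space) restricted_cdf_laplace:
  fixes V :: "'a \<Rightarrow> real"
  assumes [measurable]: "E \<in> sets M" "V \<in> borel_measurable M" and z: "z > 0" and w: "w \<ge> 0"
    and nonneg: "AE \<omega> in M. \<omega> \<in> E \<longrightarrow> V \<omega> \<ge> 0"
    and lt: "(\<integral>\<^sup>+\<omega>. indicator E \<omega> * ennreal (exp (- z * V \<omega>)) \<partial>M) = ennreal w"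
  shows "set_integrable lborel {0<..} (\<lambda>t. exp (- z * t) * measure M {\<omega> \<in> E. V \<omega> \<le> t})"
    and "laplace (\<lambda>t. measure M {\<omega> \<in> E. V \<omega> \<le> t}) z = w / z"
proof -
  define F where "F t = measure M {\<omega> \<in> E. V \<omega> \<le> t}" for t
  have ES: "E \<subseteq> space M" by (rule sets.sets_into_space) simp
  have Es: "{\<omega> \<in> E. V \<omega> \<le> u} = {\<omega> \<in> space M. \<omega> \<in> E \<and> V \<omega> \<le> u}" for u using ES by auto
  have sm [measurable]: "{\<omega> \<in> E. V \<omega> \<le> u} \<in> sets M" for u unfolding Es by measurable
  have F01: "0 \<le> F t" "F t \<le> 1" for t by (simp_all add: F_def)
  have "mono F" unfolding F_def by (intro monoI finite_measure_mono) auto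
  then have [measurable]: "F \<in> borel_measurable borel" by (rule borel_measurable_mono)
  define I where "I t = indicator {0<..} t * (exp (- z * t) * F t)" for t
  have Iint: "integrable lborel I"
  proof (rule Bochner_Integration.integrable_bound)
    show "integrable lborel (\<lambda>t. indicator {0<..} t * (exp (- z * t) * t powr (1 - 1)))"
      using has_bochner_integral_powr_exp[of 1 z] z by (simp add: has_bochner_integral_iff)
    show "I \<in> borel_measurable lborel" unfolding I_def by measurable
    show "AE t in lborel. norm (I t) \<le> norm (indicator {0<..} t * (exp (- z * t) * t powr (1 - 1)))"
      using F01 by (intro AE_I2) (auto simp: I_def indicator_def)
  qed
  then show "set_integrable lborel {0<..} (\<lambda>t. exp (- z * t) * measure M {\<omega> \<in> E. V \<omega> \<le> t})"
    unfolding set_integrable_def I_def F_def by simp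
  have L: "laplace (\<lambda>t. measure M {\<omega> \<in> E. V \<omega> \<le> t}) z = integral\<^sup>L lborel I"
    unfolding laplace_def set_lebesgue_integral_def I_def[abs_def] F_def by simp
  have I0: "0 \<le> I t" for t using F01 by (simp add: I_def)
  have "ennreal w = (\<integral>\<^sup>+t. ennreal (z * exp (- z * t)) * indicator {0..} t * (\<integral>\<^sup>+\<omega>. indicator E \<omega> * indicator {\<omega>. V \<omega> \<le> t} \<omega> \<partial>M) \<partial>lborel)"
    unfolding lt [symmetric]
    by (rule nn_integral_exp_eq_cdf_transform) (use z nonneg in \<open>auto simp: indicator_def\<close>)
  also have "\<dots> = (\<integral>\<^sup>+t. ennreal z * ennreal (I t) \<partial>lborel)"
  proof (rule nn_integral_cong_AE, rule AE_mp[OF AE_lborel_singleton[of 0]], rule AE_I2, rule impI)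
    fix t :: real assume t: "t \<noteq> 0"
    have "(\<integral>\<^sup>+\<omega>. indicator E \<omega> * indicator {\<omega>. V \<omega> \<le> t} \<omega> \<partial>M) = (\<integral>\<^sup>+\<omega>. indicator {\<omega> \<in> E. V \<omega> \<le> t} \<omega> \<partial>M)"
      by (intro nn_integral_cong) (auto simp: indicator_def)
    also have "\<dots> = ennreal (F t)" by (simp add: F_def emeasure_eq_measure)
    finally have e: "(\<integral>\<^sup>+\<omega>. indicator E \<omega> * indicator {\<omega>. V \<omega> \<le> t} \<omega> \<partial>M) = ennreal (F t)" .
    show "ennreal (z * exp (- z * t)) * indicator {0..} t * (\<integral>\<^sup>+\<omega>. indicator E \<omega> * indicator {\<omega>. V \<omega> \<le> t} \<omega> \<partial>M) = ennreal z * ennreal (I t)"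
      unfolding e I_def using t z F01[of t] by (cases "t > 0") (auto simp: ennreal_mult mult_ac)
  qed
  also have "\<dots> = ennreal z * (\<integral>\<^sup>+t. ennreal (I t) \<partial>lborel)"
    using Iint by (intro nn_integral_cmult) auto
  also have "(\<integral>\<^sup>+t. ennreal (I t) \<partial>lborel) = ennreal (integral\<^sup>L lborel I)"
    by (rule nn_integral_eq_integral[OF Iint]) (simp add: I0)
  also have "ennreal z * \<dots> = ennreal (z * integral\<^sup>L lborel I)" using z by (simp add: ennreal_mult')
  finally have "w = z * integral\<^sup>L lborel I"
    using w z I0 by (simp add: integral_nonneg_AE)
  then show "laplace (\<lambda>t. measure M {\<omega> \<in> E. V \<omega> \<le> t}) z = w / z" unfolding L using z by simp
qed

text \<open>The ballot weight for the start level k. One factor k * mu is split off the power of k *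
  mu, which accounts for the exponent lowered by 1 in \<open>A0\<close>; the k + h * k down-steps
  and h up-steps together give the power a0 k k h of 1 / \<theta>.\<close>

lemma hit_weight_A0:
  assumes "k \<ge> 1" "\<theta> > 0"
  shows "hit_weight (real k * mu / \<theta>) (lam / \<theta>) k k (a0 k k h) = real k * mu * A0 lam mu k k h / \<theta> ^ a0 k k h"
proof -
  obtain j where j: "k + h * k = Suc j" using assms by (cases "k + h * k") auto
  have a: "k + h * (k + 1) = (k + h * k) + h" by simp
  have gen: "K * F / (G * H) * (P / T1) * (L / T2) = m * (K * L * P' / (G * H) * F) / (T1 * T2)"
    if "P = m * P'" for K F G H P T1 L T2 m P' :: real
    using that by (simp add: mult_ac)
  have "hit_weight (real k * mu / \<theta>) (lam / \<theta>) k k (a0 k k h) =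
     real k * fact (k + h * (k + 1) - 1) / (fact h * fact (k + h * k)) * ((real k * mu) ^ (k + h * k) / \<theta> ^ (k + h * k)) * (lam ^ h / \<theta> ^ h)"
    unfolding a0_def hit_weight_ballot power_divide using assms by simp
  also have "\<dots> = real k * mu * (real k * lam ^ h * (real k * mu) ^ (k + h * k - 1) / (fact h * fact (k + h * k)) * fact (k + h * (k + 1) - 1)) / (\<theta> ^ (k + h * k) * \<theta> ^ h)"
    by (rule gen) (simp add: j)
  also have "\<theta> ^ (k + h * k) * \<theta> ^ h = \<theta> ^ a0 k k h" unfolding a0_def a power_add ..
  finally show ?thesis unfolding A0_def .
qed

theorem theorem3p9:
  fixes M :: "'w measure"
    and Q :: "real \<Rightarrow> 'w \<Rightarrow> nat \<times> nat"
    and D :: "real \<Rightarrow> 'w \<Rightarrow> real"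
    and lam mu \<alpha>1 \<alpha>2 c1 c2 t :: real
    and k :: nat
  assumes "prob_space M"
    and "lam > 0" and "mu > 0" and "k \<ge> 1"
    and "0 < \<alpha>2" and "\<alpha>2 < \<alpha>1" and "\<alpha>1 < 1"
    and "c1 > 0" and "c2 \<ge> 0" and "c1 + c2 = 1"
    and "erlang_queue M lam mu k Q"
    and "mixed_stable_subordinator M \<alpha>1 \<alpha>2 c1 c2 D"
    and "indep_processes M Q (inverse_process D)"
    and "t > 0"
  shows "(\<lambda>h. real k * mu * A0 lam mu k k h / c1 ^ a0 k k h *
            conv_power (h_fun lam mu k \<alpha>1 \<alpha>2 c1 c2 (a0 k k h)) (a0 k k h) t)
         sums busy_period_cdf M (time_change Q (inverse_process D)) t"
proof -
  interpret prob_space M by fact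
  note lam = assms(2) and mu = assms(3) and k = assms(4) and c1 = assms(8) and c2 = assms(9)
  define \<theta> where "\<theta> = lam + real k * mu"
  have th: "\<theta> > 0" unfolding \<theta>_def using lam mu by (intro add_pos_nonneg) auto
  obtain Z S where Z: "\<And>i. Z i \<in> measurable M (count_space UNIV)" and S: "\<And>i. S i \<in> borel_measurable M"
    and law: "\<And>n z s. (\<And>i. i < n \<Longrightarrow> 0 \<le> s i) \<Longrightarrow>
        measure M {\<omega> \<in> space M. (\<forall>i\<le>n. Z i \<omega> = z i) \<and> (\<forall>i<n. s i < S i \<omega>)} =
          of_bool (z 0 = (0, 0)) * (\<Prod>i<n. jump_prob (erlang_rate lam mu k) (z i) (z (Suc i)) *
            exp (- exit_rate (erlang_rate lam mu k) (z i) * s i))"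
    and path: "AE \<omega> in M. \<forall>n t. (\<Sum>i<n. S i \<omega>) \<le> t \<and> t < (\<Sum>i<Suc n. S i \<omega>) \<longrightarrow> Q t \<omega> = Z n \<omega>"
    using assms(11) unfolding erlang_queue_def markov_chain_with_rates_def by blast
  interpret ec: erlang_chain M lam mu k Z S
    by unfold_locales (rule lam mu k Z S | (rule law, blast))+
  interpret ms: mixed_sub M \<alpha>1 \<alpha>2 c1 c2 D
    using assms by unfold_locales auto
  let ?A = "process_algebra M (count_space UNIV) Q"
  have indep: "indep_set (sets ?A) (sets (process_algebra M borel (inverse_process D)))"
    using assms(13) by (simp add: indep_processes_def)
  have QA: "Q t \<in> measurable ?A (count_space UNIV)" if "t \<ge> 0" for t
    by (rule process_algebra_component[OF that]) simp
  note meas = busy_start_q_measurable[of Q ?A, OF QA] busy_end_q_measurable[of Q ?A, OF QA] jumps_in_cycle_measurable[of Q ?A, OF QA]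
  define sg where "sg \<omega> = real_of_ereal (busy_start_q (\<lambda>t. Q t \<omega>))" for \<omega>
  define rh where "rh \<omega> = real_of_ereal (busy_end_q (\<lambda>t. Q t \<omega>))" for \<omega>
  \<comment> \<open>The event is defined through the path of Q rather than the jump chain Z, so that
    it lies in the algebra of the queue.\<close>
  define E where "E a = {\<omega> \<in> space M. jumps_in_cycle (\<lambda>t. Q t \<omega>) a}" for a
  have sgA: "sg \<in> borel_measurable ?A" and rhA: "rh \<in> borel_measurable ?A"
    unfolding sg_def rh_def using meas by simp_all
  have EA: "E a \<in> sets ?A" for a
    using meas(3)[of a] unfolding E_def pred_def by simp
  have EM [measurable]: "E a \<in> sets M" for a using EA indep_setD_ev1[OF indep] by blast
  have sgM: "sg \<in> borel_measurable M" and rhM: "rh \<in> borel_measurable M"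
    using sgA rhA by (auto intro: measurable_coarser[OF _ indep_setD_ev1[OF indep]])
  have good: "AE \<omega> in M. queue_path (\<lambda>t. Q t \<omega>) (\<lambda>i. Z i \<omega>) (\<lambda>i. S i \<omega>)"
  proof -
    have bdd: "exit_rate (erlang_rate lam mu k) x \<le> \<theta>" if "x \<in> erlang_states k" for x
      using erlang_exit_rate[OF k that] erlang_exit_rate_empty[OF k] mu by (cases "x = (0, 0)") (auto simp: \<theta>_def)
    have nonexplosion: "AE \<omega> in M. \<forall>K. \<exists>n. K < (\<Sum>i<n. S i \<omega>)"
      by (rule ec.AE_nonexplosion) (rule bdd)
    show ?thesis
      using ec.AE_valid nonexplosion path
    proof eventually_elim
      case (elim \<omega>)
      have st: "Z i \<omega> \<in> erlang_states k" for i
      proof (induction i)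
        case 0 then show ?case using elim(1) by (simp add: erlang_states_def)
      next
        case (Suc i) then show ?case using elim(1) ec.succ_V by blast
      qed
      show ?case
      proof
        show "S i \<omega> > 0" for i using elim(1) by blast
        show "\<exists>n. K < (\<Sum>i<n. S i \<omega>)" for K using elim(2) by blast
        show "Q t \<omega> = Z n \<omega>" if "(\<Sum>i<n. S i \<omega>) \<le> t" "t < (\<Sum>i<Suc n. S i \<omega>)" for n t
          using elim(3) that by blast
        show Z0: "Z 0 \<omega> = (0, 0)" using elim(1) by blast
        have "Z (Suc 0) \<omega> \<in> erlang_succ k (Z 0 \<omega>)" using elim(1) by blast
        then show "Z 1 \<omega> \<noteq> (0, 0)" using Z0 by (simp add: erlang_succ_def)
        show "Z (Suc i) \<omega> \<noteq> Z i \<omega>" for i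
          using elim(1) erlang_succ_not_self[OF k st[of i]] by metis
        show "fst (Z i \<omega>) = 0 \<longleftrightarrow> Z i \<omega> = (0, 0)" for i
          using st[of i] by (auto simp: erlang_states_def)
      qed
    qed
  qed
  have E_iff: "AE \<omega> in M. \<forall>a. \<omega> \<in> E a \<longleftrightarrow> ec.returns 1 a \<omega>"
    using good AE_space
  proof eventually_elim
    case (elim \<omega>)
    interpret queue_path "\<lambda>t. Q t \<omega>" "\<lambda>i. Z i \<omega>" "\<lambda>i. S i \<omega>" by fact
    show ?case using elim jumps_in_cycle_iff by (simp add: E_def ec.returns_def)
  qed
  have times: "AE \<omega> in M. \<forall>a. \<omega> \<in> E a \<longrightarrow> 0 < sg \<omega> \<and> sg \<omega> < rh \<omega> \<and> rh \<omega> - sg \<omega> = (\<Sum>i\<in>{1..<1 + a}. S i \<omega>)"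
    using good E_iff
  proof eventually_elim
    case (elim \<omega>)
    interpret queue_path "\<lambda>t. Q t \<omega>" "\<lambda>i. Z i \<omega>" "\<lambda>i. S i \<omega>" by fact
    show ?case
    proof (intro allI impI)
      fix a assume "\<omega> \<in> E a"
      then have r: "Z (1 + a) \<omega> = (0, 0)" "\<forall>i\<in>{1..<1 + a}. Z i \<omega> \<noteq> (0, 0)"
        using elim by (auto simp: ec.returns_def)
      have a: "a > 0" using r(1) z1 by (cases a) auto
      have e: "sg \<omega> = p 1" "rh \<omega> = p (1 + a)"
        using busy_start_q_eq busy_end_q_eq[OF r] by (simp_all add: sg_def rh_def)
      have "p (1 + a) = p 1 + (\<Sum>i\<in>{1..<1 + a}. S i \<omega>)"
        unfolding p_def lessThan_atLeast0 by (rule sum.atLeastLessThan_concat [symmetric]) auto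
      then show "0 < sg \<omega> \<and> sg \<omega> < rh \<omega> \<and> rh \<omega> - sg \<omega> = (\<Sum>i\<in>{1..<1 + a}. S i \<omega>)"
        unfolding e using p_pos[of 1] p_less[of 1 "1 + a"] a by simp
    qed
  qed
  \<comment> \<open>On completed cycles V agrees almost surely with the busy period of the
    time-changed queue.\<close>
  obtain V where Vm [measurable]: "V \<in> borel_measurable M"
    and V: "AE \<omega> in M. 0 < sg \<omega> \<and> 0 < rh \<omega> \<longrightarrow> V \<omega> = left_lim (\<lambda>t. D t \<omega>) (rh \<omega>) - left_lim (\<lambda>t. D t \<omega>) (sg \<omega>)"
    using ms.left_lim_difference_measurable[OF sgM rhM] by blast
  define F where "F a t = measure M {\<omega> \<in> E a. V \<omega> \<le> t}" for a t
  have VE: "AE \<omega> in M. \<omega> \<in> E a \<longrightarrow> V \<omega> = left_lim (\<lambda>t. D t \<omega>) (rh \<omega>) - left_lim (\<lambda>t. D t \<omega>) (sg \<omega>)" for a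
    using V times by eventually_elim auto
  have V0: "AE \<omega> in M. \<omega> \<in> E a \<longrightarrow> V \<omega> \<ge> 0" for a
    using VE[of a] times ms.AE_subordinator_path
  proof eventually_elim
    case (elim \<omega>)
    interpret subordinator_path "\<lambda>t. D t \<omega>" by fact
    show ?case using elim left_lim_strict[of "sg \<omega>" "rh \<omega>"] by force
  qed
  define w where "w a z = hit_weight (real k * mu / (\<theta> + ms.phi z)) (lam / (\<theta> + ms.phi z)) k k a" for a z
  have w0: "w a z \<ge> 0" if "z > 0" for a z
    unfolding w_def using lam mu th ms.phi_pos[OF that] by (intro hit_weight_nonneg divide_nonneg_nonneg) auto
  have LT: "(\<integral>\<^sup>+\<omega>. indicator (E a) \<omega> * ennreal (exp (- z * V \<omega>)) \<partial>M) = ennreal (w a z)" if z: "z > 0" for a z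
  proof -
    have "(\<integral>\<^sup>+\<omega>. indicator (E a) \<omega> * ennreal (exp (- z * V \<omega>)) \<partial>M) =
      (\<integral>\<^sup>+\<omega>. indicator (E a) \<omega> * ennreal (exp (- ms.phi z * (rh \<omega> - sg \<omega>))) \<partial>M)"
    proof (rule ms.time_changed_laplace[OF indep _ sgA rhA EA _ Vm VE z])
      show "AE \<omega> in M. \<omega> \<in> E a \<longrightarrow> 0 < sg \<omega> \<and> sg \<omega> < rh \<omega>" using times by eventually_elim auto
    qed simp
    also have "\<dots> = (\<integral>\<^sup>+\<omega>. ennreal (exp (- ms.phi z * (\<Sum>i\<in>{1..<1 + a}. S i \<omega>))) * indicator {\<omega>. ec.returns 1 a \<omega>} \<omega> \<partial>M)"
    proof (rule nn_integral_cong_AE, use E_iff times in eventually_elim)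
      fix \<omega> assume e: "\<forall>a. \<omega> \<in> E a \<longleftrightarrow> ec.returns 1 a \<omega>"
        and t: "\<forall>a. \<omega> \<in> E a \<longrightarrow> 0 < sg \<omega> \<and> sg \<omega> < rh \<omega> \<and> rh \<omega> - sg \<omega> = (\<Sum>i\<in>{1..<1 + a}. S i \<omega>)"
      show "indicator (E a) \<omega> * ennreal (exp (- ms.phi z * (rh \<omega> - sg \<omega>))) =
        ennreal (exp (- ms.phi z * (\<Sum>i\<in>{1..<1 + a}. S i \<omega>))) * indicator {\<omega>. ec.returns 1 a \<omega>} \<omega>"
      proof (cases "\<omega> \<in> E a")
        case True
        then have "rh \<omega> - sg \<omega> = (\<Sum>i\<in>{1..<1 + a}. S i \<omega>)" "ec.returns 1 a \<omega>" using e t by blast+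
        then show ?thesis using True by (simp only: indicator_simps mem_Collect_eq mult_1_left mult_1_right)
      next
        case False
        then have "\<not> ec.returns 1 a \<omega>" using e by blast
        then show ?thesis using False by simp
      qed
    qed
    also have "\<dots> = ennreal (w a z)"
      unfolding w_def \<theta>_def by (rule ec.return_transform[OF ms.phi_pos[OF z]])
    finally show ?thesis .
  qed
  \<comment> \<open>No walk from k to 0 has such a length, so the transform vanishes already at z =
    1; its integrand is positive on E a, which is therefore null.\<close>
  have F_zero: "F a t = 0" if "a \<notin> range (a0 k k)" for a
  proof -
    have "a \<noteq> k + h * (k + 1)" for h using that by (auto simp: a0_def)
    then have "w a 1 = 0" unfolding w_def by (rule hit_weight_zero)
    then have "(\<integral>\<^sup>+\<omega>. indicator (E a) \<omega> * ennreal (exp (- 1 * V \<omega>)) \<partial>M) = 0" using LT[of 1 a] by simp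
    then have "AE \<omega> in M. indicator (E a) \<omega> * ennreal (exp (- 1 * V \<omega>)) = 0"
      by (subst (asm) nn_integral_0_iff_AE) measurable
    then have "AE \<omega> in M. \<omega> \<notin> E a" by eventually_elim (auto simp: indicator_def split: if_splits)
    then have "measure M {\<omega> \<in> E a. V \<omega> \<le> t} = measure M {}"
      using EM[of a] sets.sets_into_space[OF EM[of a]]
      by (intro measure_eq_AE) (auto elim!: eventually_mono intro!: sets.sets_Collect)
    then show ?thesis by (simp add: F_def)
  qed
  obtain c where c: "c > 0" and conv: "\<And>N. N \<ge> 1 \<Longrightarrow> \<exists>b>0. \<exists>C. tame b c C (conv_power (h_fun lam mu k \<alpha>1 \<alpha>2 c1 c2 N) N) \<and>
    (\<forall>z>c. laplace (conv_power (h_fun lam mu k \<alpha>1 \<alpha>2 c1 c2 N) N) z =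
       c1 ^ N / (z * (lam + real k * mu + (c1 * z powr \<alpha>1 + c2 * z powr \<alpha>2)) ^ N))"
    using conv_power_h_fun_laplace[OF c1 c2 assms(5,6), of lam k mu] th unfolding \<theta>_def by blast
  have F_term: "F (a0 k k h) t = real k * mu * A0 lam mu k k h / c1 ^ a0 k k h *
            conv_power (h_fun lam mu k \<alpha>1 \<alpha>2 c1 c2 (a0 k k h)) (a0 k k h) t" for h
  proof -
    define N where "N = a0 k k h"
    define H where "H = conv_power (h_fun lam mu k \<alpha>1 \<alpha>2 c1 c2 N) N"
    define K where "K = real k * mu * A0 lam mu k k h / c1 ^ N"
    have N: "N \<ge> 1" using k by (simp add: N_def a0_def)
    obtain b C where b: "b > 0" and C: "tame b c C H"
      and HL: "\<And>z. z > c \<Longrightarrow> laplace H z = c1 ^ N / (z * (\<theta> + ms.phi z) ^ N)"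
      using conv[OF N] unfolding H_def \<theta>_def ms.phi_def by blast
    have "F N t = K * H t"
    \<comment> \<open>K cancels the factor c1 ^ N of the convolution power, and the remaining factor
      is the ballot weight over z. F N is right-continuous as a restricted distribution function,
      and H is continuous because it is tame.\<close>
    proof (rule laplace_unique[where c = c and f = "F N" and g = "\<lambda>t. K * H t"])
      fix z assume z: "z > c"
      then have z0: "z > 0" using c by simp
      note R = restricted_cdf_laplace[OF EM Vm z0 w0[OF z0] V0 LT[OF z0]]
      show "set_integrable lborel {0<..} (\<lambda>t. exp (- z * t) * F N t)" unfolding F_def by (rule R(1))
      have "set_integrable lborel {0<..} (\<lambda>t. K * (exp (- z * t) * H t))"
        by (intro set_integrable_mult_right tame_laplace_integrable[OF C b z])
      then show "set_integrable lborel {0<..} (\<lambda>t. exp (- z * t) * (K * H t))"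
        by (simp add: mult.left_commute)
      have "laplace (\<lambda>t. K * H t) z = (LINT t:{0<..}|lborel. K * (exp (- z * t) * H t))"
        unfolding laplace_def by (simp add: mult.left_commute)
      also have "\<dots> = K * laplace H z" unfolding laplace_def by (rule set_integral_mult_right)
      also have "\<dots> = K * (c1 ^ N / (z * (\<theta> + ms.phi z) ^ N))" unfolding HL[OF z] ..
      also have "\<dots> = (real k * mu * A0 lam mu k k h / (\<theta> + ms.phi z) ^ N) / z"
        using c1 by (simp add: K_def)
      also have "\<dots> = w N z / z"
        unfolding w_def N_def using th ms.phi_pos[OF z0] by (subst hit_weight_A0[OF k]) auto
      also have "\<dots> = laplace (F N) z" using R(2)[of N] by (simp add: F_def[abs_def])
      finally show "laplace (F N) z = laplace (\<lambda>t. K * H t) z" by simp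
    next
      fix t :: real assume t: "t > 0"
      show "continuous (at_right t) (F N)" unfolding F_def[abs_def]
        by (rule restricted_cdf_right_continuous) measurable
      have "isCont H t" using C t unfolding tame_def by (simp add: continuous_on_eq_continuous_at)
      then have "continuous (at_right t) H" by (rule continuous_at_imp_continuous_at_within)
      then show "continuous (at_right t) (\<lambda>t. K * H t)" by (intro continuous_intros)
    qed (use assms(14) in simp)
    then show ?thesis by (simp add: N_def K_def H_def)
  qed
  define T where "T a = {\<omega> \<in> E a. V \<omega> \<le> t}" for a
  have Tm: "T a \<in> sets M" for a
  proof -
    have "T a = {\<omega> \<in> space M. \<omega> \<in> E a \<and> V \<omega> \<le> t}" using sets.sets_into_space[OF EM[of a]] by (auto simp: T_def)
    also have "\<dots> \<in> sets M" by measurable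
    finally show ?thesis .
  qed
  have "disjoint_family T"
    unfolding disjoint_family_on_def T_def E_def using jumps_in_cycle_unique by blast
  then have sums: "(\<lambda>a. F a t) sums measure M (\<Union>a. T a)"
    unfolding F_def T_def[symmetric] using Tm by (intro finite_measure_UNION) auto
  have cdf: "busy_period_cdf M (time_change Q (inverse_process D)) t = measure M (\<Union>a. T a)"
    unfolding busy_period_cdf_def
  proof (rule measure_completion_AE_eq)
    show "(\<Union>a. T a) \<in> sets M" using Tm by blast
    show "AE \<omega> in M. \<omega> \<in> {\<omega> \<in> space M. busy_period (\<lambda>s. time_change Q (inverse_process D) s \<omega>) \<le> ereal t} \<longleftrightarrow> \<omega> \<in> (\<Union>a. T a)"
      using good E_iff times V ms.AE_subordinator_path AE_space
    proof eventually_elim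
      case (elim \<omega>)
      interpret q: queue_path "\<lambda>t. Q t \<omega>" "\<lambda>i. Z i \<omega>" "\<lambda>i. S i \<omega>" by fact
      interpret d: subordinator_path "\<lambda>t. D t \<omega>" by fact
      have tc: "(\<lambda>s. time_change Q (inverse_process D) s \<omega>) = (\<lambda>s. Q (d.y s) \<omega>)"
        by (simp add: time_change_def inverse_process_def d.y_def fun_eq_iff)
      show ?case
      proof (cases "\<exists>a. \<omega> \<in> E a")
        case True
        then obtain a where a: "\<omega> \<in> E a" by blast
        then have r: "Z (1 + a) \<omega> = (0, 0)" "\<forall>i\<in>{1..<1 + a}. Z i \<omega> \<noteq> (0, 0)"
          using elim(2) by (auto simp: ec.returns_def)
        have sr: "0 < sg \<omega>" "sg \<omega> < rh \<omega>" using elim(3) a by blast+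
        have e: "sg \<omega> = q.p 1" "rh \<omega> = q.p (1 + a)"
          using q.busy_start_q_eq q.busy_end_q_eq[OF r] by (simp_all add: sg_def rh_def)
        have "busy_period (\<lambda>s. Q (d.y s) \<omega>) = ereal (left_lim (\<lambda>t. D t \<omega>) (rh \<omega>) - left_lim (\<lambda>t. D t \<omega>) (sg \<omega>))"
        proof (rule d.busy_period_time_change[where x = "\<lambda>t. Q t \<omega>" and \<rho>' = "q.p (Suc (1 + a))"])
          show "rh \<omega> < q.p (Suc (1 + a))" unfolding e by (rule q.p_less) simp
          show "fst (Q u \<omega>) = 0" if "0 \<le> u" "u < sg \<omega>" for u using q.fst_before that e by simp
          show "fst (Q u \<omega>) \<noteq> 0" if "sg \<omega> \<le> u" "u < rh \<omega>" for u using q.fst_busy[OF r(2)] that e by simp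
          show "fst (Q u \<omega>) = 0" if "rh \<omega> \<le> u" "u < q.p (Suc (1 + a))" for u using q.fst_after[OF r(1)] that e by simp
        qed (use sr in auto)
        also have "\<dots> = ereal (V \<omega>)" using elim(4) sr by simp
        finally have "busy_period (\<lambda>s. Q (d.y s) \<omega>) = ereal (V \<omega>)" .
        then have "busy_period (\<lambda>s. time_change Q (inverse_process D) s \<omega>) = ereal (V \<omega>)" unfolding tc .
        then show ?thesis unfolding T_def using True elim(6) by auto
      next
        case False
        then have "\<And>a. \<not> jumps_in_cycle (\<lambda>t. Q t \<omega>) a" using elim(6) by (simp add: E_def)
        then have nz: "\<forall>i\<ge>1. Z i \<omega> \<noteq> (0, 0)" by (rule q.no_cycle)
        \<comment> \<open>A chain that never returns to the empty state keeps the time-changed queue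
          busy forever, so such paths belong to neither event.\<close>
        have "busy_period (\<lambda>s. Q (d.y s) \<omega>) = \<infinity>"
          by (rule d.busy_period_time_change_infinite[where x = "\<lambda>t. Q t \<omega>" and \<sigma> = "q.p 1"])
            (use q.p_pos[of 1] q.fst_before q.fst_never[OF nz] in auto)
        then have "busy_period (\<lambda>s. time_change Q (inverse_process D) s \<omega>) = \<infinity>" unfolding tc .
        then show ?thesis unfolding T_def using False by auto
      qed
    qed
  qed auto
  have sm: "strict_mono (a0 k k)" by (auto simp: strict_mono_Suc_iff a0_def)
  \<comment> \<open>Only lengths of the form a0 k k h contribute, so the sum over all jump counts is
    reindexed by the number h of arrivals during the busy period.\<close>
  have "(\<lambda>h. F (a0 k k h) t) sums measure M (\<Union>a. T a)"
    using sums_mono_reindex[OF sm, of "\<lambda>a. F a t"] F_zero sums by blast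
  then show ?thesis unfolding cdf F_term .
qed

end
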